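(* Let $S$ be a commutative ring, let $\mathsf{C}$ be an additive self-orthogonal subcategory of $\mathrm{Mod}(S)$, let $f\in S$ be $S$-regular and $\mathsf{C}$-divisible, and set $R=S/(f)$. There is a triangulated functor $\widetilde{\mathsf{T}}:\mathsf{HF}(\mathsf{C},f)\to \mathsf{K}_{\mathrm{tac}}(\mathrm{Hom}_S(R,\mathsf{C}))$ that is full and faithful.
   Context: Subcategories of $\mathrm{Mod}(S)$, the category of $S$-modules, are full and closed under isomorphisms. $\mathsf{C}$ is self-orthogonal if $\mathrm{Ext}_S^i(C,C')=0$ for all $C,C'\in\mathsf{C}$, $i\ge 1$ (similarly over $R$). The element $f$ is $S$-regular if it is a nonzerodivisor on $S$; it is $M$-divisible if for every $x\in M$ there is $y\in M$ with $fy=x$, and $\mathsf{C}$-divisible if it is $M$-divisible for every $M\in\mathsf{C}$. $\mathrm{Hom}_S(R,\mathsf{C})$ is the category of $R$-modules isomorphic to $\mathrm{Hom}_S(R,C)$ for some $C\in\mathsf{C}$; under the given hypotheses it is self-orthogonal in $\mathrm{Mod}(R)$. A $\mathsf{C}$-factorization $(M,d)$ of $f$ consists of $M_0,M_1\in\mathsf{C}$ and $S$-linear maps $d_1:M_1\to M_0$, $d_0:M_0\to M_1$ with $d_1d_0=f1^{M_0}$, $d_0d_1=f1^{M_1}$. A morphism $\alpha:(M,d)\to(M',d')$ is a pair $\alpha_i:M_i\to M_i'$ ($i=0,1$) with $\alpha_0d_1=d_1'\alpha_1$ and $\alpha_1d_0=d_0'\alpha_0$. Morphisms $\alpha,\beta$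 are homotopic if there are $h_0:M_0\to M_1'$, $h_1:M_1\to M_0'$ with $\alpha_0-\beta_0=h_1d_0+d_1'h_0$ and $\alpha_1-\beta_1=h_0d_1+d_0'h_1$. $\mathsf{HF}(\mathsf{C},f)$ has $\mathsf{C}$-factorizations of $f$ as objects and homotopy classes of morphisms as morphisms. It carries the usual triangulated structure: the shift interchanges $M_0$ and $M_1$ and changes the sign of $d$; exact triangles are those isomorphic to the ones coming from mapping cones, where the cone of $\alpha:M\to M'$ has components $M_i'\oplus M_{i-1}$ (indices mod 2) and differential $\begin{pmatrix} d' & \alpha\\ 0&-d\end{pmatrix}$. For a self-orthogonal category $\mathsf{W}$ of $R$-modules, an $R$-complex $T$ is $\mathsf{W}$-totally acyclic if it is acyclic, $T_i\in\mathsf{W}$ for all $i\in\mathbb{Z}$, and $\mathrm{Hom}_R(T,W)$ and $\mathrm{Hom}_R(W,T)$ are acyclic for every $W\in\mathsf{W}$. $\mathsf{K}_{\mathrm{tac}}(\mathsf{W})$ is the homotopy category of $\mathsf{W}$-totally acyclic complexes (morphisms are homotopy classes of degree $0$ chain maps), with its usual triangulated structure. *)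

theory Defs
  imports "HOL-Library.FSet" "HOL-Library.Z2" "HOL-Algebra.QuotRing" "HOL-Algebra.Module" "HOL-Algebra.Elementary_Groups"
begin

section \<open>Linear maps\<close>

text \<open>
  Linear maps are extensional outside the carrier of their source, so that equality of linear
  maps is equality of HOL functions.  The fields \<open>mult\<close> and \<open>one\<close> that the record of modules
  inherits from rings have no meaning for modules.
\<close>

definition linear_maps ::
  "('s, 'e) ring_scheme \<Rightarrow> ('s, 'm) module \<Rightarrow> ('s, 'n) module \<Rightarrow> ('m \<Rightarrow> 'n) set"
  where "linear_maps S M N =
    {h \<in> carrier M \<rightarrow>\<^sub>E carrier N.
       (\<forall>x\<in>carrier M. \<forall>y\<in>carrier M. h (x \<oplus>\<^bsub>M\<^esub> y) = h x \<oplus>\<^bsub>N\<^esub> h y) \<and>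
       (\<forall>a\<in>carrier S. \<forall>x\<in>carrier M. h (a \<odot>\<^bsub>M\<^esub> x) = a \<odot>\<^bsub>N\<^esub> h x)}"

definition module_iso ::
  "('s, 'e) ring_scheme \<Rightarrow> ('s, 'm) module \<Rightarrow> ('s, 'n) module \<Rightarrow> bool"
  where "module_iso S M N \<longleftrightarrow> (\<exists>h\<in>linear_maps S M N. bij_betw h (carrier M) (carrier N))"

definition add_map ::
  "('s, 'm) module \<Rightarrow> ('s, 'n) module \<Rightarrow> ('m \<Rightarrow> 'n) \<Rightarrow> ('m \<Rightarrow> 'n) \<Rightarrow> 'm \<Rightarrow> 'n"
  where "add_map M N g h = (\<lambda>x\<in>carrier M. g x \<oplus>\<^bsub>N\<^esub> h x)"

definition direct_sum :: "('s, 'm) module \<Rightarrow> ('s, 'n) module \<Rightarrow> ('s, 'm \<times> 'n) module"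
  where "direct_sum M N =
    \<lparr>carrier = carrier M \<times> carrier N, mult = undefined, one = undefined,
     zero = (\<zero>\<^bsub>M\<^esub>, \<zero>\<^bsub>N\<^esub>), add = (\<lambda>(x, y) (x', y'). (x \<oplus>\<^bsub>M\<^esub> x', y \<oplus>\<^bsub>N\<^esub> y')),
     smult = (\<lambda>a (x, y). (a \<odot>\<^bsub>M\<^esub> x, a \<odot>\<^bsub>N\<^esub> y))\<rparr>"

definition hom_module ::
  "('s, 'e) ring_scheme \<Rightarrow> ('s, 'm) module \<Rightarrow> ('s, 'n) module \<Rightarrow> ('s, 'm \<Rightarrow> 'n) module"
  where "hom_module S M N =
    \<lparr>carrier = linear_maps S M N, mult = undefined, one = undefined,
     zero = (\<lambda>x\<in>carrier M. \<zero>\<^bsub>N\<^esub>), add = add_map M N,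
     smult = (\<lambda>a h. \<lambda>x\<in>carrier M. a \<odot>\<^bsub>N\<^esub> h x)\<rparr>"


section \<open>Ext\<close>

text \<open>
  \<open>Ext\<close> is computed from the standard free resolution
  \<open>\<dots> \<rightarrow> F\<^sub>1 \<rightarrow> F\<^sub>0 \<rightarrow> M \<rightarrow> 0\<close>: \<open>F\<^sub>0\<close> is free on the elements of \<open>M\<close>,
  and each further term is free on the elements of the kernel of the preceding map.  To have all
  terms over one carrier type, the elements of a kernel, which are formal linear combinations of
  generators, are encoded as generators again; \<open>inv_into\<close> decodes a generator to the element it
  stands for.
\<close>

datatype ('s, 'm) generator = Gen 'm | Syz "(('s, 'm) generator \<times> 's) fset"

definition free_module :: "('s, 'e) ring_scheme \<Rightarrow> 'g set \<Rightarrow> ('s, 'g \<Rightarrow> 's) module"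
  where "free_module S G =
    \<lparr>carrier = {c. range c \<subseteq> carrier S \<and> finite {g. c g \<noteq> \<zero>\<^bsub>S\<^esub>} \<and> {g. c g \<noteq> \<zero>\<^bsub>S\<^esub>} \<subseteq> G},
     mult = undefined, one = undefined,
     zero = (\<lambda>g. \<zero>\<^bsub>S\<^esub>), add = (\<lambda>c c' g. c g \<oplus>\<^bsub>S\<^esub> c' g), smult = (\<lambda>a c g. a \<otimes>\<^bsub>S\<^esub> c g)\<rparr>"

definition lin_ext ::
  "('s, 'e) ring_scheme \<Rightarrow> 'g set \<Rightarrow> ('s, 'n) module \<Rightarrow> ('g \<Rightarrow> 'n) \<Rightarrow> ('g \<Rightarrow> 's) \<Rightarrow> 'n"
  where "lin_ext S G N \<phi> =
    (\<lambda>c\<in>carrier (free_module S G). \<Oplus>\<^bsub>N\<^esub>g\<in>{g. c g \<noteq> \<zero>\<^bsub>S\<^esub>}. c g \<odot>\<^bsub>N\<^esub> \<phi> g)"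

definition syz_code ::
  "('s, 'e) ring_scheme \<Rightarrow> (('s, 'm) generator \<Rightarrow> 's) \<Rightarrow> ('s, 'm) generator"
  where "syz_code S c = Syz (Abs_fset ((\<lambda>g. (g, c g)) ` {g. c g \<noteq> \<zero>\<^bsub>S\<^esub>}))"

definition augmentation ::
  "('s, 'e) ring_scheme \<Rightarrow> ('s, 'm) module \<Rightarrow> (('s, 'm) generator \<Rightarrow> 's) \<Rightarrow> 'm"
  where "augmentation S M = lin_ext S (Gen ` carrier M) M (inv_into (carrier M) Gen)"

text \<open>
  The set of generators of \<open>F\<^sub>n\<close>, and the kernel of the map from \<open>F\<^sub>n\<close> to its predecessor
  (to \<open>M\<close> if \<open>n = 0\<close>).
\<close>

primrec res_data ::
  "('s, 'e) ring_scheme \<Rightarrow> ('s, 'm) module \<Rightarrow> nat \<Rightarrow>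
    ('s, 'm) generator set \<times> (('s, 'm) generator \<Rightarrow> 's) set"
  where
    "res_data S M 0 =
      (Gen ` carrier M, a_kernel (free_module S (Gen ` carrier M)) M (augmentation S M))"
  | "res_data S M (Suc n) =
      (let (G, K) = res_data S M n; G' = syz_code S ` K
       in (G', a_kernel (free_module S G') (free_module S G)
                 (lin_ext S G' (free_module S G) (inv_into K (syz_code S)))))"

definition res_module ::
  "('s, 'e) ring_scheme \<Rightarrow> ('s, 'm) module \<Rightarrow> nat \<Rightarrow> ('s, ('s, 'm) generator \<Rightarrow> 's) module"
  where "res_module S M n = free_module S (fst (res_data S M n))"

text \<open>\<open>res_map S M n\<close> is the differential from \<open>F\<^sub>n\<^sub>+\<^sub>1\<close> to \<open>F\<^sub>n\<close>.\<close>

definition res_map ::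
  "('s, 'e) ring_scheme \<Rightarrow> ('s, 'm) module \<Rightarrow> nat \<Rightarrow>
    (('s, 'm) generator \<Rightarrow> 's) \<Rightarrow> ('s, 'm) generator \<Rightarrow> 's"
  where "res_map S M n =
    lin_ext S (fst (res_data S M (Suc n))) (res_module S M n)
      (inv_into (snd (res_data S M n)) (syz_code S))"

definition ext_cocycles ::
  "('s, 'e) ring_scheme \<Rightarrow> nat \<Rightarrow> ('s, 'm) module \<Rightarrow> ('s, 'n) module \<Rightarrow>
    ((('s, 'm) generator \<Rightarrow> 's) \<Rightarrow> 'n) set"
  where "ext_cocycles S n M N =
    {\<phi> \<in> linear_maps S (res_module S M n) N.
       \<forall>x\<in>carrier (res_module S M (Suc n)). \<phi> (res_map S M n x) = \<zero>\<^bsub>N\<^esub>}"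

definition ext_coboundaries ::
  "('s, 'e) ring_scheme \<Rightarrow> nat \<Rightarrow> ('s, 'm) module \<Rightarrow> ('s, 'n) module \<Rightarrow>
    ((('s, 'm) generator \<Rightarrow> 's) \<Rightarrow> 'n) set"
  where "ext_coboundaries S n M N =
    (case n of
       0 \<Rightarrow> {\<zero>\<^bsub>hom_module S (res_module S M 0) N\<^esub>}
     | Suc k \<Rightarrow> (\<lambda>\<psi>. compose (carrier (res_module S M n)) \<psi> (res_map S M k)) `
                  linear_maps S (res_module S M k) N)"

definition Ext ::
  "('s, 'e) ring_scheme \<Rightarrow> nat \<Rightarrow> ('s, 'm) module \<Rightarrow> ('s, 'n) module \<Rightarrow>
    ((('s, 'm) generator \<Rightarrow> 's) \<Rightarrow> 'n) set monoid"
  where "Ext S n M N =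
    add_monoid (hom_module S (res_module S M n) N \<lparr>carrier := ext_cocycles S n M N\<rparr>)
      Mod ext_coboundaries S n M N"


section \<open>Subcategories of modules\<close>

text \<open>
  A full subcategory is given by its set of objects; its modules have carriers in a fixed type,
  which plays the role of a universe.
\<close>

definition additive_subcategory :: "('s, 'e) ring_scheme \<Rightarrow> ('s, 'm) module set \<Rightarrow> bool"
  where "additive_subcategory S C \<longleftrightarrow>
    (\<forall>M\<in>C. module S M) \<and>
    (\<forall>M\<in>C. \<forall>N. module S N \<and> module_iso S M N \<longrightarrow> N \<in> C) \<and>
    (\<exists>Z\<in>C. carrier Z = {\<zero>\<^bsub>Z\<^esub>}) \<and>
    (\<forall>M\<in>C. \<forall>N\<in>C. \<exists>P\<in>C. module_iso S P (direct_sum M N))"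

definition self_orthogonal :: "('s, 'e) ring_scheme \<Rightarrow> ('s, 'm) module set \<Rightarrow> bool"
  where "self_orthogonal S C \<longleftrightarrow> (\<forall>M\<in>C. \<forall>N\<in>C. \<forall>i\<ge>1. trivial_group (Ext S i M N))"

definition regular_element :: "('s, 'e) ring_scheme \<Rightarrow> 's \<Rightarrow> bool"
  where "regular_element S f \<longleftrightarrow>
    f \<in> carrier S \<and> (\<forall>a\<in>carrier S. f \<otimes>\<^bsub>S\<^esub> a = \<zero>\<^bsub>S\<^esub> \<longrightarrow> a = \<zero>\<^bsub>S\<^esub>)"

definition divisible_module :: "('s, 'm) module \<Rightarrow> 's \<Rightarrow> bool"
  where "divisible_module M f \<longleftrightarrow> (\<forall>x\<in>carrier M. \<exists>y\<in>carrier M. f \<odot>\<^bsub>M\<^esub> y = x)"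

definition divisible_category :: "('s, 'm) module set \<Rightarrow> 's \<Rightarrow> bool"
  where "divisible_category C f \<longleftrightarrow> (\<forall>M\<in>C. divisible_module M f)"

definition quotient_ring :: "('s, 'e) ring_scheme \<Rightarrow> 's \<Rightarrow> 's set ring"
  where "quotient_ring S f = S Quot (PIdl\<^bsub>S\<^esub> f)"

definition quotient_module :: "('s, 'e) ring_scheme \<Rightarrow> 's \<Rightarrow> ('s, 's set) module"
  where "quotient_module S f =
    \<lparr>carrier = carrier (quotient_ring S f), mult = undefined, one = undefined,
     zero = \<zero>\<^bsub>quotient_ring S f\<^esub>, add = add (quotient_ring S f),
     smult = (\<lambda>a r. (PIdl\<^bsub>S\<^esub> f +>\<^bsub>S\<^esub> a) \<otimes>\<^bsub>quotient_ring S f\<^esub> r)\<rparr>"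

text \<open>\<open>Hom\<^sub>S(R, M)\<close> as a module over \<open>R = S/(f)\<close>, which acts through its action on the source \<open>R\<close>.\<close>

definition hom_from_quotient ::
  "('s, 'e) ring_scheme \<Rightarrow> 's \<Rightarrow> ('s, 'm) module \<Rightarrow> ('s set, 's set \<Rightarrow> 'm) module"
  where "hom_from_quotient S f M =
    \<lparr>carrier = linear_maps S (quotient_module S f) M, mult = undefined, one = undefined,
     zero = (\<lambda>x\<in>carrier (quotient_ring S f). \<zero>\<^bsub>M\<^esub>), add = add_map (quotient_module S f) M,
     smult = (\<lambda>r h. \<lambda>x\<in>carrier (quotient_ring S f). h (x \<otimes>\<^bsub>quotient_ring S f\<^esub> r))\<rparr>"

definition hom_category ::
  "('s, 'e) ring_scheme \<Rightarrow> 's \<Rightarrow> ('s, 'm) module set \<Rightarrow> ('s set, 's set \<Rightarrow> 'm) module set"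
  where "hom_category S f C =
    {N. module (quotient_ring S f) N \<and>
        (\<exists>M\<in>C. module_iso (quotient_ring S f) N (hom_from_quotient S f M))}"


section \<open>Factorizations and complexes\<close>

text \<open>
  Factorizations and complexes are treated together as families of modules \<open>M\<^sub>i\<close> with maps
  \<open>d\<^sub>i : M\<^sub>i \<rightarrow> M\<^sub>i\<^sub>-\<^sub>1\<close>.  The index \<open>i\<close> ranges over \<^typ>\<open>int\<close> for complexes and over
  \<^typ>\<open>bit\<close>, the integers mod 2, for factorizations; in \<^typ>\<open>bit\<close> one has \<open>0 - 1 = 1\<close>.
\<close>

record ('i, 's, 'm) family =
  cmp :: "'i \<Rightarrow> ('s, 'm) module"
  dif :: "'i \<Rightarrow> 'm \<Rightarrow> 'm"

definition chain_maps ::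
  "('s, 'e) ring_scheme \<Rightarrow> ('i::comm_ring_1, 's, 'm) family \<Rightarrow> ('i, 's, 'n) family \<Rightarrow>
    ('i \<Rightarrow> 'm \<Rightarrow> 'n) set"
  where "chain_maps S X Y =
    {\<alpha>. \<forall>i. \<alpha> i \<in> linear_maps S (cmp X i) (cmp Y i) \<and>
            (\<forall>x\<in>carrier (cmp X i). \<alpha> (i - 1) (dif X i x) = dif Y i (\<alpha> i x))}"

definition chain_id :: "('i, 's, 'm) family \<Rightarrow> 'i \<Rightarrow> 'm \<Rightarrow> 'm"
  where "chain_id X = (\<lambda>i. \<lambda>x\<in>carrier (cmp X i). x)"

definition chain_comp ::
  "('i, 's, 'm) family \<Rightarrow> ('i \<Rightarrow> 'n \<Rightarrow> 'p) \<Rightarrow> ('i \<Rightarrow> 'm \<Rightarrow> 'n) \<Rightarrow> 'i \<Rightarrow> 'm \<Rightarrow> 'p"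
  where "chain_comp X \<beta> \<alpha> = (\<lambda>i. compose (carrier (cmp X i)) (\<beta> i) (\<alpha> i))"

definition chain_add ::
  "('i, 's, 'm) family \<Rightarrow> ('i, 's, 'n) family \<Rightarrow> ('i \<Rightarrow> 'm \<Rightarrow> 'n) \<Rightarrow> ('i \<Rightarrow> 'm \<Rightarrow> 'n) \<Rightarrow>
    'i \<Rightarrow> 'm \<Rightarrow> 'n"
  where "chain_add X Y \<alpha> \<beta> = (\<lambda>i. add_map (cmp X i) (cmp Y i) (\<alpha> i) (\<beta> i))"

definition homotopy_rel ::
  "('s, 'e) ring_scheme \<Rightarrow> ('i::comm_ring_1, 's, 'm) family \<Rightarrow> ('i, 's, 'n) family \<Rightarrow>
    ('i \<Rightarrow> 'm \<Rightarrow> 'n) rel"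
  where "homotopy_rel S X Y =
    {(\<alpha>, \<beta>). \<alpha> \<in> chain_maps S X Y \<and> \<beta> \<in> chain_maps S X Y \<and>
       (\<exists>h. \<forall>i. h i \<in> linear_maps S (cmp X i) (cmp Y (i + 1)) \<and>
          (\<forall>x\<in>carrier (cmp X i).
             \<alpha> i x \<ominus>\<^bsub>cmp Y i\<^esub> \<beta> i x =
             dif Y (i + 1) (h i x) \<oplus>\<^bsub>cmp Y i\<^esub> h (i - 1) (dif X i x)))}"

definition homotopy_equivs ::
  "('s, 'e) ring_scheme \<Rightarrow> ('i::comm_ring_1, 's, 'm) family \<Rightarrow> ('i, 's, 'n) family \<Rightarrow>
    ('i \<Rightarrow> 'm \<Rightarrow> 'n) set"
  where "homotopy_equivs S X Y =
    {\<alpha> \<in> chain_maps S X Y. \<exists>\<beta>\<in>chain_maps S Y X.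
       (chain_comp X \<beta> \<alpha>, chain_id X) \<in> homotopy_rel S X X \<and>
       (chain_comp Y \<alpha> \<beta>, chain_id Y) \<in> homotopy_rel S Y Y}"

definition shift :: "('i::comm_ring_1, 's, 'm) family \<Rightarrow> ('i, 's, 'm) family"
  where "shift X =
    \<lparr>cmp = (\<lambda>i. cmp X (i - 1)),
     dif = (\<lambda>i. \<lambda>x\<in>carrier (cmp X (i - 1)). \<ominus>\<^bsub>cmp X (i - 1 - 1)\<^esub> dif X (i - 1) x)\<rparr>"

definition shift_map :: "('i::comm_ring_1 \<Rightarrow> 'm \<Rightarrow> 'n) \<Rightarrow> 'i \<Rightarrow> 'm \<Rightarrow> 'n"
  where "shift_map \<alpha> = (\<lambda>i. \<alpha> (i - 1))"

definition cone ::
  "('i::comm_ring_1, 's, 'm) family \<Rightarrow> ('i, 's, 'n) family \<Rightarrow> ('i \<Rightarrow> 'm \<Rightarrow> 'n) \<Rightarrow>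
    ('i, 's, 'n \<times> 'm) family"
  where "cone X Y \<alpha> =
    \<lparr>cmp = (\<lambda>i. direct_sum (cmp Y i) (cmp X (i - 1))),
     dif = (\<lambda>i. \<lambda>(y, x)\<in>carrier (cmp Y i) \<times> carrier (cmp X (i - 1)).
              (dif Y i y \<oplus>\<^bsub>cmp Y (i - 1)\<^esub> \<alpha> (i - 1) x,
               \<ominus>\<^bsub>cmp X (i - 1 - 1)\<^esub> dif X (i - 1) x))\<rparr>"

definition cone_incl ::
  "('i::comm_ring_1, 's, 'm) family \<Rightarrow> ('i, 's, 'n) family \<Rightarrow> 'i \<Rightarrow> 'n \<Rightarrow> 'n \<times> 'm"
  where "cone_incl X Y = (\<lambda>i. \<lambda>y\<in>carrier (cmp Y i). (y, \<zero>\<^bsub>cmp X (i - 1)\<^esub>))"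

definition cone_proj ::
  "('i::comm_ring_1, 's, 'm) family \<Rightarrow> ('i, 's, 'n) family \<Rightarrow> 'i \<Rightarrow> 'n \<times> 'm \<Rightarrow> 'm"
  where "cone_proj X Y = (\<lambda>i. \<lambda>(y, x)\<in>carrier (cmp Y i) \<times> carrier (cmp X (i - 1)). x)"

definition factorizations ::
  "('s, 'e) ring_scheme \<Rightarrow> ('s, 'm) module set \<Rightarrow> 's \<Rightarrow> (bit, 's, 'm) family set"
  where "factorizations S C f =
    {X. \<forall>i. cmp X i \<in> C \<and> dif X i \<in> linear_maps S (cmp X i) (cmp X (i - 1)) \<and>
            (\<forall>x\<in>carrier (cmp X i). dif X (i - 1) (dif X i x) = f \<odot>\<^bsub>cmp X i\<^esub> x)}"

definition is_complex :: "('s, 'e) ring_scheme \<Rightarrow> (int, 's, 'm) family \<Rightarrow> bool"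
  where "is_complex R T \<longleftrightarrow>
    (\<forall>i. module R (cmp T i) \<and> dif T i \<in> linear_maps R (cmp T i) (cmp T (i - 1)) \<and>
         (\<forall>x\<in>carrier (cmp T i). dif T (i - 1) (dif T i x) = \<zero>\<^bsub>cmp T (i - 1 - 1)\<^esub>))"

definition acyclic_complex :: "(int, 's, 'm) family \<Rightarrow> bool"
  where "acyclic_complex T \<longleftrightarrow>
    (\<forall>i. a_kernel (cmp T i) (cmp T (i - 1)) (dif T i) =
         dif T (i + 1) ` carrier (cmp T (i + 1)))"

definition hom_complex_from ::
  "('s, 'e) ring_scheme \<Rightarrow> ('s, 'm) module \<Rightarrow> (int, 's, 'n) family \<Rightarrow> (int, 's, 'm \<Rightarrow> 'n) family"
  where "hom_complex_from R W T =
    \<lparr>cmp = (\<lambda>i. hom_module R W (cmp T i)),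
     dif = (\<lambda>i. \<lambda>\<phi>\<in>linear_maps R W (cmp T i). compose (carrier W) (dif T i) \<phi>)\<rparr>"

text \<open>
  \<open>Hom\<^sub>R(T, W)\<close> has \<open>Hom\<^sub>R(T\<^sub>-\<^sub>i, W)\<close> in degree \<open>i\<close>.  The customary sign in its differential
  is omitted; it changes neither kernels nor images.
\<close>

definition hom_complex_into ::
  "('s, 'e) ring_scheme \<Rightarrow> (int, 's, 'm) family \<Rightarrow> ('s, 'n) module \<Rightarrow> (int, 's, 'm \<Rightarrow> 'n) family"
  where "hom_complex_into R T W =
    \<lparr>cmp = (\<lambda>i. hom_module R (cmp T (- i)) W),
     dif = (\<lambda>i. \<lambda>\<phi>\<in>linear_maps R (cmp T (- i)) W.
              compose (carrier (cmp T (- i + 1))) \<phi> (dif T (- i + 1)))\<rparr>"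

definition tac_complexes ::
  "('s, 'e) ring_scheme \<Rightarrow> ('s, 'm) module set \<Rightarrow> (int, 's, 'm) family set"
  where "tac_complexes R \<W> =
    {T. is_complex R T \<and> acyclic_complex T \<and> (\<forall>i. cmp T i \<in> \<W>) \<and>
        (\<forall>W\<in>\<W>. acyclic_complex (hom_complex_into R T W) \<and>
                acyclic_complex (hom_complex_from R W T))}"


section \<open>Triangulated functors\<close>

text \<open>
  The data of a triangulated category: a category (composition, identities and sums of morphisms
  take the objects involved as arguments, so hom sets need not be disjoint), a shift functor, and
  the exact triangles \<open>X \<rightarrow>\<^sup>u Y \<rightarrow>\<^sup>v Z \<rightarrow>\<^sup>w \<Sigma>X\<close>, listed as \<open>(X, Y, Z, u, v, w)\<close>.
\<close>

record ('o, 'h) tricat =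
  Ob :: "'o set"
  Mor :: "'o \<Rightarrow> 'o \<Rightarrow> 'h set"
  Ident :: "'o \<Rightarrow> 'h"
  Comp :: "'o \<Rightarrow> 'o \<Rightarrow> 'o \<Rightarrow> 'h \<Rightarrow> 'h \<Rightarrow> 'h"
  Plus :: "'o \<Rightarrow> 'o \<Rightarrow> 'h \<Rightarrow> 'h \<Rightarrow> 'h"
  Shift :: "'o \<Rightarrow> 'o"
  ShiftMor :: "'o \<Rightarrow> 'o \<Rightarrow> 'h \<Rightarrow> 'h"
  Triangles :: "('o \<times> 'o \<times> 'o \<times> 'h \<times> 'h \<times> 'h) set"

definition isos :: "('o, 'h) tricat \<Rightarrow> 'o \<Rightarrow> 'o \<Rightarrow> 'h set"
  where "isos A X Y =
    {g \<in> Mor A X Y. \<exists>k\<in>Mor A Y X. Comp A X Y X k g = Ident A X \<and> Comp A Y X Y g k = Ident A Y}"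

definition is_functor ::
  "('o, 'h) tricat \<Rightarrow> ('p, 'k) tricat \<Rightarrow> ('o \<Rightarrow> 'p) \<Rightarrow> ('o \<Rightarrow> 'o \<Rightarrow> 'h \<Rightarrow> 'k) \<Rightarrow> bool"
  where "is_functor A B Fo Fm \<longleftrightarrow>
    (\<forall>X\<in>Ob A. Fo X \<in> Ob B) \<and>
    (\<forall>X\<in>Ob A. \<forall>Y\<in>Ob A. \<forall>g\<in>Mor A X Y. Fm X Y g \<in> Mor B (Fo X) (Fo Y)) \<and>
    (\<forall>X\<in>Ob A. Fm X X (Ident A X) = Ident B (Fo X)) \<and>
    (\<forall>X\<in>Ob A. \<forall>Y\<in>Ob A. \<forall>Z\<in>Ob A. \<forall>g\<in>Mor A X Y. \<forall>k\<in>Mor A Y Z.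
       Fm X Z (Comp A X Y Z k g) = Comp B (Fo X) (Fo Y) (Fo Z) (Fm Y Z k) (Fm X Y g))"

definition triangulated_functor ::
  "('o, 'h) tricat \<Rightarrow> ('p, 'k) tricat \<Rightarrow> ('o \<Rightarrow> 'p) \<Rightarrow> ('o \<Rightarrow> 'o \<Rightarrow> 'h \<Rightarrow> 'k) \<Rightarrow> bool"
  where "triangulated_functor A B Fo Fm \<longleftrightarrow>
    is_functor A B Fo Fm \<and>
    (\<forall>X\<in>Ob A. \<forall>Y\<in>Ob A. \<forall>g\<in>Mor A X Y. \<forall>k\<in>Mor A X Y.
       Fm X Y (Plus A X Y g k) = Plus B (Fo X) (Fo Y) (Fm X Y g) (Fm X Y k)) \<and>
    (\<exists>\<eta>.
       (\<forall>X\<in>Ob A. \<eta> X \<in> isos B (Fo (Shift A X)) (Shift B (Fo X))) \<and>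
       (\<forall>X\<in>Ob A. \<forall>Y\<in>Ob A. \<forall>g\<in>Mor A X Y.
          Comp B (Fo (Shift A X)) (Fo (Shift A Y)) (Shift B (Fo Y))
            (\<eta> Y) (Fm (Shift A X) (Shift A Y) (ShiftMor A X Y g)) =
          Comp B (Fo (Shift A X)) (Shift B (Fo X)) (Shift B (Fo Y))
            (ShiftMor B (Fo X) (Fo Y) (Fm X Y g)) (\<eta> X)) \<and>
       (\<forall>X Y Z u v w. (X, Y, Z, u, v, w) \<in> Triangles A \<longrightarrow>
          (Fo X, Fo Y, Fo Z, Fm X Y u, Fm Y Z v,
           Comp B (Fo Z) (Fo (Shift A X)) (Shift B (Fo X)) (\<eta> X) (Fm Z (Shift A X) w))
          \<in> Triangles B))"

definition full_functor ::
  "('o, 'h) tricat \<Rightarrow> ('p, 'k) tricat \<Rightarrow> ('o \<Rightarrow> 'p) \<Rightarrow> ('o \<Rightarrow> 'o \<Rightarrow> 'h \<Rightarrow> 'k) \<Rightarrow> bool"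
  where "full_functor A B Fo Fm \<longleftrightarrow>
    (\<forall>X\<in>Ob A. \<forall>Y\<in>Ob A. \<forall>k\<in>Mor B (Fo X) (Fo Y). \<exists>g\<in>Mor A X Y. Fm X Y g = k)"

definition faithful_functor ::
  "('o, 'h) tricat \<Rightarrow> ('o \<Rightarrow> 'o \<Rightarrow> 'h \<Rightarrow> 'k) \<Rightarrow> bool"
  where "faithful_functor A Fm \<longleftrightarrow> (\<forall>X\<in>Ob A. \<forall>Y\<in>Ob A. inj_on (Fm X Y) (Mor A X Y))"


section \<open>Homotopy categories\<close>

text \<open>
  Morphisms are homotopy classes.  An exact triangle is one that is isomorphic to
  \<open>X' \<rightarrow> Y' \<rightarrow> cone(\<alpha>) \<rightarrow> \<Sigma>X'\<close> for some chain map \<open>\<alpha>\<close>; the isomorphism is expressed by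
  representatives, since the carriers of the literal cone have another type than those of the
  objects of the category.
\<close>

definition homotopy_category ::
  "('s, 'e) ring_scheme \<Rightarrow> ('i::comm_ring_1, 's, 'm) family set \<Rightarrow>
    (('i, 's, 'm) family, ('i \<Rightarrow> 'm \<Rightarrow> 'm) set) tricat"
  where "homotopy_category S Obj =
    \<lparr>Ob = Obj,
     Mor = (\<lambda>X Y. chain_maps S X Y // homotopy_rel S X Y),
     Ident = (\<lambda>X. homotopy_rel S X X `` {chain_id X}),
     Comp = (\<lambda>X Y Z k g. \<Union>\<beta>\<in>k. \<Union>\<alpha>\<in>g. homotopy_rel S X Z `` {chain_comp X \<beta> \<alpha>}),
     Plus = (\<lambda>X Y g k. \<Union>\<alpha>\<in>g. \<Union>\<beta>\<in>k. homotopy_rel S X Y `` {chain_add X Y \<alpha> \<beta>}),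
     Shift = shift,
     ShiftMor = (\<lambda>X Y g. \<Union>\<alpha>\<in>g. homotopy_rel S (shift X) (shift Y) `` {shift_map \<alpha>}),
     Triangles =
       {(X, Y, Z, u, v, w).
          X \<in> Obj \<and> Y \<in> Obj \<and> Z \<in> Obj \<and>
          u \<in> chain_maps S X Y // homotopy_rel S X Y \<and>
          v \<in> chain_maps S Y Z // homotopy_rel S Y Z \<and>
          w \<in> chain_maps S Z (shift X) // homotopy_rel S Z (shift X) \<and>
          (\<exists>X'\<in>Obj. \<exists>Y'\<in>Obj. \<exists>\<alpha>\<in>chain_maps S X' Y'.
             \<exists>a\<in>homotopy_equivs S X X'. \<exists>b\<in>homotopy_equivs S Y Y'.
             \<exists>c\<in>homotopy_equivs S Z (cone X' Y' \<alpha>). \<exists>u'\<in>u. \<exists>v'\<in>v. \<exists>w'\<in>w.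
               (chain_comp X b u', chain_comp X \<alpha> a) \<in> homotopy_rel S X Y' \<and>
               (chain_comp Y c v', chain_comp Y (cone_incl X' Y') b)
                 \<in> homotopy_rel S Y (cone X' Y' \<alpha>) \<and>
               (chain_comp Z (shift_map a) w', chain_comp Z (cone_proj X' Y') c)
                 \<in> homotopy_rel S Z (shift X'))}\<rparr>"

definition HF ::
  "('s, 'e) ring_scheme \<Rightarrow> ('s, 'm) module set \<Rightarrow> 's \<Rightarrow>
    ((bit, 's, 'm) family, (bit \<Rightarrow> 'm \<Rightarrow> 'm) set) tricat"
  where "HF S C f = homotopy_category S (factorizations S C f)"

definition K_tac ::
  "('s, 'e) ring_scheme \<Rightarrow> ('s, 'm) module set \<Rightarrow>
    ((int, 's, 'm) family, (int \<Rightarrow> 'm \<Rightarrow> 'm) set) tricat"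
  where "K_tac R \<W> = homotopy_category R (tac_complexes R \<W>)"

end

theory Submission
  imports Defs
begin

text \<open>
  Write \<open>M[f]\<close> for the submodule of elements of \<open>M\<close> killed by \<open>f\<close>.  Evaluation at \<open>1\<close>
  identifies \<open>Hom\<^sub>S(R, M)\<close> with \<open>M[f]\<close>.  As \<open>d\<close> composed with itself is multiplication by \<open>f\<close>,
  a factorization \<open>(M, d)\<close> becomes the 2-periodic complex
  \<open>\<dots> \<rightarrow> M\<^sub>1[f] \<rightarrow> M\<^sub>0[f] \<rightarrow> M\<^sub>1[f] \<rightarrow> \<dots>\<close> over \<open>R\<close>; this is the functor.

  Everything rests on the description of \<open>Hom\<^sub>R(M[f], N[f])\<close> as \<open>Hom\<^sub>S(M, N) / f Hom\<^sub>S(M, N)\<close>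
  for \<open>M\<close> and \<open>N\<close> in \<open>C\<close>.  Divisibility makes \<open>0 \<rightarrow> M[f] \<rightarrow> M \<rightarrow> M \<rightarrow> 0\<close>, with multiplication
  by \<open>f\<close> on the right, exact.  Apply \<open>Hom\<^sub>S(-, N)\<close> and use \<open>Ext\<^sup>1(M, N) = 0\<close>: every map
  \<open>M[f] \<rightarrow> N\<close> extends to \<open>M\<close> (\<open>extend_from_torsion\<close>, \<open>hom_map_full\<close>), and two extensions differ
  by a multiple of \<open>f\<close> (\<open>hom_map_eqD\<close>).  Moreover \<open>f\<close> acts injectively on \<open>Hom\<^sub>S(M, N)\<close>, again
  because \<open>M\<close> is divisible (\<open>f_cancel\<close>).  So a statement about maps over \<open>R\<close> lifts to one about maps
  over \<open>S\<close> modulo \<open>f\<close>, where an error term \<open>f u = d d u\<close> is absorbed by changing the lift by \<open>d u\<close>,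
  and where \<open>d\<close> itself can be cancelled.

  For total acyclicity, if \<open>g\<close> lifts a cycle of \<open>Hom\<^sub>R(N[f], M[f])\<close>, then \<open>d g = f u\<close>, hence
  \<open>f g = d d g = f d u\<close> and \<open>g = d u\<close> (\<open>factor_from\<close>, and \<open>factor_into\<close> for the other variable).
  For fullness, lift a chain map \<open>\<phi>\<close> to maps \<open>a\<^sub>i\<close>, so that \<open>d a\<^sub>i = a\<^sub>i\<^sub>-\<^sub>1 d + f u\<^sub>i\<close>.  Then
  \<open>a\<^sub>0\<close> and \<open>a\<^sub>1 - d u\<^sub>1\<close> form a morphism of factorizations, and the \<open>u\<^sub>i\<close> provide the increments of a
  homotopy from its image to \<open>\<phi>\<close>, built in both directions from degree \<open>0\<close> (\<open>hom_chain_full\<close>).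
  For faithfulness, the part of a null homotopy that starts in degrees \<open>0\<close> and \<open>-1\<close> lifts, after a
  correction by a multiple of \<open>d\<close>, to a homotopy of factorizations (\<open>hom_chain_faithful\<close>).

  That the functor is triangulated is formal: \<open>Hom\<^sub>S(R, -)\<close> is additive and is applied in each
  degree, so it commutes with the shift on the nose and with mapping cones up to the isomorphism
  \<open>Hom\<^sub>S(R, N \<oplus> M) \<cong> Hom\<^sub>S(R, N) \<oplus> Hom\<^sub>S(R, M)\<close> (\<open>hom_split_equiv\<close>, \<open>hom_triangle\<close>).
\<close>

section \<open>Linear maps\<close>

lemma linear_mapsI:
  assumes "\<And>x. x \<in> carrier M \<Longrightarrow> h x \<in> carrier N" "\<And>x. x \<notin> carrier M \<Longrightarrow> h x = undefined"
    and "\<And>x y. x \<in> carrier M \<Longrightarrow> y \<in> carrier M \<Longrightarrow> h (x \<oplus>\<^bsub>M\<^esub> y) = h x \<oplus>\<^bsub>N\<^esub> h y"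
    and "\<And>a x. a \<in> carrier S \<Longrightarrow> x \<in> carrier M \<Longrightarrow> h (a \<odot>\<^bsub>M\<^esub> x) = a \<odot>\<^bsub>N\<^esub> h x"
  shows "h \<in> linear_maps S M N"
  using assms unfolding linear_maps_def by (auto simp: PiE_def extensional_def)

lemma module_add_closed: "module S M \<Longrightarrow> x \<in> carrier M \<Longrightarrow> y \<in> carrier M \<Longrightarrow> x \<oplus>\<^bsub>M\<^esub> y \<in> carrier M"
  by (meson abelian_groupE(1) module.axioms(2))

lemma module_neg_closed: "module S M \<Longrightarrow> x \<in> carrier M \<Longrightarrow> \<ominus>\<^bsub>M\<^esub> x \<in> carrier M"
  by (simp add: abelian_group.a_inv_closed module.axioms(2))

lemma module_minus_zero:
  assumes "module S M"
  shows "\<ominus>\<^bsub>M\<^esub> \<zero>\<^bsub>M\<^esub> = \<zero>\<^bsub>M\<^esub>"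
proof -
  interpret M: module S M by fact
  show ?thesis by (rule M.M.minus_equality) auto
qed

lemma module_minus_eq_iff:
  assumes "module S M" "x \<in> carrier M" "y \<in> carrier M" "z \<in> carrier M"
  shows "x \<ominus>\<^bsub>M\<^esub> y = z \<longleftrightarrow> x = y \<oplus>\<^bsub>M\<^esub> z"
proof -
  interpret M: module S M by fact
  show ?thesis using assms(2-4) by (auto simp: M.M.minus_eq M.M.a_ac M.M.r_neg M.M.r_neg1 M.M.r_neg2 M.M.a_lcomm[of y])
qed

lemma linear_maps_restrictI:
  assumes "module S M" "\<And>x. x \<in> carrier M \<Longrightarrow> h x \<in> carrier N"
    and "\<And>x y. x \<in> carrier M \<Longrightarrow> y \<in> carrier M \<Longrightarrow> h (x \<oplus>\<^bsub>M\<^esub> y) = h x \<oplus>\<^bsub>N\<^esub> h y"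
    and "\<And>a x. a \<in> carrier S \<Longrightarrow> x \<in> carrier M \<Longrightarrow> h (a \<odot>\<^bsub>M\<^esub> x) = a \<odot>\<^bsub>N\<^esub> h x"
  shows "(\<lambda>x\<in>carrier M. h x) \<in> linear_maps S M N"
  using assms by (intro linear_mapsI) (auto simp: module_add_closed module.smult_closed)

lemma linear_maps_closed: "h \<in> linear_maps S M N \<Longrightarrow> x \<in> carrier M \<Longrightarrow> h x \<in> carrier N"
  unfolding linear_maps_def by auto

lemma linear_maps_add:
  "h \<in> linear_maps S M N \<Longrightarrow> x \<in> carrier M \<Longrightarrow> y \<in> carrier M \<Longrightarrow> h (x \<oplus>\<^bsub>M\<^esub> y) = h x \<oplus>\<^bsub>N\<^esub> h y"
  unfolding linear_maps_def by auto

lemma linear_maps_smult: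
  "h \<in> linear_maps S M N \<Longrightarrow> a \<in> carrier S \<Longrightarrow> x \<in> carrier M \<Longrightarrow> h (a \<odot>\<^bsub>M\<^esub> x) = a \<odot>\<^bsub>N\<^esub> h x"
  unfolding linear_maps_def by auto

lemma linear_maps_zero:
  assumes "h \<in> linear_maps S M N" "module S M" "module S N"
  shows "h \<zero>\<^bsub>M\<^esub> = \<zero>\<^bsub>N\<^esub>"
proof -
  interpret M: module S M by fact
  interpret N: module S N by fact
  have "h \<zero>\<^bsub>M\<^esub> = h (\<zero>\<^bsub>S\<^esub> \<odot>\<^bsub>M\<^esub> \<zero>\<^bsub>M\<^esub>)" by simp
  also have "\<dots> = \<zero>\<^bsub>S\<^esub> \<odot>\<^bsub>N\<^esub> h \<zero>\<^bsub>M\<^esub>" using assms(1) by (rule linear_maps_smult) auto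
  finally show ?thesis using linear_maps_closed[OF assms(1), of "\<zero>\<^bsub>M\<^esub>"] by simp
qed

lemma linear_maps_neg:
  assumes "h \<in> linear_maps S M N" "module S M" "module S N" "x \<in> carrier M"
  shows "h (\<ominus>\<^bsub>M\<^esub> x) = \<ominus>\<^bsub>N\<^esub> h x"
proof -
  interpret M: module S M by fact
  interpret N: module S N by fact
  have "h (\<ominus>\<^bsub>M\<^esub> x) \<oplus>\<^bsub>N\<^esub> h x = h (\<ominus>\<^bsub>M\<^esub> x \<oplus>\<^bsub>M\<^esub> x)"
    using assms by (simp add: linear_maps_add)
  also have "\<dots> = \<zero>\<^bsub>N\<^esub>" using assms by (simp add: M.M.l_neg linear_maps_zero)
  finally show ?thesis using assms
    by (intro N.M.minus_equality[symmetric]) (auto intro: linear_maps_closed)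
qed

lemma linear_maps_eqI:
  assumes "g \<in> linear_maps S M N" "h \<in> linear_maps S' M N'" "\<And>x. x \<in> carrier M \<Longrightarrow> g x = h x"
  shows "g = h"
  using assms unfolding linear_maps_def by (intro PiE_ext[of g "carrier M" _ h]) auto

lemma linear_maps_comp:
  assumes "g \<in> linear_maps S M N" "h \<in> linear_maps S N P" "module S M"
  shows "compose (carrier M) h g \<in> linear_maps S M P"
  unfolding compose_def using assms
  by (intro linear_maps_restrictI)
    (auto simp: linear_maps_closed linear_maps_add linear_maps_smult)

lemma linear_maps_add_map:
  assumes "g \<in> linear_maps S M N" "h \<in> linear_maps S M N" "module S M" "module S N"
  shows "(\<lambda>x\<in>carrier M. g x \<oplus>\<^bsub>N\<^esub> h x) \<in> linear_maps S M N"
proof -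
  interpret N: module S N by fact
  show ?thesis using assms
    by (intro linear_maps_restrictI)
      (auto simp: linear_maps_closed linear_maps_add linear_maps_smult N.M.a_ac N.smult_r_distr)
qed

lemma linear_maps_zero_map:
  assumes "module S M" "module S N"
  shows "(\<lambda>x\<in>carrier M. \<zero>\<^bsub>N\<^esub>) \<in> linear_maps S M N"
proof -
  interpret N: module S N by fact
  show ?thesis using assms by (intro linear_maps_restrictI) auto
qed

lemma linear_maps_smult_map:
  assumes "g \<in> linear_maps S M N" "a \<in> carrier S" "module S M" "module S N"
  shows "(\<lambda>x\<in>carrier M. a \<odot>\<^bsub>N\<^esub> g x) \<in> linear_maps S M N"
proof -
  interpret N: module S N by fact
  show ?thesis using assms
    by (intro linear_maps_restrictI)
      (auto simp: linear_maps_closed linear_maps_add linear_maps_smult N.smult_r_distr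
         N.smult_assoc1[symmetric] N.R.m_comm)
qed

lemma linear_maps_neg_map:
  assumes "g \<in> linear_maps S M N" "module S M" "module S N"
  shows "(\<lambda>x\<in>carrier M. \<ominus>\<^bsub>N\<^esub> g x) \<in> linear_maps S M N"
proof -
  interpret N: module S N by fact
  show ?thesis using assms
    by (intro linear_maps_restrictI)
      (auto simp: linear_maps_closed linear_maps_add linear_maps_smult N.M.minus_add
         N.smult_r_minus)
qed

lemma linear_maps_minus_map:
  assumes "g \<in> linear_maps S M N" "h \<in> linear_maps S M N" "module S M" "module S N"
  shows "(\<lambda>x\<in>carrier M. g x \<ominus>\<^bsub>N\<^esub> h x) \<in> linear_maps S M N"
proof -
  interpret N: module S N by fact
  show ?thesis using assms
    by (intro linear_maps_restrictI)
      (auto simp: linear_maps_closed linear_maps_add linear_maps_smult N.M.minus_add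
         N.smult_r_minus N.M.minus_eq N.M.a_ac N.smult_r_distr)
qed

lemma linear_maps_id: "module S M \<Longrightarrow> (\<lambda>x\<in>carrier M. x) \<in> linear_maps S M M"
  by (intro linear_maps_restrictI) auto

lemma linear_maps_inverse:
  assumes e: "e \<in> linear_maps S M N" and b: "bij_betw e (carrier M) (carrier N)"
    and M: "module S M" and N: "module S N"
  obtains e' where "e' \<in> linear_maps S N M" "\<And>x. x \<in> carrier M \<Longrightarrow> e' (e x) = x"
    "\<And>y. y \<in> carrier N \<Longrightarrow> e (e' y) = y"
proof -
  let ?j = "inv_into (carrier M) e"
  interpret M: module S M by fact
  interpret N: module S N by fact
  have inv: "e (?j y) = y" "?j y \<in> carrier M" if "y \<in> carrier N" for y
    using that b bij_betw_inv_into_right[OF b] bij_betw_apply[OF bij_betw_inv_into[OF b]] by auto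
  have inv': "?j y = x" if "e x = y" "x \<in> carrier M" for x y
    using that bij_betw_inv_into_left[OF b] by auto
  have "(\<lambda>y\<in>carrier N. ?j y) \<in> linear_maps S N M"
    by (intro linear_maps_restrictI N)
      (auto simp: inv intro!: inv' simp: linear_maps_add[OF e] linear_maps_smult[OF e])
  then show thesis
    by (rule that) (use inv inv' linear_maps_closed[OF e] in auto)
qed

section \<open>Free modules and the first Ext group\<close>

lemma linear_maps_finsum:
  assumes h: "h \<in> linear_maps S N P" and N: "module S N" and P: "module S P"
    and "finite A" "\<phi> \<in> A \<rightarrow> carrier N"
  shows "h (\<Oplus>\<^bsub>N\<^esub>g\<in>A. \<phi> g) = (\<Oplus>\<^bsub>P\<^esub>g\<in>A. h (\<phi> g))"
proof -
  interpret N: module S N by fact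
  interpret P: module S P by fact
  show ?thesis using assms(4,5)
  proof (induction A rule: finite_induct)
    case empty
    then show ?case by (simp add: linear_maps_zero[OF h N P])
  next
    case (insert a A)
    then have "\<phi> \<in> A \<rightarrow> carrier N" "(\<lambda>g. h (\<phi> g)) \<in> A \<rightarrow> carrier P" "\<phi> a \<in> carrier N"
      by (auto intro: linear_maps_closed[OF h])
    with insert show ?case
      by (simp add: linear_maps_add[OF h] linear_maps_closed[OF h])
  qed
qed

lemma free_module_carrier:
  "c \<in> carrier (free_module S G) \<longleftrightarrow>
    (\<forall>g. c g \<in> carrier S) \<and> finite {g. c g \<noteq> \<zero>\<^bsub>S\<^esub>} \<and> {g. c g \<noteq> \<zero>\<^bsub>S\<^esub>} \<subseteq> G"
  unfolding free_module_def by auto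

lemma free_module_is_module:
  assumes "cring S"
  shows "module S (free_module S G)"
proof -
  interpret S: cring S by fact
  have add: "(\<lambda>g. c g \<oplus>\<^bsub>S\<^esub> c' g) \<in> carrier (free_module S G)"
    if "c \<in> carrier (free_module S G)" "c' \<in> carrier (free_module S G)" for c c'
  proof -
    have sub: "{g. c g \<oplus>\<^bsub>S\<^esub> c' g \<noteq> \<zero>\<^bsub>S\<^esub>} \<subseteq> {g. c g \<noteq> \<zero>\<^bsub>S\<^esub>} \<union> {g. c' g \<noteq> \<zero>\<^bsub>S\<^esub>}" by auto
    show ?thesis using that finite_subset[OF sub] sub by (auto simp: free_module_carrier)
  qed
  have smult: "(\<lambda>g. a \<otimes>\<^bsub>S\<^esub> c g) \<in> carrier (free_module S G)"
    if "a \<in> carrier S" "c \<in> carrier (free_module S G)" for a c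
  proof -
    have sub: "{g. a \<otimes>\<^bsub>S\<^esub> c g \<noteq> \<zero>\<^bsub>S\<^esub>} \<subseteq> {g. c g \<noteq> \<zero>\<^bsub>S\<^esub>}" using that(1) by auto
    show ?thesis using that finite_subset[OF sub] sub by (auto simp: free_module_carrier)
  qed
  have neg: "\<exists>c'\<in>carrier (free_module S G). (\<lambda>g. c g \<oplus>\<^bsub>S\<^esub> c' g) = (\<lambda>g. \<zero>\<^bsub>S\<^esub>)"
    if "c \<in> carrier (free_module S G)" for c
    using that smult[OF _ that, of "\<ominus>\<^bsub>S\<^esub> \<one>\<^bsub>S\<^esub>"]
    by (intro bexI[of _ "\<lambda>g. \<ominus>\<^bsub>S\<^esub> \<one>\<^bsub>S\<^esub> \<otimes>\<^bsub>S\<^esub> c g"])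
      (auto simp: free_module_carrier S.l_minus S.r_neg)
  have sel: "add (free_module S G) = (\<lambda>c c' g. c g \<oplus>\<^bsub>S\<^esub> c' g)"
    "zero (free_module S G) = (\<lambda>g. \<zero>\<^bsub>S\<^esub>)" "smult (free_module S G) = (\<lambda>a c g. a \<otimes>\<^bsub>S\<^esub> c g)"
    by (auto simp: free_module_def)
  have mem: "c g \<in> carrier S" if "c \<in> carrier (free_module S G)" for c g
    using that by (simp add: free_module_carrier)
  have zero: "(\<lambda>g. \<zero>\<^bsub>S\<^esub>) \<in> carrier (free_module S G)" by (simp add: free_module_carrier)
  show ?thesis
    by (intro moduleI abelian_groupI \<open>cring S\<close>; (unfold sel)?)
      (auto simp: add smult zero neg mem S.a_ac S.l_distr S.r_distr S.m_assoc)
qed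

text \<open>
  The support of a sum may be smaller than the union of the supports.  Summing over an arbitrary
  finite superset of the support gives both sides of a linearity statement the same index set.
\<close>

lemma lin_ext_eq_finsum:
  assumes N: "module S N" and c: "c \<in> carrier (free_module S G)"
    and A: "finite A" "{g. c g \<noteq> \<zero>\<^bsub>S\<^esub>} \<subseteq> A" "A \<subseteq> G" and \<phi>: "\<phi> \<in> G \<rightarrow> carrier N"
  shows "lin_ext S G N \<phi> c = (\<Oplus>\<^bsub>N\<^esub>g\<in>A. c g \<odot>\<^bsub>N\<^esub> \<phi> g)"
proof -
  interpret N: module S N by fact
  have "(\<Oplus>\<^bsub>N\<^esub>g\<in>{g. c g \<noteq> \<zero>\<^bsub>S\<^esub>}. c g \<odot>\<^bsub>N\<^esub> \<phi> g) = (\<Oplus>\<^bsub>N\<^esub>g\<in>A. c g \<odot>\<^bsub>N\<^esub> \<phi> g)"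
    using A \<phi> c by (intro N.M.add.finprod_mono_neutral_cong_left)
      (auto simp: free_module_carrier Pi_iff intro!: N.smult_closed)
  then show ?thesis using c by (simp add: lin_ext_def)
qed

lemma lin_ext_linear:
  assumes N: "module S N" and \<phi>: "\<phi> \<in> G \<rightarrow> carrier N"
  shows "lin_ext S G N \<phi> \<in> linear_maps S (free_module S G) N"
proof -
  interpret N: module S N by fact
  let ?F = "free_module S G" and ?l = "lin_ext S G N \<phi>"
  interpret F: module S ?F by (rule free_module_is_module) (rule N.is_cring)
  let ?s = "\<lambda>c. {g. c g \<noteq> \<zero>\<^bsub>S\<^esub>}"
  have mem: "c g \<in> carrier S" if "c \<in> carrier ?F" for c g
    using that by (simp add: free_module_carrier)
  have term_closed: "c g \<odot>\<^bsub>N\<^esub> \<phi> g \<in> carrier N" if "c \<in> carrier ?F" "g \<in> G" for c g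
    using that \<phi> mem by auto
  have s: "finite (?s c)" "?s c \<subseteq> G" if "c \<in> carrier ?F" for c
    using that by (auto simp: free_module_carrier)
  show ?thesis
  proof (rule linear_mapsI)
    fix c assume c: "c \<in> carrier ?F"
    have "?l c = (\<Oplus>\<^bsub>N\<^esub>g\<in>?s c. c g \<odot>\<^bsub>N\<^esub> \<phi> g)"
      using s[OF c] by (intro lin_ext_eq_finsum N c \<phi>) auto
    also have "\<dots> \<in> carrier N" using s[OF c] c term_closed by (intro N.M.finsum_closed) auto
    finally show "?l c \<in> carrier N" .
  next
    fix c assume "c \<notin> carrier ?F"
    then show "?l c = undefined" by (simp add: lin_ext_def)
  next
    fix c c' assume c: "c \<in> carrier ?F" "c' \<in> carrier ?F"
    let ?A = "?s c \<union> ?s c'"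
    have A: "finite ?A" "?A \<subseteq> G" using s[OF c(1)] s[OF c(2)] by auto
    have sum: "c \<oplus>\<^bsub>?F\<^esub> c' = (\<lambda>g. c g \<oplus>\<^bsub>S\<^esub> c' g)" by (simp add: free_module_def)
    have "?l (c \<oplus>\<^bsub>?F\<^esub> c') = (\<Oplus>\<^bsub>N\<^esub>g\<in>?A. (c \<oplus>\<^bsub>?F\<^esub> c') g \<odot>\<^bsub>N\<^esub> \<phi> g)"
      using A c by (intro lin_ext_eq_finsum N \<phi> F.M.a_closed) (auto simp: sum)
    also have "\<dots> = (\<Oplus>\<^bsub>N\<^esub>g\<in>?A. c g \<odot>\<^bsub>N\<^esub> \<phi> g \<oplus>\<^bsub>N\<^esub> c' g \<odot>\<^bsub>N\<^esub> \<phi> g)"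
      using A c \<phi> mem term_closed
      by (intro N.M.finsum_cong') (auto simp: sum Pi_iff subset_iff intro!: N.smult_l_distr)
    also have "\<dots> = (\<Oplus>\<^bsub>N\<^esub>g\<in>?A. c g \<odot>\<^bsub>N\<^esub> \<phi> g) \<oplus>\<^bsub>N\<^esub> (\<Oplus>\<^bsub>N\<^esub>g\<in>?A. c' g \<odot>\<^bsub>N\<^esub> \<phi> g)"
      using A c term_closed by (intro N.M.finsum_addf) auto
    also have "(\<Oplus>\<^bsub>N\<^esub>g\<in>?A. c g \<odot>\<^bsub>N\<^esub> \<phi> g) = ?l c"
      using A c by (intro lin_ext_eq_finsum[symmetric] N \<phi>) auto
    also have "(\<Oplus>\<^bsub>N\<^esub>g\<in>?A. c' g \<odot>\<^bsub>N\<^esub> \<phi> g) = ?l c'"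
      using A c by (intro lin_ext_eq_finsum[symmetric] N \<phi>) auto
    finally show "?l (c \<oplus>\<^bsub>?F\<^esub> c') = ?l c \<oplus>\<^bsub>N\<^esub> ?l c'" .
  next
    fix a c assume a: "a \<in> carrier S" and c: "c \<in> carrier ?F"
    have prod: "a \<odot>\<^bsub>?F\<^esub> c = (\<lambda>g. a \<otimes>\<^bsub>S\<^esub> c g)" by (simp add: free_module_def)
    have "?l (a \<odot>\<^bsub>?F\<^esub> c) = (\<Oplus>\<^bsub>N\<^esub>g\<in>?s c. (a \<odot>\<^bsub>?F\<^esub> c) g \<odot>\<^bsub>N\<^esub> \<phi> g)"
      using s[OF c] a c by (intro lin_ext_eq_finsum N \<phi> F.smult_closed) (auto simp: prod)
    also have "\<dots> = (\<Oplus>\<^bsub>N\<^esub>g\<in>?s c. a \<odot>\<^bsub>N\<^esub> (c g \<odot>\<^bsub>N\<^esub> \<phi> g))"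
      using s[OF c] a c \<phi> mem term_closed
      by (intro N.M.finsum_cong')
        (auto simp: prod Pi_iff subset_iff intro!: N.smult_closed N.smult_assoc1)
    also have "\<dots> = a \<odot>\<^bsub>N\<^esub> (\<Oplus>\<^bsub>N\<^esub>g\<in>?s c. c g \<odot>\<^bsub>N\<^esub> \<phi> g)"
      using s[OF c] a c term_closed by (intro N.finsum_smult_ldistr[symmetric]) auto
    also have "(\<Oplus>\<^bsub>N\<^esub>g\<in>?s c. c g \<odot>\<^bsub>N\<^esub> \<phi> g) = ?l c"
      using s[OF c] by (intro lin_ext_eq_finsum[symmetric] N c \<phi>) auto
    finally show "?l (a \<odot>\<^bsub>?F\<^esub> c) = a \<odot>\<^bsub>N\<^esub> ?l c" .
  qed
qed

text \<open>
  Over the zero ring the basis vector \<open>e\<close> has empty support.  The formula survives because then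
  \<open>\<phi> g\<close> is zero as well.
\<close>

lemma lin_ext_basis:
  assumes N: "module S N" and \<phi>: "\<phi> \<in> G \<rightarrow> carrier N" and g: "g \<in> G"
  defines "e \<equiv> (\<lambda>g'. if g' = g then \<one>\<^bsub>S\<^esub> else \<zero>\<^bsub>S\<^esub>)"
  shows "e \<in> carrier (free_module S G)" "lin_ext S G N \<phi> e = \<phi> g"
proof -
  interpret N: module S N by fact
  have "{g'. e g' \<noteq> \<zero>\<^bsub>S\<^esub>} \<subseteq> {g}" by (auto simp: e_def)
  then show e: "e \<in> carrier (free_module S G)"
    using finite_subset[of _ "{g}"] g by (auto simp: free_module_carrier e_def)
  have "lin_ext S G N \<phi> e = (\<Oplus>\<^bsub>N\<^esub>g'\<in>{g}. e g' \<odot>\<^bsub>N\<^esub> \<phi> g')"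
    using g by (intro lin_ext_eq_finsum N e \<phi>) (auto simp: e_def)
  also have "\<dots> = \<phi> g"
    using g \<phi> by (subst N.M.finsum_insert) (auto simp: e_def Pi_iff)
  finally show "lin_ext S G N \<phi> e = \<phi> g" .
qed

lemma lin_ext_cong:
  assumes N: "module S N" and "\<phi>' \<in> G \<rightarrow> carrier N" "\<And>g. g \<in> G \<Longrightarrow> \<phi> g = \<phi>' g"
    and c: "c \<in> carrier (free_module S G)"
  shows "lin_ext S G N \<phi> c = lin_ext S G N \<phi>' c"
proof -
  interpret N: module S N by fact
  let ?A = "{g. c g \<noteq> \<zero>\<^bsub>S\<^esub>}"
  have c': "?A \<subseteq> G" "\<And>g. c g \<in> carrier S" using c by (auto simp: free_module_carrier)
  have "(\<Oplus>\<^bsub>N\<^esub>g\<in>?A. c g \<odot>\<^bsub>N\<^esub> \<phi> g) = (\<Oplus>\<^bsub>N\<^esub>g\<in>?A. c g \<odot>\<^bsub>N\<^esub> \<phi>' g)"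
    using c' assms(2,3) by (intro N.M.finsum_cong') (auto simp: Pi_iff subset_iff)
  then show ?thesis using c by (simp add: lin_ext_def)
qed

lemma linear_maps_lin_ext:
  assumes h: "h \<in> linear_maps S N P" and N: "module S N" and P: "module S P"
    and \<phi>: "\<phi> \<in> G \<rightarrow> carrier N" and c: "c \<in> carrier (free_module S G)"
  shows "h (lin_ext S G N \<phi> c) = lin_ext S G P (\<lambda>g. h (\<phi> g)) c"
proof -
  interpret N: module S N by fact
  interpret P: module S P by fact
  let ?A = "{g. c g \<noteq> \<zero>\<^bsub>S\<^esub>}"
  have c': "finite ?A" "?A \<subseteq> G" "\<And>g. c g \<in> carrier S" using c by (auto simp: free_module_carrier)
  have "h (lin_ext S G N \<phi> c) = h (\<Oplus>\<^bsub>N\<^esub>g\<in>?A. c g \<odot>\<^bsub>N\<^esub> \<phi> g)" using c by (simp add: lin_ext_def)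
  also have "\<dots> = (\<Oplus>\<^bsub>P\<^esub>g\<in>?A. h (c g \<odot>\<^bsub>N\<^esub> \<phi> g))"
    using c' \<phi> by (intro linear_maps_finsum[OF h N P]) auto
  also have "\<dots> = (\<Oplus>\<^bsub>P\<^esub>g\<in>?A. c g \<odot>\<^bsub>P\<^esub> h (\<phi> g))"
    using c' \<phi> linear_maps_closed[OF h] by (intro P.M.finsum_cong')
      (auto simp: linear_maps_smult[OF h] Pi_iff subset_iff)
  finally show ?thesis using c by (simp add: lin_ext_def)
qed

text \<open>
  Consecutive maps of the standard resolution compose to zero by this lemma, because each of them
  sends its generators into the kernel of the next.
\<close>

lemma lin_ext_into_kernel:
  assumes h: "h \<in> linear_maps S N P" and N: "module S N" and P: "module S P"
    and \<phi>: "\<phi> \<in> G \<rightarrow> {x \<in> carrier N. h x = \<zero>\<^bsub>P\<^esub>}" and c: "c \<in> carrier (free_module S G)"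
  shows "h (lin_ext S G N \<phi> c) = \<zero>\<^bsub>P\<^esub>"
proof -
  interpret P: module S P by fact
  let ?A = "{g. c g \<noteq> \<zero>\<^bsub>S\<^esub>}"
  have c': "\<And>g. c g \<in> carrier S" using c by (auto simp: free_module_carrier)
  have "h (lin_ext S G N \<phi> c) = lin_ext S G P (\<lambda>g. h (\<phi> g)) c"
    using \<phi> by (intro linear_maps_lin_ext h N P c) auto
  also have "\<dots> = lin_ext S G P (\<lambda>g. \<zero>\<^bsub>P\<^esub>) c"
    using \<phi> by (intro lin_ext_cong P c) auto
  also have "\<dots> = \<zero>\<^bsub>P\<^esub>" using c c' by (simp add: lin_ext_def)
  finally show ?thesis .
qed

text \<open>
  A finitely supported function is determined by its graph over its support, which is finite, so
  \<open>Abs_fset\<close> loses no information.  Hence decoding a syzygy recovers the kernel element, and the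
  standard resolution is exact.
\<close>

lemma syz_code_inj:
  assumes "finite {g. c g \<noteq> \<zero>\<^bsub>S\<^esub>}" "finite {g. c' g \<noteq> \<zero>\<^bsub>S\<^esub>}" "syz_code S c = syz_code S c'"
  shows "c = c'"
proof
  fix g
  let ?E = "\<lambda>c. (\<lambda>g. (g, c g)) ` {g. c g \<noteq> \<zero>\<^bsub>S\<^esub>}"
  have "?E c = ?E c'"
    using assms by (auto simp: syz_code_def Abs_fset_inject)
  then have "(g, a) \<in> ?E c \<longleftrightarrow> (g, a) \<in> ?E c'" for a by simp
  then have "c g \<noteq> \<zero>\<^bsub>S\<^esub> \<and> a = c g \<longleftrightarrow> c' g \<noteq> \<zero>\<^bsub>S\<^esub> \<and> a = c' g" for a by auto
  then show "c g = c' g" by metis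
qed

text \<open>
  In a trivial factor group the coset of \<open>\<phi>\<close> is the subgroup of coboundaries itself.  The
  coset contains \<open>\<phi>\<close>, since zero is a coboundary.
\<close>

lemma Ext_1_trivial_imp:
  assumes triv: "trivial_group (Ext S 1 N M)" and M: "module S M"
    and F: "module S (res_module S N 0)"
    and d: "res_map S N 0 \<in> linear_maps S (res_module S N 1) (res_module S N 0)"
    and \<phi>: "\<phi> \<in> ext_cocycles S 1 N M"
  shows "\<exists>\<psi>\<in>linear_maps S (res_module S N 0) M.
    \<forall>x\<in>carrier (res_module S N 1). \<phi> x = \<psi> (res_map S N 0 x)"
proof -
  interpret M: module S M by fact
  let ?G = "add_monoid (hom_module S (res_module S N 1) M \<lparr>carrier := ext_cocycles S 1 N M\<rparr>)"
  let ?H = "ext_coboundaries S 1 N M"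
  have H: "?H = (\<lambda>\<psi>. compose (carrier (res_module S N 1)) \<psi> (res_map S N 0)) `
      linear_maps S (res_module S N 0) M"
    by (simp add: ext_coboundaries_def)
  have "carrier (?G Mod ?H) = {\<one>\<^bsub>?G Mod ?H\<^esub>}"
    using triv unfolding trivial_group_def Ext_def by simp
  moreover have "?H #>\<^bsub>?G\<^esub> \<phi> \<in> carrier (?G Mod ?H)"
    using \<phi> by (auto simp: FactGroup_def RCOSETS_def)
  ultimately have coset: "?H #>\<^bsub>?G\<^esub> \<phi> = ?H" by (auto simp: FactGroup_def)
  let ?z = "\<lambda>x\<in>carrier (res_module S N 1). \<zero>\<^bsub>M\<^esub>"
  have "?z = compose (carrier (res_module S N 1))
      (\<lambda>x\<in>carrier (res_module S N 0). \<zero>\<^bsub>M\<^esub>) (res_map S N 0)"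
    using linear_maps_closed[OF d] by (auto simp: compose_def restrict_def fun_eq_iff)
  then have z: "?z \<in> ?H" unfolding H using linear_maps_zero_map[OF F M] by auto
  have \<phi>_lin: "\<phi> \<in> linear_maps S (res_module S N 1) M"
    using \<phi> by (simp add: ext_cocycles_def)
  have "?z \<otimes>\<^bsub>?G\<^esub> \<phi> = \<phi>"
  proof
    fix x
    show "(?z \<otimes>\<^bsub>?G\<^esub> \<phi>) x = \<phi> x"
      using \<phi>_lin linear_maps_closed[OF \<phi>_lin]
      by (cases "x \<in> carrier (res_module S N 1)")
        (auto simp: hom_module_def add_map_def linear_maps_def)
  qed
  then have "\<phi> \<in> ?H #>\<^bsub>?G\<^esub> \<phi>" using z unfolding r_coset_def by force
  then have "\<phi> \<in> ?H" using coset by simp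
  then show ?thesis unfolding H by (auto simp: compose_def)
qed

text \<open>
  The surjectivity of \<open>Hom(N, M) \<rightarrow> Hom(N[f], M)\<close>, a piece of the long exact sequence of
  \<open>0 \<rightarrow> N[f] \<rightarrow> N \<rightarrow> N \<rightarrow> 0\<close>, made explicit on the standard resolution
  \<open>F2 \<rightarrow> F1 \<rightarrow> F0 \<rightarrow> N\<close>.  As \<open>F0\<close> is free, the augmentation \<open>\<epsilon>\<close> lifts to \<open>\<rho>\<close> with \<open>f \<rho> = \<epsilon>\<close>.
  It maps the kernel of \<open>\<epsilon>\<close> to \<open>N[f]\<close>, so \<open>\<phi> \<rho> d1\<close> is a cocycle; it represents the image of
  \<open>\<phi>\<close> under the connecting homomorphism.  Writing it as \<open>\<psi> d1\<close> gives \<open>\<psi> = \<phi> \<rho>\<close> on the kernel of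
  \<open>\<epsilon>\<close>, and \<open>\<theta> x = \<phi> (x - \<rho> c) + \<psi> c\<close>, for any \<open>c\<close> with \<open>\<epsilon> c = f x\<close>, is the extension.
\<close>

lemma extend_from_torsion:
  fixes S :: "('s, 'e) ring_scheme" and N :: "('s, 'n) module" and M :: "('s, 'm) module"
  assumes N: "module S N" and M: "module S M" and f: "f \<in> carrier S"
    and div: "divisible_module N f" and triv: "trivial_group (Ext S 1 N M)"
    and \<phi>: "\<And>x. x \<in> carrier N \<Longrightarrow> f \<odot>\<^bsub>N\<^esub> x = \<zero>\<^bsub>N\<^esub> \<Longrightarrow> \<phi> x \<in> carrier M"
    and \<phi>_add: "\<And>x y. x \<in> carrier N \<Longrightarrow> f \<odot>\<^bsub>N\<^esub> x = \<zero>\<^bsub>N\<^esub> \<Longrightarrow> y \<in> carrier N \<Longrightarrow> f \<odot>\<^bsub>N\<^esub> y = \<zero>\<^bsub>N\<^esub> \<Longrightarrow>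
      \<phi> (x \<oplus>\<^bsub>N\<^esub> y) = \<phi> x \<oplus>\<^bsub>M\<^esub> \<phi> y"
    and \<phi>_smult: "\<And>a x. a \<in> carrier S \<Longrightarrow> x \<in> carrier N \<Longrightarrow> f \<odot>\<^bsub>N\<^esub> x = \<zero>\<^bsub>N\<^esub> \<Longrightarrow>
      \<phi> (a \<odot>\<^bsub>N\<^esub> x) = a \<odot>\<^bsub>M\<^esub> \<phi> x"
  shows "\<exists>\<theta>\<in>linear_maps S N M. \<forall>x\<in>carrier N. f \<odot>\<^bsub>N\<^esub> x = \<zero>\<^bsub>N\<^esub> \<longrightarrow> \<theta> x = \<phi> x"
proof -
  interpret N: module S N by fact
  interpret M: module S M by fact
  define T where "T = {x \<in> carrier N. f \<odot>\<^bsub>N\<^esub> x = \<zero>\<^bsub>N\<^esub>}"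
  define G0 :: "('s, 'n) generator set" where "G0 = Gen ` carrier N"
  define F0 where "F0 = free_module S G0"
  define \<epsilon> where "\<epsilon> = augmentation S N"
  define K0 where "K0 = a_kernel F0 N \<epsilon>"
  define G1 where "G1 = syz_code S ` K0"
  define F1 where "F1 = free_module S G1"
  define d1 where "d1 = lin_ext S G1 F0 (inv_into K0 (syz_code S))"
  define K1 where "K1 = a_kernel F1 F0 d1"
  define G2 where "G2 = syz_code S ` K1"
  define F2 where "F2 = free_module S G2"
  define d2 where "d2 = lin_ext S G2 F1 (inv_into K1 (syz_code S))"
  note defs = G0_def F0_def \<epsilon>_def K0_def G1_def F1_def d1_def K1_def G2_def F2_def d2_def
  have data0: "res_data S N 0 = (G0, K0)" by (simp add: defs)
  have data1: "res_data S N (Suc 0) = (G1, K1)"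
    unfolding res_data.simps(2) data0 by (simp add: Let_def defs)
  have data2: "fst (res_data S N (Suc (Suc 0))) = G2"
    unfolding res_data.simps(2)[of S N "Suc 0"] data1 by (simp add: Let_def defs)
  have mods: "res_module S N 0 = F0" "res_module S N 1 = F1" "res_module S N (Suc 1) = F2"
    unfolding res_module_def One_nat_def data0 data1 data2 by (simp_all add: defs)
  have maps: "res_map S N 0 = d1" "res_map S N 1 = d2"
    unfolding res_map_def mods[unfolded One_nat_def] data0 data1 data2 One_nat_def
    by (simp_all add: defs)
  have F0: "module S F0" and F1: "module S F1" and F2: "module S F2"
    unfolding F0_def F1_def F2_def by (simp_all add: free_module_is_module N.is_cring)
  interpret F0: module S F0 by (rule F0)
  have ker: "K0 = {c \<in> carrier F0. \<epsilon> c = \<zero>\<^bsub>N\<^esub>}" "K1 = {c \<in> carrier F1. d1 c = \<zero>\<^bsub>F0\<^esub>}"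
    unfolding K0_def K1_def a_kernel_def kernel_def by auto
  define dec :: "('s, 'n) generator \<Rightarrow> 'n" where "dec = inv_into (carrier N) Gen"
  have dec0: "dec \<in> G0 \<rightarrow> carrier N" unfolding G0_def dec_def by (auto intro: inv_into_into)
  have dec1: "inv_into K0 (syz_code S) \<in> G1 \<rightarrow> K0" unfolding G1_def by (auto intro: inv_into_into)
  have dec2: "inv_into K1 (syz_code S) \<in> G2 \<rightarrow> K1" unfolding G2_def by (auto intro: inv_into_into)
  have \<epsilon>_eq: "\<epsilon> = lin_ext S G0 N dec" by (simp add: \<epsilon>_def augmentation_def G0_def dec_def)
  have \<epsilon>: "\<epsilon> \<in> linear_maps S F0 N"
    unfolding \<epsilon>_eq F0_def by (intro lin_ext_linear N dec0)
  have d1: "d1 \<in> linear_maps S F1 F0"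
    unfolding d1_def F1_def using dec1 ker by (intro lin_ext_linear F0) auto
  have d2: "d2 \<in> linear_maps S F2 F1"
    unfolding d2_def F2_def using dec2 ker by (intro lin_ext_linear F1) auto
  have d1_K0: "d1 x \<in> K0" if "x \<in> carrier F1" for x
    using that linear_maps_closed[OF d1 that] lin_ext_into_kernel[OF \<epsilon> F0 N, of _ G1 x] dec1
    unfolding ker d1_def F1_def by auto
  have d1_d2: "d1 (d2 x) = \<zero>\<^bsub>F0\<^esub>" if "x \<in> carrier F2" for x
    using that lin_ext_into_kernel[OF d1 F1 F0, of _ G2 x] dec2
    unfolding ker d2_def F2_def by auto

  define \<rho>0 where "\<rho>0 = (\<lambda>g. SOME y. y \<in> carrier N \<and> f \<odot>\<^bsub>N\<^esub> y = dec g)"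
  have \<rho>0: "\<rho>0 g \<in> carrier N" "f \<odot>\<^bsub>N\<^esub> \<rho>0 g = dec g" if "g \<in> G0" for g
  proof -
    have "\<exists>y. y \<in> carrier N \<and> f \<odot>\<^bsub>N\<^esub> y = dec g"
      using div dec0 that unfolding divisible_module_def by (auto simp: Pi_iff)
    then show "\<rho>0 g \<in> carrier N" "f \<odot>\<^bsub>N\<^esub> \<rho>0 g = dec g"
      unfolding \<rho>0_def by (metis (mono_tags, lifting) someI_ex)+
  qed
  define \<rho> where "\<rho> = lin_ext S G0 N \<rho>0"
  have \<rho>: "\<rho> \<in> linear_maps S F0 N"
    unfolding \<rho>_def F0_def using \<rho>0 by (intro lin_ext_linear N) auto
  have f_lin: "(\<lambda>x\<in>carrier N. f \<odot>\<^bsub>N\<^esub> x) \<in> linear_maps S N N"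
    using linear_maps_smult_map[OF linear_maps_id[OF N] f N N]
    by (simp add: restrict_def cong: if_cong)
  have f_\<rho>: "f \<odot>\<^bsub>N\<^esub> \<rho> c = \<epsilon> c" if c: "c \<in> carrier F0" for c
  proof -
    have "f \<odot>\<^bsub>N\<^esub> \<rho> c = lin_ext S G0 N (\<lambda>g. (\<lambda>x\<in>carrier N. f \<odot>\<^bsub>N\<^esub> x) (\<rho>0 g)) c"
      using linear_maps_lin_ext[OF f_lin N N, of \<rho>0 G0 c] \<rho>0 c linear_maps_closed[OF \<rho> c]
      by (auto simp: \<rho>_def F0_def)
    also have "\<dots> = \<epsilon> c"
      unfolding \<epsilon>_eq using c \<rho>0 by (intro lin_ext_cong N dec0) (auto simp: F0_def)
    finally show ?thesis .
  qed
  have \<rho>_T: "\<rho> c \<in> T" if "c \<in> K0" for c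
    using that f_\<rho> linear_maps_closed[OF \<rho>] by (auto simp: T_def ker)
  have \<phi>_zero: "\<phi> \<zero>\<^bsub>N\<^esub> = \<zero>\<^bsub>M\<^esub>"
    using \<phi>_smult[of "\<zero>\<^bsub>S\<^esub>" "\<zero>\<^bsub>N\<^esub>"] \<phi>[of "\<zero>\<^bsub>N\<^esub>"] f by simp

  define \<Phi> where "\<Phi> = (\<lambda>x\<in>carrier F1. \<phi> (\<rho> (d1 x)))"
  have \<rho>d: "\<rho> (d1 x) \<in> carrier N" "f \<odot>\<^bsub>N\<^esub> \<rho> (d1 x) = \<zero>\<^bsub>N\<^esub>" if "x \<in> carrier F1" for x
    using \<rho>_T[OF d1_K0[OF that]] by (auto simp: T_def)
  have "\<Phi> \<in> linear_maps S F1 M"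
    unfolding \<Phi>_def
    by (intro linear_maps_restrictI F1)
      (simp_all add: \<phi> \<rho>d linear_maps_add[OF d1] linear_maps_add[OF \<rho>] linear_maps_closed[OF d1]
        linear_maps_smult[OF d1] linear_maps_smult[OF \<rho>] \<phi>_add \<phi>_smult)
  moreover have "\<Phi> (d2 x) = \<zero>\<^bsub>M\<^esub>" if "x \<in> carrier F2" for x
    using that linear_maps_closed[OF d2 that]
    by (simp add: \<Phi>_def d1_d2 linear_maps_zero[OF \<rho> F0 N] \<phi>_zero)
  ultimately have "\<Phi> \<in> ext_cocycles S 1 N M"
    unfolding ext_cocycles_def mods maps by auto
  from Ext_1_trivial_imp[OF triv M _ _ this, unfolded mods maps, OF F0 d1]
  obtain \<psi> where \<psi>: "\<psi> \<in> linear_maps S F0 M" "\<And>x. x \<in> carrier F1 \<Longrightarrow> \<Phi> x = \<psi> (d1 x)" by auto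
  \<comment> \<open>By exactness, each element of the kernel is the image under \<open>d1\<close> of its own generator.\<close>
  have \<psi>_K0: "\<psi> k = \<phi> (\<rho> k)" if k: "k \<in> K0" for k
  proof -
    have fin: "finite {g. c g \<noteq> \<zero>\<^bsub>S\<^esub>}" if "c \<in> K0" for c
      using that unfolding ker F0_def by (auto simp: free_module_carrier)
    have "inj_on (syz_code S) K0" by (auto intro!: inj_onI syz_code_inj fin)
    then have "inv_into K0 (syz_code S) (syz_code S k) = k" using k by simp
    moreover have "syz_code S k \<in> G1" using k by (simp add: G1_def)
    ultimately obtain e where "e \<in> carrier F1" "d1 e = k"
      unfolding d1_def F1_def using lin_ext_basis[OF F0, of "inv_into K0 (syz_code S)" G1 "syz_code S k"]
        dec1 ker by force
    then show ?thesis using \<psi>(2) by (auto simp: \<Phi>_def)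
  qed

  define cf where "cf = (\<lambda>x. SOME c. c \<in> carrier F0 \<and> \<epsilon> c = f \<odot>\<^bsub>N\<^esub> x)"
  have cf: "cf x \<in> carrier F0" "\<epsilon> (cf x) = f \<odot>\<^bsub>N\<^esub> x" if x: "x \<in> carrier N" for x
  proof -
    have "f \<odot>\<^bsub>N\<^esub> x \<in> carrier N" using f x by simp
    then have "dec (Gen (f \<odot>\<^bsub>N\<^esub> x)) = f \<odot>\<^bsub>N\<^esub> x" "Gen (f \<odot>\<^bsub>N\<^esub> x) \<in> G0"
      by (auto simp: G0_def dec_def inj_on_def)
    then have "\<exists>c. c \<in> carrier F0 \<and> \<epsilon> c = f \<odot>\<^bsub>N\<^esub> x"
      unfolding \<epsilon>_eq F0_def using lin_ext_basis[OF N dec0, of "Gen (f \<odot>\<^bsub>N\<^esub> x)"] by metis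
    then show "cf x \<in> carrier F0" "\<epsilon> (cf x) = f \<odot>\<^bsub>N\<^esub> x"
      unfolding cf_def by (metis (mono_tags, lifting) someI_ex)+
  qed
  define \<theta> where "\<theta> = (\<lambda>x. \<phi> (x \<ominus>\<^bsub>N\<^esub> \<rho> (cf x)) \<oplus>\<^bsub>M\<^esub> \<psi> (cf x))"
  have rem_T: "x \<ominus>\<^bsub>N\<^esub> \<rho> c \<in> carrier N" "f \<odot>\<^bsub>N\<^esub> (x \<ominus>\<^bsub>N\<^esub> \<rho> c) = \<zero>\<^bsub>N\<^esub>"
    if "x \<in> carrier N" "c \<in> carrier F0" "\<epsilon> c = f \<odot>\<^bsub>N\<^esub> x" for x c
    using that f linear_maps_closed[OF \<rho>, of c]
    by (simp_all add: N.M.minus_eq N.smult_r_distr N.smult_r_minus f_\<rho> N.M.r_neg)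
  \<comment> \<open>The value of \<open>\<theta>\<close> does not depend on the chosen preimage, as \<open>\<psi> = \<phi> \<circ> \<rho>\<close> on the kernel.\<close>
  have \<theta>: "\<theta> x = \<phi> (x \<ominus>\<^bsub>N\<^esub> \<rho> c) \<oplus>\<^bsub>M\<^esub> \<psi> c"
    if x: "x \<in> carrier N" and c: "c \<in> carrier F0" "\<epsilon> c = f \<odot>\<^bsub>N\<^esub> x" for x c
  proof -
    \<comment> \<open>Two preimages differ by an element of \<open>K0\<close>.\<close>
    define k where "k = c \<ominus>\<^bsub>F0\<^esub> cf x"
    have k: "k \<in> carrier F0" "c = k \<oplus>\<^bsub>F0\<^esub> cf x"
      using c cf[OF x] by (simp_all add: k_def F0.M.minus_eq F0.M.a_assoc F0.M.l_neg)
    have "\<epsilon> k = \<zero>\<^bsub>N\<^esub>"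
      using c cf[OF x] x f
      by (simp add: k_def F0.M.minus_eq linear_maps_add[OF \<epsilon>] linear_maps_neg[OF \<epsilon> F0 N] N.M.r_neg)
    then have kK: "k \<in> K0" using k by (simp add: ker)
    have cl: "\<rho> k \<in> carrier N" "\<rho> (cf x) \<in> carrier N" "\<psi> k \<in> carrier M" "\<psi> (cf x) \<in> carrier M"
      using k cf[OF x] linear_maps_closed[OF \<rho>] linear_maps_closed[OF \<psi>(1)] by auto
    have "x \<ominus>\<^bsub>N\<^esub> \<rho> (cf x) = (x \<ominus>\<^bsub>N\<^esub> \<rho> c) \<oplus>\<^bsub>N\<^esub> \<rho> k"
      using k cf[OF x] cl x
      by (simp add: linear_maps_add[OF \<rho>] N.M.minus_eq N.M.minus_add N.M.a_ac N.M.r_neg2)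
    moreover have "\<phi> ((x \<ominus>\<^bsub>N\<^esub> \<rho> c) \<oplus>\<^bsub>N\<^esub> \<rho> k) = \<phi> (x \<ominus>\<^bsub>N\<^esub> \<rho> c) \<oplus>\<^bsub>M\<^esub> \<psi> k"
      using \<rho>_T[OF kK] rem_T[OF x c] by (simp add: \<phi>_add T_def \<psi>_K0[OF kK])
    ultimately show ?thesis
      using cl \<phi>[OF rem_T[OF x c]] k cf[OF x]
      by (simp add: \<theta>_def linear_maps_add[OF \<psi>(1)] M.M.a_assoc)
  qed
  have cl: "\<rho> (cf x) \<in> carrier N" "\<psi> (cf x) \<in> carrier M" "\<phi> (x \<ominus>\<^bsub>N\<^esub> \<rho> (cf x)) \<in> carrier M"
    if "x \<in> carrier N" for x
    using cf[OF that] linear_maps_closed[OF \<rho>] linear_maps_closed[OF \<psi>(1)] \<phi> rem_T[OF that cf[OF that]]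
    by auto
  have "(\<lambda>x\<in>carrier N. \<theta> x) \<in> linear_maps S N M"
  proof (rule linear_maps_restrictI[OF N])
    fix x assume "x \<in> carrier N"
    then show "\<theta> x \<in> carrier M" using cl by (simp add: \<theta>_def)
  next
    fix x y assume x: "x \<in> carrier N" and y: "y \<in> carrier N"
    have "\<theta> (x \<oplus>\<^bsub>N\<^esub> y) = \<phi> ((x \<oplus>\<^bsub>N\<^esub> y) \<ominus>\<^bsub>N\<^esub> \<rho> (cf x \<oplus>\<^bsub>F0\<^esub> cf y)) \<oplus>\<^bsub>M\<^esub> \<psi> (cf x \<oplus>\<^bsub>F0\<^esub> cf y)"
      using x y f cf[OF x] cf[OF y]
      by (intro \<theta>) (auto simp: linear_maps_add[OF \<epsilon>] N.smult_r_distr)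
    also have "(x \<oplus>\<^bsub>N\<^esub> y) \<ominus>\<^bsub>N\<^esub> \<rho> (cf x \<oplus>\<^bsub>F0\<^esub> cf y) = (x \<ominus>\<^bsub>N\<^esub> \<rho> (cf x)) \<oplus>\<^bsub>N\<^esub> (y \<ominus>\<^bsub>N\<^esub> \<rho> (cf y))"
      using x y cf[OF x] cf[OF y] cl[OF x] cl[OF y]
      by (simp add: linear_maps_add[OF \<rho>] N.M.minus_eq N.M.minus_add N.M.a_ac)
    finally show "\<theta> (x \<oplus>\<^bsub>N\<^esub> y) = \<theta> x \<oplus>\<^bsub>M\<^esub> \<theta> y"
      using cl[OF x] cl[OF y] cf[OF x] cf[OF y] rem_T[OF x cf[OF x]] rem_T[OF y cf[OF y]]
      by (simp add: \<theta>_def \<phi>_add linear_maps_add[OF \<psi>(1)] M.M.a_ac)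
  next
    fix a x assume a: "a \<in> carrier S" and x: "x \<in> carrier N"
    have "\<theta> (a \<odot>\<^bsub>N\<^esub> x) = \<phi> (a \<odot>\<^bsub>N\<^esub> x \<ominus>\<^bsub>N\<^esub> \<rho> (a \<odot>\<^bsub>F0\<^esub> cf x)) \<oplus>\<^bsub>M\<^esub> \<psi> (a \<odot>\<^bsub>F0\<^esub> cf x)"
      using x a f cf[OF x]
      by (intro \<theta>) (auto simp: linear_maps_smult[OF \<epsilon>] N.smult_assoc1[symmetric] N.R.m_comm)
    also have "a \<odot>\<^bsub>N\<^esub> x \<ominus>\<^bsub>N\<^esub> \<rho> (a \<odot>\<^bsub>F0\<^esub> cf x) = a \<odot>\<^bsub>N\<^esub> (x \<ominus>\<^bsub>N\<^esub> \<rho> (cf x))"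
      using x a cf[OF x] cl[OF x]
      by (simp add: linear_maps_smult[OF \<rho>] N.M.minus_eq N.smult_r_distr N.smult_r_minus)
    finally show "\<theta> (a \<odot>\<^bsub>N\<^esub> x) = a \<odot>\<^bsub>M\<^esub> \<theta> x"
      using a cl[OF x] cf[OF x] rem_T[OF x cf[OF x]]
      by (simp add: \<theta>_def \<phi>_smult linear_maps_smult[OF \<psi>(1)] M.smult_r_distr)
  qed
  moreover have "\<theta> x = \<phi> x" if x: "x \<in> carrier N" "f \<odot>\<^bsub>N\<^esub> x = \<zero>\<^bsub>N\<^esub>" for x
    using x \<theta>[of x "\<zero>\<^bsub>F0\<^esub>"] \<phi>[OF x]
    by (simp add: linear_maps_zero[OF \<epsilon> F0 N] linear_maps_zero[OF \<rho> F0 N]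
        linear_maps_zero[OF \<psi>(1) F0 M] N.M.minus_eq module_minus_zero[OF N])
  ultimately show ?thesis by (intro bexI[of _ "\<lambda>x\<in>carrier N. \<theta> x"]) auto
qed

section \<open>The functor \<open>Hom\<^sub>S(R, -)\<close> on modules\<close>

text \<open>
  The quotient module \<open>S/(f)\<close> is cyclic, so a homomorphism out of it is determined by its value at
  \<open>1\<close>.  Below, equalities in \<open>Hom\<^sub>S(R, M)\<close> are always checked at \<open>1\<close> (\<open>hom_eqI\<close>), where the
  operations of \<open>Hom\<^sub>S(R, M)\<close> become those of \<open>M\<close>.
\<close>

locale principal_quotient = cring S for S :: "('s, 'e) ring_scheme" +
  fixes f :: 's
  assumes f_closed: "f \<in> carrier S"
begin

abbreviation R :: "'s set ring"
  where "R \<equiv> quotient_ring S f"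

abbreviation HomR :: "('s, 'm) module \<Rightarrow> ('s set, 's set \<Rightarrow> 'm) module"
  where "HomR \<equiv> hom_from_quotient S f"

definition proj :: "'s \<Rightarrow> 's set"
  where "proj a = PIdl\<^bsub>S\<^esub> f +>\<^bsub>S\<^esub> a"

lemma ideal_f: "ideal (PIdl\<^bsub>S\<^esub> f) S"
  by (rule cgenideal_ideal[OF f_closed])

lemma quotient_cring: "cring R"
  unfolding quotient_ring_def using ideal.quotient_is_cring[OF ideal_f] is_cring by simp

lemma proj_hom: "proj \<in> ring_hom S R"
  using ideal.rcos_ring_hom[OF ideal_f] unfolding quotient_ring_def proj_def by simp

lemma proj_simps:
  "a \<in> carrier S \<Longrightarrow> proj a \<in> carrier R"
  "a \<in> carrier S \<Longrightarrow> b \<in> carrier S \<Longrightarrow> proj (a \<oplus>\<^bsub>S\<^esub> b) = proj a \<oplus>\<^bsub>R\<^esub> proj b"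
  "a \<in> carrier S \<Longrightarrow> b \<in> carrier S \<Longrightarrow> proj (a \<otimes>\<^bsub>S\<^esub> b) = proj a \<otimes>\<^bsub>R\<^esub> proj b"
  "proj \<one>\<^bsub>S\<^esub> = \<one>\<^bsub>R\<^esub>"
  "proj \<zero>\<^bsub>S\<^esub> = \<zero>\<^bsub>R\<^esub>"
  using proj_hom ring_hom_zero[OF proj_hom ring_axioms cring.axioms(1)[OF quotient_cring]]
  by (auto simp: ring_hom_def)

lemma proj_surj:
  assumes "r \<in> carrier R"
  obtains a where "a \<in> carrier S" "r = proj a"
  using assms unfolding quotient_ring_def FactRing_def proj_def by (auto simp: A_RCOSETS_def')

lemma proj_eqD:
  assumes "a \<in> carrier S" "b \<in> carrier S" "proj a = proj b"
  shows "\<exists>c\<in>carrier S. a = b \<oplus>\<^bsub>S\<^esub> c \<otimes>\<^bsub>S\<^esub> f"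
proof -
  have "a \<in> proj a"
    unfolding proj_def
    using abelian_subgroup.a_rcos_self[OF abelian_subgroupI3[OF _ is_abelian_group]] assms(1)
      ideal.axioms(1)[OF ideal_f] by blast
  then have "a \<in> proj b" using assms(3) by simp
  then show ?thesis
    using assms(2) f_closed
    by (auto simp: proj_def a_r_coset_def' cgenideal_def a_comm)
qed

lemma proj_f: "proj f = \<zero>\<^bsub>R\<^esub>"
  using a_rcos_zero[OF ideal_f cgenideal_self[OF f_closed]]
  by (simp add: proj_def quotient_ring_def FactRing_def)

lemma quotient_module_simps:
  "carrier (quotient_module S f) = carrier R"
  "zero (quotient_module S f) = zero R"
  "add (quotient_module S f) = add R"
  "smult (quotient_module S f) a r = proj a \<otimes>\<^bsub>R\<^esub> r"
  by (simp_all add: quotient_module_def proj_def)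

lemma quotient_module_is_module: "module S (quotient_module S f)"
proof -
  interpret R: cring R by (rule quotient_cring)
  have neg: "\<exists>s\<in>carrier R. s \<oplus>\<^bsub>R\<^esub> r = \<zero>\<^bsub>R\<^esub>"
    if "r \<in> carrier R" for r
    using that R.l_neg by (intro bexI[of _ "\<ominus>\<^bsub>R\<^esub> r"]) auto
  show ?thesis
    by (intro moduleI abelian_groupI is_cring; (unfold quotient_module_simps)?)
      (use neg in \<open>auto simp: proj_simps R.a_ac R.l_distr R.r_distr R.m_assoc\<close>)
qed

lemma hom_carrier: "carrier (HomR M) = linear_maps S (quotient_module S f) M"
  by (simp add: hom_from_quotient_def)

lemma hom_apply:
  assumes "h \<in> carrier (HomR M)" "a \<in> carrier S"
  shows "h (proj a) = a \<odot>\<^bsub>M\<^esub> h \<one>\<^bsub>R\<^esub>"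
proof -
  interpret R: cring R by (rule quotient_cring)
  show ?thesis
    using linear_maps_smult[of h S "quotient_module S f" M a "\<one>\<^bsub>R\<^esub>"] assms
    by (simp add: hom_carrier quotient_module_simps proj_simps)
qed

lemma hom_eval_closed:
  assumes "h \<in> carrier (HomR M)"
  shows "h \<one>\<^bsub>R\<^esub> \<in> carrier M"
proof -
  interpret R: cring R by (rule quotient_cring)
  show ?thesis using assms
    by (auto simp: hom_carrier quotient_module_simps intro: linear_maps_closed)
qed

lemma hom_eval_torsion:
  assumes "module S M" "h \<in> carrier (HomR M)"
  shows "f \<odot>\<^bsub>M\<^esub> h \<one>\<^bsub>R\<^esub> = \<zero>\<^bsub>M\<^esub>"
proof -
  have "f \<odot>\<^bsub>M\<^esub> h \<one>\<^bsub>R\<^esub> = h \<zero>\<^bsub>quotient_module S f\<^esub>"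
    using hom_apply[OF assms(2) f_closed] by (simp add: proj_f quotient_module_simps)
  then show ?thesis
    using assms linear_maps_zero[OF _ quotient_module_is_module, of h] by (simp add: hom_carrier)
qed

lemma hom_eqI:
  assumes "h \<in> carrier (HomR M)" "h' \<in> carrier (HomR M)"
    and "h \<one>\<^bsub>R\<^esub> = h' \<one>\<^bsub>R\<^esub>"
  shows "h = h'"
proof (rule linear_maps_eqI)
  show "h \<in> linear_maps S (quotient_module S f) M" "h' \<in> linear_maps S (quotient_module S f) M"
    using assms by (simp_all add: hom_carrier)
  fix r assume "r \<in> carrier (quotient_module S f)"
  then obtain a where "a \<in> carrier S" "r = proj a" by (auto simp: quotient_module_simps elim: proj_surj)
  then show "h r = h' r" using assms by (simp add: hom_apply)
qed

text \<open>
  For \<open>x\<close> in \<open>M[f]\<close>, this is the homomorphism \<open>R \<rightarrow> M\<close> with value \<open>x\<close> at \<open>1\<close>.  The chosen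
  representative \<open>a\<close> of \<open>r\<close> does not matter then, as \<open>f\<close> kills \<open>x\<close>.
\<close>

definition hom_at :: "('s, 'm) module \<Rightarrow> 'm \<Rightarrow> 's set \<Rightarrow> 'm"
  where "hom_at M x =
    (\<lambda>r\<in>carrier R. (SOME a. a \<in> carrier S \<and> r = proj a) \<odot>\<^bsub>M\<^esub> x)"

lemma hom_at:
  assumes M: "module S M" and x: "x \<in> carrier M" "f \<odot>\<^bsub>M\<^esub> x = \<zero>\<^bsub>M\<^esub>"
  shows "hom_at M x \<in> carrier (HomR M)"
    and "hom_at M x \<one>\<^bsub>R\<^esub> = x"
proof -
  interpret M: module S M by fact
  interpret R: cring R by (rule quotient_cring)
  have at: "hom_at M x (proj a) = a \<odot>\<^bsub>M\<^esub> x" if a: "a \<in> carrier S" for a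
  proof -
    define b where "b = (SOME b. b \<in> carrier S \<and> proj a = proj b)"
    have b: "b \<in> carrier S" "proj a = proj b"
      unfolding b_def using a by (metis (mono_tags, lifting) someI)+
    obtain c where c: "c \<in> carrier S" "a = b \<oplus>\<^bsub>S\<^esub> c \<otimes>\<^bsub>S\<^esub> f" using proj_eqD[OF a b] by auto
    have "a \<odot>\<^bsub>M\<^esub> x = b \<odot>\<^bsub>M\<^esub> x"
      using c b x f_closed by (simp add: M.smult_l_distr M.smult_assoc1)
    then show ?thesis using a by (simp add: hom_at_def proj_simps b_def)
  qed
  show "hom_at M x \<in> carrier (HomR M)"
    unfolding hom_carrier
  proof (rule linear_mapsI; (unfold quotient_module_simps)?)
    fix r assume "r \<in> carrier R"
    then show "hom_at M x r \<in> carrier M" using x by (elim proj_surj) (simp add: at)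
  next
    fix r assume "r \<notin> carrier R"
    then show "hom_at M x r = undefined" by (simp add: hom_at_def)
  next
    fix r s assume "r \<in> carrier R" "s \<in> carrier R"
    then show "hom_at M x (r \<oplus>\<^bsub>R\<^esub> s) = hom_at M x r \<oplus>\<^bsub>M\<^esub> hom_at M x s"
      using x by (elim proj_surj) (simp add: at proj_simps(2)[symmetric] M.smult_l_distr)
  next
    fix a r assume "a \<in> carrier S" "r \<in> carrier R"
    then show "hom_at M x (proj a \<otimes>\<^bsub>R\<^esub> r) = a \<odot>\<^bsub>M\<^esub> hom_at M x r"
      using x by (elim proj_surj) (simp add: at proj_simps(3)[symmetric] M.smult_assoc1)
  qed
  show "hom_at M x \<one>\<^bsub>R\<^esub> = x"
    using at[of "\<one>\<^bsub>S\<^esub>"] x by (simp add: proj_simps)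
qed

lemma hom_add_eval:
  "(h \<oplus>\<^bsub>HomR M\<^esub> h') \<one>\<^bsub>R\<^esub> =
    h \<one>\<^bsub>R\<^esub> \<oplus>\<^bsub>M\<^esub> h' \<one>\<^bsub>R\<^esub>"
  using ring.ring_simprules(6)[OF cring.axioms(1)[OF quotient_cring]]
  by (simp add: hom_from_quotient_def add_map_def quotient_module_simps)

lemma hom_zero_eval:
  "\<zero>\<^bsub>HomR M\<^esub> \<one>\<^bsub>R\<^esub> = \<zero>\<^bsub>M\<^esub>"
  using ring.ring_simprules(6)[OF cring.axioms(1)[OF quotient_cring]]
  by (simp add: hom_from_quotient_def)

lemma hom_smult_eval:
  assumes "h \<in> carrier (HomR M)" "a \<in> carrier S"
  shows "(proj a \<odot>\<^bsub>HomR M\<^esub> h) \<one>\<^bsub>R\<^esub> =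
    a \<odot>\<^bsub>M\<^esub> h \<one>\<^bsub>R\<^esub>"
proof -
  interpret R: cring R by (rule quotient_cring)
  have "(proj a \<odot>\<^bsub>HomR M\<^esub> h) \<one>\<^bsub>R\<^esub> = h (proj a)"
    using assms by (simp add: hom_from_quotient_def proj_simps)
  then show ?thesis using hom_apply[OF assms] by simp
qed

lemma hom_smult_closed:
  assumes "module S M" "h \<in> carrier (HomR M)" "r \<in> carrier R"
  shows "r \<odot>\<^bsub>HomR M\<^esub> h \<in> carrier (HomR M)"
proof -
  interpret R: cring R by (rule quotient_cring)
  have h: "h \<in> linear_maps S (quotient_module S f) M" using assms(2) by (simp add: hom_carrier)
  have "(\<lambda>x\<in>carrier (quotient_module S f). h (x \<otimes>\<^bsub>R\<^esub> r))
      \<in> linear_maps S (quotient_module S f) M"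
    using assms(3) linear_maps_closed[OF h] linear_maps_add[OF h] linear_maps_smult[OF h]
    by (intro linear_maps_restrictI quotient_module_is_module)
      (auto simp: quotient_module_simps R.l_distr R.m_assoc proj_simps)
  then show ?thesis by (simp add: hom_from_quotient_def quotient_module_simps)
qed

lemma hom_module_is_module:
  assumes M: "module S M"
  shows "module R (HomR M)"
proof -
  interpret M: module S M by fact
  interpret R: cring R by (rule quotient_cring)
  let ?T = "HomR M"
  note ev = hom_add_eval hom_zero_eval hom_smult_eval hom_eval_closed
  have add: "h \<oplus>\<^bsub>?T\<^esub> h' \<in> carrier ?T" if "h \<in> carrier ?T" "h' \<in> carrier ?T" for h h'
    using that linear_maps_add_map[OF _ _ quotient_module_is_module M]
    by (simp add: hom_carrier) (simp add: hom_from_quotient_def add_map_def)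
  have zero: "\<zero>\<^bsub>?T\<^esub> \<in> carrier ?T"
    using linear_maps_zero_map[OF quotient_module_is_module M]
    by (simp add: hom_from_quotient_def quotient_module_simps)
  note cl = add zero hom_smult_closed[OF M]
  have neg: "\<exists>h'\<in>carrier ?T. h' \<oplus>\<^bsub>?T\<^esub> h = \<zero>\<^bsub>?T\<^esub>" if h: "h \<in> carrier ?T" for h
  proof -
    let ?n = "\<lambda>x\<in>carrier (quotient_module S f). \<ominus>\<^bsub>M\<^esub> h x"
    have n: "?n \<in> carrier ?T"
      using linear_maps_neg_map[OF _ quotient_module_is_module M] h by (simp add: hom_carrier)
    moreover have "?n \<oplus>\<^bsub>?T\<^esub> h = \<zero>\<^bsub>?T\<^esub>"
      using h n by (intro hom_eqI[where M = M] cl) (auto simp: ev quotient_module_simps M.M.l_neg)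
    ultimately show ?thesis by blast
  qed
  show ?thesis
  proof (intro moduleI abelian_groupI quotient_cring cl neg)
    fix a b h h' assume "a \<in> carrier R" "b \<in> carrier R"
      and h: "h \<in> carrier ?T" "h' \<in> carrier ?T"
    then obtain a' b' where ab: "a' \<in> carrier S" "a = proj a'" "b' \<in> carrier S" "b = proj b'"
      by (metis proj_surj)
    have [simp]: "proj a' \<in> carrier R" "proj b' \<in> carrier R"
      "proj (a' \<oplus>\<^bsub>S\<^esub> b') \<in> carrier R"
      "proj (a' \<otimes>\<^bsub>S\<^esub> b') \<in> carrier R"
      using ab by (auto intro!: proj_simps)
    show "(a \<oplus>\<^bsub>R\<^esub> b) \<odot>\<^bsub>?T\<^esub> h = a \<odot>\<^bsub>?T\<^esub> h \<oplus>\<^bsub>?T\<^esub> b \<odot>\<^bsub>?T\<^esub> h"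
      unfolding ab using ab h
      by (intro hom_eqI[where M = M]) (auto simp: proj_simps(2)[symmetric] cl ev M.smult_l_distr)
    show "(a \<otimes>\<^bsub>R\<^esub> b) \<odot>\<^bsub>?T\<^esub> h = a \<odot>\<^bsub>?T\<^esub> (b \<odot>\<^bsub>?T\<^esub> h)"
      unfolding ab using ab h
      by (intro hom_eqI[where M = M]) (auto simp: proj_simps(3)[symmetric] cl ev M.smult_assoc1)
    show "a \<odot>\<^bsub>?T\<^esub> (h \<oplus>\<^bsub>?T\<^esub> h') = a \<odot>\<^bsub>?T\<^esub> h \<oplus>\<^bsub>?T\<^esub> a \<odot>\<^bsub>?T\<^esub> h'"
      unfolding ab using ab h
      by (intro hom_eqI[where M = M]) (auto simp: cl ev M.smult_r_distr)
  next
    fix h assume h: "h \<in> carrier ?T"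
    show "\<one>\<^bsub>R\<^esub> \<odot>\<^bsub>?T\<^esub> h = h"
      using h hom_smult_closed[OF M h R.one_closed] hom_smult_eval[OF h one_closed]
      by (intro hom_eqI[where M = M]) (auto simp: proj_simps ev)
  next
    fix h h' h'' assume "h \<in> carrier ?T" "h' \<in> carrier ?T" "h'' \<in> carrier ?T"
    then show "h \<oplus>\<^bsub>?T\<^esub> h' \<oplus>\<^bsub>?T\<^esub> h'' = h \<oplus>\<^bsub>?T\<^esub> (h' \<oplus>\<^bsub>?T\<^esub> h'')"
      by (intro hom_eqI[where M = M]) (auto simp: cl ev M.M.a_assoc)
  next
    fix h h' assume "h \<in> carrier ?T" "h' \<in> carrier ?T"
    then show "h \<oplus>\<^bsub>?T\<^esub> h' = h' \<oplus>\<^bsub>?T\<^esub> h"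
      by (intro hom_eqI[where M = M]) (auto simp: cl ev M.M.a_comm)
  next
    fix h assume "h \<in> carrier ?T"
    then show "\<zero>\<^bsub>?T\<^esub> \<oplus>\<^bsub>?T\<^esub> h = h"
      by (intro hom_eqI[where M = M]) (auto simp: cl ev)
  qed
qed

lemma hom_neg_eval:
  assumes M: "module S M" and h: "h \<in> carrier (HomR M)"
  shows "(\<ominus>\<^bsub>HomR M\<^esub> h) \<one>\<^bsub>R\<^esub> = \<ominus>\<^bsub>M\<^esub> h \<one>\<^bsub>R\<^esub>"
proof -
  interpret M: module S M by fact
  interpret T: module R "HomR M" by (rule hom_module_is_module[OF M])
  have "(\<ominus>\<^bsub>HomR M\<^esub> h \<oplus>\<^bsub>HomR M\<^esub> h) \<one>\<^bsub>R\<^esub> = \<zero>\<^bsub>M\<^esub>"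
    using h by (simp add: T.M.l_neg hom_zero_eval)
  then show ?thesis
    using h by (intro M.M.minus_equality[symmetric]) (auto simp: hom_add_eval hom_eval_closed)
qed

definition hom_map :: "('s, 'm) module \<Rightarrow> ('m \<Rightarrow> 'n) \<Rightarrow> ('s set \<Rightarrow> 'm) \<Rightarrow> 's set \<Rightarrow> 'n"
  where "hom_map M g =
    (\<lambda>h\<in>carrier (HomR M). compose (carrier R) g h)"

lemma hom_map_eval:
  assumes "h \<in> carrier (HomR M)"
  shows "hom_map M g h \<one>\<^bsub>R\<^esub> = g (h \<one>\<^bsub>R\<^esub>)"
  using assms ring.ring_simprules(6)[OF cring.axioms(1)[OF quotient_cring]]
  by (simp add: hom_map_def compose_def)

lemma hom_map_linear:
  assumes g: "g \<in> linear_maps S M N" and M: "module S M" and N: "module S N"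
  shows "hom_map M g \<in> linear_maps R (HomR M) (HomR N)"
proof -
  let ?T = "HomR M" and ?U = "HomR N"
  interpret T: module R ?T by (rule hom_module_is_module[OF M])
  interpret U: module R ?U by (rule hom_module_is_module[OF N])
  have cl: "hom_map M g h \<in> carrier ?U" if "h \<in> carrier ?T" for h
    using that linear_maps_comp[OF _ g quotient_module_is_module]
    by (simp add: hom_map_def hom_carrier quotient_module_simps)
  show ?thesis
  proof (rule linear_mapsI)
    fix h assume "h \<in> carrier ?T" then show "hom_map M g h \<in> carrier ?U" by (rule cl)
  next
    fix h assume "h \<notin> carrier ?T" then show "hom_map M g h = undefined" by (simp add: hom_map_def)
  next
    fix h h' assume h: "h \<in> carrier ?T" "h' \<in> carrier ?T"
    then show "hom_map M g (h \<oplus>\<^bsub>?T\<^esub> h') = hom_map M g h \<oplus>\<^bsub>?U\<^esub> hom_map M g h'"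
      by (intro hom_eqI[where M = N])
        (auto simp: cl hom_add_eval hom_map_eval hom_eval_closed linear_maps_add[OF g])
  next
    fix r h assume r: "r \<in> carrier R" and h: "h \<in> carrier ?T"
    from r obtain a where a: "a \<in> carrier S" "r = proj a" by (rule proj_surj)
    show "hom_map M g (r \<odot>\<^bsub>?T\<^esub> h) = r \<odot>\<^bsub>?U\<^esub> hom_map M g h"
      using h r a(1) unfolding a(2)
      by (intro hom_eqI[where M = N])
        (auto simp: cl hom_smult_eval hom_map_eval hom_eval_closed linear_maps_smult[OF g])
  qed
qed

lemmas hom_map_closed = linear_maps_closed[OF hom_map_linear]

text \<open>
  Multiplication by \<open>f\<close> is onto \<open>M\<close>, and it may be moved from the value of a linear map to its
  argument; hence \<open>f\<close> is a nonzerodivisor on \<open>Hom\<^sub>S(M, N)\<close>.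
\<close>

lemma f_cancel:
  assumes "divisible_module M f" "g \<in> linear_maps S M N" "g' \<in> linear_maps S M N" "module S M"
    and "\<And>x. x \<in> carrier M \<Longrightarrow> f \<odot>\<^bsub>N\<^esub> g x = f \<odot>\<^bsub>N\<^esub> g' x" "x \<in> carrier M"
  shows "g x = g' x"
proof -
  obtain y where y: "y \<in> carrier M" "x = f \<odot>\<^bsub>M\<^esub> y"
    using assms(1,6) unfolding divisible_module_def by metis
  then show ?thesis
    using assms(5) f_closed by (simp add: linear_maps_smult[OF assms(2)] linear_maps_smult[OF assms(3)])
qed

text \<open>
  Through evaluation at \<open>1\<close> and its inverse \<open>hom_at\<close>, the map \<open>\<Phi>\<close> is a linear map
  \<open>M[f] \<rightarrow> N[f]\<close>, and any extension of it to \<open>M\<close> induces \<open>\<Phi>\<close>.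
\<close>

lemma hom_map_full:
  assumes M: "module S M" and N: "module S N" and div: "divisible_module M f"
    and triv: "trivial_group (Ext S 1 M N)"
    and \<Phi>: "\<Phi> \<in> linear_maps R (HomR M) (HomR N)"
  obtains g where "g \<in> linear_maps S M N" "hom_map M g = \<Phi>"
proof -
  let ?T = "HomR M" and ?U = "HomR N"
  let ?\<phi> = "\<lambda>x. \<Phi> (hom_at M x) \<one>\<^bsub>R\<^esub>"
  interpret M: module S M by fact
  interpret T: module R ?T by (rule hom_module_is_module[OF M])
  note at = hom_at[OF M]
  have "\<exists>\<theta>\<in>linear_maps S M N. \<forall>x\<in>carrier M. f \<odot>\<^bsub>M\<^esub> x = \<zero>\<^bsub>M\<^esub> \<longrightarrow> \<theta> x = ?\<phi> x"
  proof (rule extend_from_torsion[OF M N f_closed div triv])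
    fix x assume x: "x \<in> carrier M" "f \<odot>\<^bsub>M\<^esub> x = \<zero>\<^bsub>M\<^esub>"
    show "?\<phi> x \<in> carrier N"
      by (intro hom_eval_closed linear_maps_closed[OF \<Phi>] at x)
    show "?\<phi> (x \<oplus>\<^bsub>M\<^esub> y) = ?\<phi> x \<oplus>\<^bsub>N\<^esub> ?\<phi> y" if y: "y \<in> carrier M" "f \<odot>\<^bsub>M\<^esub> y = \<zero>\<^bsub>M\<^esub>" for y
    proof -
      have xy: "x \<oplus>\<^bsub>M\<^esub> y \<in> carrier M" "f \<odot>\<^bsub>M\<^esub> (x \<oplus>\<^bsub>M\<^esub> y) = \<zero>\<^bsub>M\<^esub>"
        using x y f_closed by (auto simp: M.smult_r_distr)
      have "hom_at M (x \<oplus>\<^bsub>M\<^esub> y) = hom_at M x \<oplus>\<^bsub>?T\<^esub> hom_at M y"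
        using at[OF x] at[OF y] at[OF xy] by (intro hom_eqI[where M = M]) (auto simp: hom_add_eval)
      then show ?thesis
        using at(1)[OF x] at(1)[OF y] by (simp add: linear_maps_add[OF \<Phi>] hom_add_eval)
    qed
    show "?\<phi> (a \<odot>\<^bsub>M\<^esub> x) = a \<odot>\<^bsub>N\<^esub> ?\<phi> x" if a: "a \<in> carrier S" for a
    proof -
      have ax: "a \<odot>\<^bsub>M\<^esub> x \<in> carrier M" "f \<odot>\<^bsub>M\<^esub> (a \<odot>\<^bsub>M\<^esub> x) = \<zero>\<^bsub>M\<^esub>"
        using x a f_closed M.smult_assoc1[of f a x] M.smult_assoc1[of a f x]
        by (auto simp: m_comm)
      have "hom_at M (a \<odot>\<^bsub>M\<^esub> x) = proj a \<odot>\<^bsub>?T\<^esub> hom_at M x"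
        using at[OF x] at[OF ax] a
        by (intro hom_eqI[where M = M]) (auto simp: hom_smult_eval proj_simps)
      then show ?thesis
        using at(1)[OF x] a linear_maps_closed[OF \<Phi> at(1)[OF x]]
        by (simp add: linear_maps_smult[OF \<Phi>] hom_smult_eval proj_simps)
    qed
  qed
  then obtain g where g: "g \<in> linear_maps S M N"
    "\<And>x. x \<in> carrier M \<Longrightarrow> f \<odot>\<^bsub>M\<^esub> x = \<zero>\<^bsub>M\<^esub> \<Longrightarrow> g x = ?\<phi> x" by auto
  have "hom_map M g = \<Phi>"
  proof (rule linear_maps_eqI[OF hom_map_linear[OF g(1) M N] \<Phi>])
    fix h assume h: "h \<in> carrier ?T"
    note ev = hom_eval_closed[OF h] hom_eval_torsion[OF M h]
    have "hom_at M (h \<one>\<^bsub>R\<^esub>) = h"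
      using at[OF ev] h by (intro hom_eqI[where M = M]) auto
    then show "hom_map M g h = \<Phi> h"
      using h ev hom_map_closed[OF g(1) M N] linear_maps_closed[OF \<Phi> h]
      by (intro hom_eqI[where M = N]) (auto simp: hom_map_eval g(2))
  qed
  with g(1) show thesis by (rule that)
qed

text \<open>
  The difference \<open>k = g - g'\<close> vanishes on \<open>M[f]\<close>, the kernel of the surjection \<open>f\<close> on \<open>M\<close>, so it
  factors through that surjection as \<open>k x = u (f x)\<close>.
\<close>

lemma hom_map_eqD:
  assumes M: "module S M" and N: "module S N" and div: "divisible_module M f"
    and g: "g \<in> linear_maps S M N" and g': "g' \<in> linear_maps S M N"
    and eq: "hom_map M g = hom_map M g'"
  obtains u where "u \<in> linear_maps S M N"
    "\<And>x. x \<in> carrier M \<Longrightarrow> g x = g' x \<oplus>\<^bsub>N\<^esub> f \<odot>\<^bsub>N\<^esub> u x"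
proof -
  interpret M: module S M by fact
  interpret N: module S N by fact
  define k where "k = (\<lambda>x\<in>carrier M. g x \<ominus>\<^bsub>N\<^esub> g' x)"
  have k: "k \<in> linear_maps S M N" unfolding k_def by (rule linear_maps_minus_map[OF g g' M N])
  have k_T: "k x = \<zero>\<^bsub>N\<^esub>" if x: "x \<in> carrier M" "f \<odot>\<^bsub>M\<^esub> x = \<zero>\<^bsub>M\<^esub>" for x
  proof -
    have "g x = g' x"
      using arg_cong[OF eq, of "\<lambda>\<phi>. \<phi> (hom_at M x) \<one>\<^bsub>R\<^esub>"] hom_at[OF M x]
      by (simp add: hom_map_eval)
    then show ?thesis
      using x linear_maps_closed[OF g' x(1)] by (simp add: k_def N.M.minus_eq N.M.r_neg)
  qed
  \<comment> \<open>\<open>w\<close> is a set-theoretic section of multiplication by \<open>f\<close>.\<close>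
  define w where "w = (\<lambda>x. SOME y. y \<in> carrier M \<and> f \<odot>\<^bsub>M\<^esub> y = x)"
  have w: "w x \<in> carrier M" "f \<odot>\<^bsub>M\<^esub> w x = x" if "x \<in> carrier M" for x
  proof -
    have "\<exists>y. y \<in> carrier M \<and> f \<odot>\<^bsub>M\<^esub> y = x"
      using that div unfolding divisible_module_def by auto
    from someI_ex[OF this] show "w x \<in> carrier M" "f \<odot>\<^bsub>M\<^esub> w x = x" unfolding w_def by auto
  qed
  have kw: "k y = k (w x)" if "y \<in> carrier M" "f \<odot>\<^bsub>M\<^esub> y = x" "x \<in> carrier M" for x y
  proof -
    have "f \<odot>\<^bsub>M\<^esub> (y \<ominus>\<^bsub>M\<^esub> w x) = \<zero>\<^bsub>M\<^esub>"
      using that w f_closed by (simp add: M.M.minus_eq M.smult_r_distr M.smult_r_minus M.M.r_neg)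
    then have "k (y \<ominus>\<^bsub>M\<^esub> w x) = \<zero>\<^bsub>N\<^esub>" using that w by (intro k_T) auto
    moreover have "y = (y \<ominus>\<^bsub>M\<^esub> w x) \<oplus>\<^bsub>M\<^esub> w x"
      using that w by (simp add: M.M.minus_eq M.M.a_assoc M.M.l_neg)
    ultimately show ?thesis
      using that w linear_maps_closed[OF k] linear_maps_add[OF k, of "y \<ominus>\<^bsub>M\<^esub> w x" "w x"] by simp
  qed
  define u where "u = (\<lambda>x\<in>carrier M. k (w x))"
  have u: "u \<in> linear_maps S M N"
    unfolding u_def
  proof (rule linear_maps_restrictI[OF M])
    fix x assume "x \<in> carrier M"
    then show "k (w x) \<in> carrier N" using w linear_maps_closed[OF k] by simp
  next
    fix x y assume "x \<in> carrier M" "y \<in> carrier M"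
    then show "k (w (x \<oplus>\<^bsub>M\<^esub> y)) = k (w x) \<oplus>\<^bsub>N\<^esub> k (w y)"
      using w f_closed kw[of "w x \<oplus>\<^bsub>M\<^esub> w y" "x \<oplus>\<^bsub>M\<^esub> y"]
      by (simp add: M.smult_r_distr linear_maps_add[OF k])
  next
    fix a x assume "a \<in> carrier S" "x \<in> carrier M"
    then show "k (w (a \<odot>\<^bsub>M\<^esub> x)) = a \<odot>\<^bsub>N\<^esub> k (w x)"
      using w f_closed kw[of "a \<odot>\<^bsub>M\<^esub> w x" "a \<odot>\<^bsub>M\<^esub> x"] M.smult_assoc1[of f a "w x"] M.smult_assoc1[of a f "w x"]
      by (simp add: m_comm linear_maps_smult[OF k])
  qed
  have "g x = g' x \<oplus>\<^bsub>N\<^esub> f \<odot>\<^bsub>N\<^esub> u x" if x: "x \<in> carrier M" for x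
  proof -
    have "f \<odot>\<^bsub>N\<^esub> u x = k (f \<odot>\<^bsub>M\<^esub> w x)"
      using linear_maps_smult[OF k f_closed w(1)[OF x]] x by (simp add: u_def)
    also have "\<dots> = g x \<ominus>\<^bsub>N\<^esub> g' x" using x w by (simp add: k_def)
    finally show ?thesis
      using x linear_maps_closed[OF g x] linear_maps_closed[OF g' x]
      by (simp add: N.M.minus_eq N.M.a_ac N.M.r_neg2 N.M.r_neg)
  qed
  with u show thesis by (rule that)
qed

end

section \<open>Homotopies\<close>

text \<open>
  The common ground of factorizations and complexes.  It is stable under shifts and mapping cones,
  whereas the components of a cone have carriers of another type than the objects of the
  subcategory.
\<close>

definition module_family :: "('s, 'e) ring_scheme \<Rightarrow> ('i::comm_ring_1, 's, 'm) family \<Rightarrow> bool"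
  where "module_family S X \<longleftrightarrow>
    (\<forall>i. module S (cmp X i) \<and> dif X i \<in> linear_maps S (cmp X i) (cmp X (i - 1)))"

lemma module_familyD:
  assumes "module_family S X"
  shows "module S (cmp X i)" "dif X i \<in> linear_maps S (cmp X i) (cmp X (i - 1))"
  using assms unfolding module_family_def by auto

lemma dif_Suc:
  "module_family S X \<Longrightarrow> dif X (i + 1) \<in> linear_maps S (cmp X (i + 1)) (cmp X i)"
  using module_familyD(2)[of S X "i + 1"] by simp

lemma chain_mapsD:
  assumes "\<alpha> \<in> chain_maps S X Y"
  shows "\<alpha> i \<in> linear_maps S (cmp X i) (cmp Y i)"
    and "x \<in> carrier (cmp X i) \<Longrightarrow> \<alpha> (i - 1) (dif X i x) = dif Y i (\<alpha> i x)"
  using assms unfolding chain_maps_def by auto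

lemma chain_maps_eqI:
  assumes "\<alpha> \<in> chain_maps S X Y" "\<beta> \<in> chain_maps S X Y"
    and "\<And>i x. x \<in> carrier (cmp X i) \<Longrightarrow> \<alpha> i x = \<beta> i x"
  shows "\<alpha> = \<beta>"
proof (rule ext)
  fix i
  show "\<alpha> i = \<beta> i"
    by (rule linear_maps_eqI[OF chain_mapsD(1)[OF assms(1)] chain_mapsD(1)[OF assms(2)] assms(3)])
qed

text \<open>
  The homotopy relation with the difference moved to the other side, so that calculations with it
  need no subtraction.
\<close>

definition homotopy ::
  "('s, 'e) ring_scheme \<Rightarrow> ('i::comm_ring_1, 's, 'm) family \<Rightarrow> ('i, 's, 'n) family \<Rightarrow>
    ('i \<Rightarrow> 'm \<Rightarrow> 'n) \<Rightarrow> ('i \<Rightarrow> 'm \<Rightarrow> 'n) \<Rightarrow> ('i \<Rightarrow> 'm \<Rightarrow> 'n) \<Rightarrow> bool"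
  where "homotopy S X Y \<alpha> \<beta> h \<longleftrightarrow>
    (\<forall>i. h i \<in> linear_maps S (cmp X i) (cmp Y (i + 1)) \<and>
      (\<forall>x\<in>carrier (cmp X i).
         \<alpha> i x = \<beta> i x \<oplus>\<^bsub>cmp Y i\<^esub> (dif Y (i + 1) (h i x) \<oplus>\<^bsub>cmp Y i\<^esub> h (i - 1) (dif X i x))))"

text \<open>
  Adjusts the index \<open>i - 1 + 1\<close> that results from instantiating the type of a homotopy at \<open>i - 1\<close>.
\<close>

lemma homotopy_step_linear:
  fixes i :: "'i::comm_ring_1"
  assumes "h (i - 1) \<in> linear_maps S (cmp X (i - 1)) (cmp Y (i - 1 + 1))"
  shows "h (i - 1) \<in> linear_maps S (cmp X (i - 1)) (cmp Y i)"
  using assms by simp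

lemma homotopyD:
  assumes "homotopy S X Y \<alpha> \<beta> h"
  shows "h i \<in> linear_maps S (cmp X i) (cmp Y (i + 1))"
    and "h (i - 1) \<in> linear_maps S (cmp X (i - 1)) (cmp Y i)"
    and "x \<in> carrier (cmp X i) \<Longrightarrow>
      \<alpha> i x = \<beta> i x \<oplus>\<^bsub>cmp Y i\<^esub> (dif Y (i + 1) (h i x) \<oplus>\<^bsub>cmp Y i\<^esub> h (i - 1) (dif X i x))"
  using assms unfolding homotopy_def by (blast, intro homotopy_step_linear, blast, blast)

lemma homotopy_rel_iff:
  assumes X: "module_family S X" and Y: "module_family S Y"
  shows "(\<alpha>, \<beta>) \<in> homotopy_rel S X Y \<longleftrightarrow>
    \<alpha> \<in> chain_maps S X Y \<and> \<beta> \<in> chain_maps S X Y \<and> (\<exists>h. homotopy S X Y \<alpha> \<beta> h)"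
proof -
  have eq: "\<alpha> i x \<ominus>\<^bsub>cmp Y i\<^esub> \<beta> i x = dif Y (i + 1) (h i x) \<oplus>\<^bsub>cmp Y i\<^esub> h (i - 1) (dif X i x) \<longleftrightarrow>
      \<alpha> i x = \<beta> i x \<oplus>\<^bsub>cmp Y i\<^esub> (dif Y (i + 1) (h i x) \<oplus>\<^bsub>cmp Y i\<^esub> h (i - 1) (dif X i x))"
    if \<alpha>: "\<alpha> \<in> chain_maps S X Y" and \<beta>: "\<beta> \<in> chain_maps S X Y"
      and h: "\<forall>i. h i \<in> linear_maps S (cmp X i) (cmp Y (i + 1))" and x: "x \<in> carrier (cmp X i)"
    for h i x
  proof -
    have h': "h (i - 1) \<in> linear_maps S (cmp X (i - 1)) (cmp Y i)"
      using h by (intro homotopy_step_linear) blast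
    show ?thesis
      using x linear_maps_closed[OF chain_mapsD(1)[OF \<alpha>] x] linear_maps_closed[OF chain_mapsD(1)[OF \<beta>] x]
        linear_maps_closed[OF dif_Suc[OF Y] linear_maps_closed[OF spec[OF h] x]]
        linear_maps_closed[OF h' linear_maps_closed[OF module_familyD(2)[OF X] x]]
      by (intro module_minus_eq_iff[OF module_familyD(1)[OF Y]]
          module_add_closed[OF module_familyD(1)[OF Y]]) auto
  qed
  have "(\<forall>i. h i \<in> linear_maps S (cmp X i) (cmp Y (i + 1)) \<and>
        (\<forall>x\<in>carrier (cmp X i). \<alpha> i x \<ominus>\<^bsub>cmp Y i\<^esub> \<beta> i x =
           dif Y (i + 1) (h i x) \<oplus>\<^bsub>cmp Y i\<^esub> h (i - 1) (dif X i x))) \<longleftrightarrow> homotopy S X Y \<alpha> \<beta> h"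
    if "\<alpha> \<in> chain_maps S X Y" "\<beta> \<in> chain_maps S X Y" for h
  proof (cases "\<forall>i. h i \<in> linear_maps S (cmp X i) (cmp Y (i + 1))")
    case True
    then show ?thesis using eq[OF that True] by (simp add: homotopy_def)
  next
    case False
    then show ?thesis by (auto simp: homotopy_def)
  qed
  then show ?thesis unfolding homotopy_rel_def by simp blast
qed

lemma homotopy_relI:
  assumes "module_family S X" "module_family S Y" "\<alpha> \<in> chain_maps S X Y" "\<beta> \<in> chain_maps S X Y"
    and "homotopy S X Y \<alpha> \<beta> h"
  shows "(\<alpha>, \<beta>) \<in> homotopy_rel S X Y"
  using assms homotopy_rel_iff by blast

lemma homotopy_relE:
  assumes "(\<alpha>, \<beta>) \<in> homotopy_rel S X Y" "module_family S X" "module_family S Y"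
  obtains h where "homotopy S X Y \<alpha> \<beta> h" "\<alpha> \<in> chain_maps S X Y" "\<beta> \<in> chain_maps S X Y"
  using assms homotopy_rel_iff by blast

lemma homotopy_relD:
  assumes "(\<alpha>, \<beta>) \<in> homotopy_rel S X Y"
  shows "\<alpha> \<in> chain_maps S X Y" "\<beta> \<in> chain_maps S X Y"
  using assms unfolding homotopy_rel_def by auto

lemma homotopy_terms_closed:
  assumes X: "module_family S X" and Y: "module_family S Y" and h: "homotopy S X Y \<alpha> \<beta> h"
    and x: "x \<in> carrier (cmp X i)"
  shows "dif Y (i + 1) (h i x) \<in> carrier (cmp Y i)" "h (i - 1) (dif X i x) \<in> carrier (cmp Y i)"
  using x by (auto intro!: linear_maps_closed[OF dif_Suc[OF Y]] linear_maps_closed[OF homotopyD(1)[OF h]]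
      linear_maps_closed[OF homotopyD(2)[OF h]] linear_maps_closed[OF module_familyD(2)[OF X]])

lemma homotopy_refl:
  assumes X: "module_family S X" and Y: "module_family S Y" and \<alpha>: "\<alpha> \<in> chain_maps S X Y"
  shows "homotopy S X Y \<alpha> \<alpha> (\<lambda>i. \<lambda>x\<in>carrier (cmp X i). \<zero>\<^bsub>cmp Y (i + 1)\<^esub>)"
  unfolding homotopy_def
proof (intro allI conjI ballI)
  fix i
  show "(\<lambda>x\<in>carrier (cmp X i). \<zero>\<^bsub>cmp Y (i + 1)\<^esub>) \<in> linear_maps S (cmp X i) (cmp Y (i + 1))"
    by (intro linear_maps_zero_map module_familyD[OF X] module_familyD[OF Y])
  interpret Y: module S "cmp Y i" by (rule module_familyD(1)[OF Y])
  fix x assume x: "x \<in> carrier (cmp X i)"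
  then show "\<alpha> i x = \<alpha> i x \<oplus>\<^bsub>cmp Y i\<^esub>
      (dif Y (i + 1) ((\<lambda>x\<in>carrier (cmp X i). \<zero>\<^bsub>cmp Y (i + 1)\<^esub>) x) \<oplus>\<^bsub>cmp Y i\<^esub>
       (\<lambda>x\<in>carrier (cmp X (i - 1)). \<zero>\<^bsub>cmp Y (i - 1 + 1)\<^esub>) (dif X i x))"
    using linear_maps_closed[OF chain_mapsD(1)[OF \<alpha>] x]
      linear_maps_zero[OF dif_Suc[OF Y] module_familyD(1)[OF Y] module_familyD(1)[OF Y]]
      linear_maps_closed[OF module_familyD(2)[OF X] x] by simp
qed

lemma homotopy_sym:
  assumes X: "module_family S X" and Y: "module_family S Y" and h: "homotopy S X Y \<alpha> \<beta> h"
    and \<beta>: "\<beta> \<in> chain_maps S X Y"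
  shows "homotopy S X Y \<beta> \<alpha> (\<lambda>i. \<lambda>x\<in>carrier (cmp X i). \<ominus>\<^bsub>cmp Y (i + 1)\<^esub> h i x)"
  unfolding homotopy_def
proof (intro allI conjI ballI)
  fix i
  show "(\<lambda>x\<in>carrier (cmp X i). \<ominus>\<^bsub>cmp Y (i + 1)\<^esub> h i x) \<in> linear_maps S (cmp X i) (cmp Y (i + 1))"
    by (intro linear_maps_neg_map homotopyD[OF h] module_familyD[OF X] module_familyD[OF Y])
  interpret Y: module S "cmp Y i" by (rule module_familyD(1)[OF Y])
  fix x assume x: "x \<in> carrier (cmp X i)"
  note cl = homotopy_terms_closed[OF X Y h x] linear_maps_closed[OF chain_mapsD(1)[OF \<beta>] x]
    linear_maps_closed[OF module_familyD(2)[OF X] x]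
  have "dif Y (i + 1) (\<ominus>\<^bsub>cmp Y (i + 1)\<^esub> h i x) = \<ominus>\<^bsub>cmp Y i\<^esub> dif Y (i + 1) (h i x)"
    by (intro linear_maps_neg[OF dif_Suc[OF Y] module_familyD(1)[OF Y] module_familyD(1)[OF Y]]
        linear_maps_closed[OF homotopyD(1)[OF h]] x)
  then show "\<beta> i x = \<alpha> i x \<oplus>\<^bsub>cmp Y i\<^esub>
      (dif Y (i + 1) ((\<lambda>x\<in>carrier (cmp X i). \<ominus>\<^bsub>cmp Y (i + 1)\<^esub> h i x) x) \<oplus>\<^bsub>cmp Y i\<^esub>
       (\<lambda>x\<in>carrier (cmp X (i - 1)). \<ominus>\<^bsub>cmp Y (i - 1 + 1)\<^esub> h (i - 1) x) (dif X i x))"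
    using cl x by (simp add: homotopyD(3)[OF h x] Y.M.a_ac Y.M.r_neg Y.M.r_neg1 Y.M.r_neg2)
qed

lemma homotopy_trans:
  assumes X: "module_family S X" and Y: "module_family S Y" and h: "homotopy S X Y \<alpha> \<beta> h"
    and k: "homotopy S X Y \<beta> \<gamma> k" and \<gamma>: "\<gamma> \<in> chain_maps S X Y"
  shows "homotopy S X Y \<alpha> \<gamma> (\<lambda>i. \<lambda>x\<in>carrier (cmp X i). h i x \<oplus>\<^bsub>cmp Y (i + 1)\<^esub> k i x)"
  unfolding homotopy_def
proof (intro allI conjI ballI)
  fix i
  show "(\<lambda>x\<in>carrier (cmp X i). h i x \<oplus>\<^bsub>cmp Y (i + 1)\<^esub> k i x) \<in> linear_maps S (cmp X i) (cmp Y (i + 1))"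
    by (intro linear_maps_add_map homotopyD[OF h] homotopyD[OF k] module_familyD[OF X] module_familyD[OF Y])
  interpret Y: module S "cmp Y i" by (rule module_familyD(1)[OF Y])
  fix x assume x: "x \<in> carrier (cmp X i)"
  note cl = homotopy_terms_closed[OF X Y h x] homotopy_terms_closed[OF X Y k x]
    linear_maps_closed[OF chain_mapsD(1)[OF \<gamma>] x] linear_maps_closed[OF module_familyD(2)[OF X] x]
  have "dif Y (i + 1) (h i x \<oplus>\<^bsub>cmp Y (i + 1)\<^esub> k i x) =
      dif Y (i + 1) (h i x) \<oplus>\<^bsub>cmp Y i\<^esub> dif Y (i + 1) (k i x)"
    by (intro linear_maps_add[OF dif_Suc[OF Y]] linear_maps_closed[OF homotopyD(1)[OF h]]
        linear_maps_closed[OF homotopyD(1)[OF k]] x)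
  then show "\<alpha> i x = \<gamma> i x \<oplus>\<^bsub>cmp Y i\<^esub>
      (dif Y (i + 1) ((\<lambda>x\<in>carrier (cmp X i). h i x \<oplus>\<^bsub>cmp Y (i + 1)\<^esub> k i x) x) \<oplus>\<^bsub>cmp Y i\<^esub>
       (\<lambda>x\<in>carrier (cmp X (i - 1)). h (i - 1) x \<oplus>\<^bsub>cmp Y (i - 1 + 1)\<^esub> k (i - 1) x) (dif X i x))"
    using cl x by (simp add: homotopyD(3)[OF h x] homotopyD(3)[OF k x] Y.M.a_ac)
qed

lemma homotopy_rel_refl:
  "module_family S X \<Longrightarrow> module_family S Y \<Longrightarrow> \<alpha> \<in> chain_maps S X Y \<Longrightarrow> (\<alpha>, \<alpha>) \<in> homotopy_rel S X Y"
  by (rule homotopy_relI[OF _ _ _ _ homotopy_refl])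

lemma homotopy_rel_sym:
  assumes X: "module_family S X" and Y: "module_family S Y" and \<alpha>: "(\<alpha>, \<beta>) \<in> homotopy_rel S X Y"
  shows "(\<beta>, \<alpha>) \<in> homotopy_rel S X Y"
proof -
  obtain h where "homotopy S X Y \<alpha> \<beta> h" using homotopy_relE[OF \<alpha> X Y] by metis
  from homotopy_sym[OF X Y this homotopy_relD(2)[OF \<alpha>]]
  show ?thesis by (rule homotopy_relI[OF X Y homotopy_relD(2)[OF \<alpha>] homotopy_relD(1)[OF \<alpha>]])
qed

lemma homotopy_rel_trans:
  assumes X: "module_family S X" and Y: "module_family S Y"
    and \<alpha>: "(\<alpha>, \<beta>) \<in> homotopy_rel S X Y" and \<beta>: "(\<beta>, \<gamma>) \<in> homotopy_rel S X Y"
  shows "(\<alpha>, \<gamma>) \<in> homotopy_rel S X Y"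
proof -
  obtain h k where "homotopy S X Y \<alpha> \<beta> h" "homotopy S X Y \<beta> \<gamma> k"
    using homotopy_relE[OF \<alpha> X Y] homotopy_relE[OF \<beta> X Y] by metis
  from homotopy_trans[OF X Y this homotopy_relD(2)[OF \<beta>]]
  show ?thesis by (rule homotopy_relI[OF X Y homotopy_relD(1)[OF \<alpha>] homotopy_relD(2)[OF \<beta>]])
qed

lemma homotopy_rel_equiv:
  assumes X: "module_family S X" and Y: "module_family S Y"
  shows "equiv (chain_maps S X Y) (homotopy_rel S X Y)"
proof (rule equivI)
  show "homotopy_rel S X Y \<subseteq> chain_maps S X Y \<times> chain_maps S X Y"
    by (auto simp: homotopy_rel_def)
  show "refl_on (chain_maps S X Y) (homotopy_rel S X Y)"
    using homotopy_rel_refl[OF X Y] by (rule refl_onI)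
  show "sym (homotopy_rel S X Y)" using homotopy_rel_sym[OF X Y] by (rule symI)
  show "trans (homotopy_rel S X Y)" using homotopy_rel_trans[OF X Y] by (rule transI)
qed

lemma chain_id_maps: "module_family S X \<Longrightarrow> chain_id X \<in> chain_maps S X X"
  unfolding chain_maps_def chain_id_def
  using module_familyD linear_maps_id linear_maps_closed[OF module_familyD(2)] by fastforce

lemma chain_comp_apply:
  "x \<in> carrier (cmp X i) \<Longrightarrow> chain_comp X \<beta> \<alpha> i x = \<beta> i (\<alpha> i x)"
  by (simp add: chain_comp_def compose_def)

lemma chain_comp_maps:
  assumes X: "module_family S X" and \<alpha>: "\<alpha> \<in> chain_maps S X Y" and \<beta>: "\<beta> \<in> chain_maps S Y Z"
  shows "chain_comp X \<beta> \<alpha> \<in> chain_maps S X Z"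
  unfolding chain_maps_def
proof (intro CollectI allI conjI ballI)
  fix i
  show "chain_comp X \<beta> \<alpha> i \<in> linear_maps S (cmp X i) (cmp Z i)"
    unfolding chain_comp_def
    by (intro linear_maps_comp[OF chain_mapsD(1)[OF \<alpha>] chain_mapsD(1)[OF \<beta>]] module_familyD[OF X])
  fix x assume x: "x \<in> carrier (cmp X i)"
  show "chain_comp X \<beta> \<alpha> (i - 1) (dif X i x) = dif Z i (chain_comp X \<beta> \<alpha> i x)"
    using x linear_maps_closed[OF module_familyD(2)[OF X] x] linear_maps_closed[OF chain_mapsD(1)[OF \<alpha>] x]
    by (simp add: chain_comp_apply chain_mapsD(2)[OF \<alpha>] chain_mapsD(2)[OF \<beta>])
qed

lemma chain_comp_assoc:
  assumes "\<alpha> \<in> chain_maps S X Y"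
  shows "chain_comp X \<gamma> (chain_comp X \<beta> \<alpha>) = chain_comp X (chain_comp Y \<gamma> \<beta>) \<alpha>"
  using linear_maps_closed[OF chain_mapsD(1)[OF assms]]
  by (auto simp: chain_comp_def compose_def fun_eq_iff restrict_def)

lemma chain_comp_id_left:
  assumes X: "module_family S X" and \<alpha>: "\<alpha> \<in> chain_maps S X Y"
  shows "chain_comp X (chain_id Y) \<alpha> = \<alpha>"
proof -
  have "chain_comp X (chain_id Y) \<alpha> i = \<alpha> i" for i
    using linear_maps_closed[OF chain_mapsD(1)[OF \<alpha>]] chain_mapsD(1)[OF \<alpha>, of i]
    by (auto simp: chain_comp_def chain_id_def compose_def fun_eq_iff restrict_def linear_maps_def
        PiE_def extensional_def)
  then show ?thesis by blast
qed

lemma chain_comp_id_right: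
  assumes X: "module_family S X" and \<alpha>: "\<alpha> \<in> chain_maps S X Y"
  shows "chain_comp X \<alpha> (chain_id X) = \<alpha>"
proof -
  have "chain_comp X \<alpha> (chain_id X) i = \<alpha> i" for i
    using chain_mapsD(1)[OF \<alpha>, of i]
    by (auto simp: chain_comp_def chain_id_def compose_def fun_eq_iff restrict_def linear_maps_def
        PiE_def extensional_def)
  then show ?thesis by blast
qed

text \<open>
  \<open>\<beta> \<alpha> - \<beta>' \<alpha>' = \<beta> (\<alpha> - \<alpha>') + (\<beta> - \<beta>') \<alpha>'\<close>, and \<open>\<beta>\<close> and \<open>\<alpha>'\<close> commute with the differentials.
\<close>

lemma homotopy_comp:
  assumes X: "module_family S X" and Y: "module_family S Y" and Z: "module_family S Z"
    and h: "homotopy S X Y \<alpha> \<alpha>' h" and k: "homotopy S Y Z \<beta> \<beta>' k"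
    and \<alpha>: "\<alpha> \<in> chain_maps S X Y" and \<alpha>': "\<alpha>' \<in> chain_maps S X Y"
    and \<beta>: "\<beta> \<in> chain_maps S Y Z" and \<beta>': "\<beta>' \<in> chain_maps S Y Z"
  shows "homotopy S X Z (chain_comp X \<beta> \<alpha>) (chain_comp X \<beta>' \<alpha>')
    (\<lambda>i. \<lambda>x\<in>carrier (cmp X i). \<beta> (i + 1) (h i x) \<oplus>\<^bsub>cmp Z (i + 1)\<^esub> k i (\<alpha>' i x))"
  unfolding homotopy_def
proof (intro allI conjI ballI)
  fix i
  let ?hk = "\<lambda>i. \<lambda>x\<in>carrier (cmp X i). \<beta> (i + 1) (h i x) \<oplus>\<^bsub>cmp Z (i + 1)\<^esub> k i (\<alpha>' i x)"
  note mods = module_familyD(1)[OF X] module_familyD(1)[OF Y] module_familyD(1)[OF Z]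
  have "(\<lambda>x\<in>carrier (cmp X i). compose (carrier (cmp X i)) (\<beta> (i + 1)) (h i) x \<oplus>\<^bsub>cmp Z (i + 1)\<^esub>
      compose (carrier (cmp X i)) (k i) (\<alpha>' i) x) \<in> linear_maps S (cmp X i) (cmp Z (i + 1))"
    by (intro linear_maps_add_map linear_maps_comp[OF homotopyD(1)[OF h] chain_mapsD(1)[OF \<beta>]]
        linear_maps_comp[OF chain_mapsD(1)[OF \<alpha>'] homotopyD(1)[OF k]] mods)
  then show "?hk i \<in> linear_maps S (cmp X i) (cmp Z (i + 1))"
    by (simp add: compose_def restrict_def cong: if_cong)
  interpret Z: module S "cmp Z i" by (rule module_familyD(1)[OF Z])
  fix x assume x: "x \<in> carrier (cmp X i)"
  have dx: "dif X i x \<in> carrier (cmp X (i - 1))"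
    by (intro linear_maps_closed[OF module_familyD(2)[OF X]] x)
  have hx: "h i x \<in> carrier (cmp Y (i + 1))" by (intro linear_maps_closed[OF homotopyD(1)[OF h]] x)
  have ax: "\<alpha>' i x \<in> carrier (cmp Y i)" by (intro linear_maps_closed[OF chain_mapsD(1)[OF \<alpha>']] x)
  have kx: "k i (\<alpha>' i x) \<in> carrier (cmp Z (i + 1))" by (intro linear_maps_closed[OF homotopyD(1)[OF k]] ax)
  have bhx: "\<beta> (i + 1) (h i x) \<in> carrier (cmp Z (i + 1))"
    by (intro linear_maps_closed[OF chain_mapsD(1)[OF \<beta>]] hx)
  note t = homotopy_terms_closed[OF X Y h x] homotopy_terms_closed[OF Y Z k ax]
  have cl: "\<beta>' i (\<alpha>' i x) \<in> carrier (cmp Z i)" "\<beta> i (dif Y (i + 1) (h i x)) \<in> carrier (cmp Z i)"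
    "\<beta> i (h (i - 1) (dif X i x)) \<in> carrier (cmp Z i)"
    using t ax by (auto intro!: linear_maps_closed[OF chain_mapsD(1)[OF \<beta>]]
        linear_maps_closed[OF chain_mapsD(1)[OF \<beta>']])
  have "dif Z (i + 1) (\<beta> (i + 1) (h i x) \<oplus>\<^bsub>cmp Z (i + 1)\<^esub> k i (\<alpha>' i x)) =
      dif Z (i + 1) (\<beta> (i + 1) (h i x)) \<oplus>\<^bsub>cmp Z i\<^esub> dif Z (i + 1) (k i (\<alpha>' i x))"
    by (intro linear_maps_add[OF dif_Suc[OF Z]] bhx kx)
  also have "dif Z (i + 1) (\<beta> (i + 1) (h i x)) = \<beta> i (dif Y (i + 1) (h i x))"
    using chain_mapsD(2)[OF \<beta> hx] by simp
  finally have 1: "dif Z (i + 1) (?hk i x) =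
      \<beta> i (dif Y (i + 1) (h i x)) \<oplus>\<^bsub>cmp Z i\<^esub> dif Z (i + 1) (k i (\<alpha>' i x))" using x by simp
  have 2: "?hk (i - 1) (dif X i x) =
      \<beta> i (h (i - 1) (dif X i x)) \<oplus>\<^bsub>cmp Z i\<^esub> k (i - 1) (dif Y i (\<alpha>' i x))"
    using dx chain_mapsD(2)[OF \<alpha>' x] by simp
  have "\<beta> i (\<alpha> i x) = \<beta> i (\<alpha>' i x) \<oplus>\<^bsub>cmp Z i\<^esub>
      (\<beta> i (dif Y (i + 1) (h i x)) \<oplus>\<^bsub>cmp Z i\<^esub> \<beta> i (h (i - 1) (dif X i x)))"
    unfolding homotopyD(3)[OF h x] using ax t(1,2)
    by (simp add: linear_maps_add[OF chain_mapsD(1)[OF \<beta>]] module_add_closed[OF mods(2)])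
  also have "\<beta> i (\<alpha>' i x) = \<beta>' i (\<alpha>' i x) \<oplus>\<^bsub>cmp Z i\<^esub>
      (dif Z (i + 1) (k i (\<alpha>' i x)) \<oplus>\<^bsub>cmp Z i\<^esub> k (i - 1) (dif Y i (\<alpha>' i x)))"
    by (rule homotopyD(3)[OF k ax])
  finally show "chain_comp X \<beta> \<alpha> i x = chain_comp X \<beta>' \<alpha>' i x \<oplus>\<^bsub>cmp Z i\<^esub>
      (dif Z (i + 1) (?hk i x) \<oplus>\<^bsub>cmp Z i\<^esub> ?hk (i - 1) (dif X i x))"
    unfolding 1 2 using x cl t by (simp add: chain_comp_apply Z.M.a_ac)
qed

lemma homotopy_rel_comp:
  assumes X: "module_family S X" and Y: "module_family S Y" and Z: "module_family S Z"
    and \<alpha>: "(\<alpha>, \<alpha>') \<in> homotopy_rel S X Y" and \<beta>: "(\<beta>, \<beta>') \<in> homotopy_rel S Y Z"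
  shows "(chain_comp X \<beta> \<alpha>, chain_comp X \<beta>' \<alpha>') \<in> homotopy_rel S X Z"
proof -
  obtain h k where "homotopy S X Y \<alpha> \<alpha>' h" "homotopy S Y Z \<beta> \<beta>' k"
    using homotopy_relE[OF \<alpha> X Y] homotopy_relE[OF \<beta> Y Z] by metis
  from homotopy_comp[OF X Y Z this homotopy_relD[OF \<alpha>] homotopy_relD[OF \<beta>]]
  show ?thesis
    by (rule homotopy_relI[OF X Z chain_comp_maps[OF X homotopy_relD(1)[OF \<alpha>] homotopy_relD(1)[OF \<beta>]]
          chain_comp_maps[OF X homotopy_relD(2)[OF \<alpha>] homotopy_relD(2)[OF \<beta>]]])
qed

lemma chain_add_maps:
  assumes X: "module_family S X" and Y: "module_family S Y"
    and \<alpha>: "\<alpha> \<in> chain_maps S X Y" and \<beta>: "\<beta> \<in> chain_maps S X Y"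
  shows "chain_add X Y \<alpha> \<beta> \<in> chain_maps S X Y"
  unfolding chain_maps_def
proof (intro CollectI allI conjI ballI)
  fix i
  show "chain_add X Y \<alpha> \<beta> i \<in> linear_maps S (cmp X i) (cmp Y i)"
    unfolding chain_add_def add_map_def
    by (intro linear_maps_add_map chain_mapsD(1) \<alpha> \<beta> module_familyD(1) X Y)
  fix x assume x: "x \<in> carrier (cmp X i)"
  show "chain_add X Y \<alpha> \<beta> (i - 1) (dif X i x) = dif Y i (chain_add X Y \<alpha> \<beta> i x)"
    using x linear_maps_closed[OF module_familyD(2)[OF X] x]
      linear_maps_closed[OF chain_mapsD(1)[OF \<alpha>] x] linear_maps_closed[OF chain_mapsD(1)[OF \<beta>] x]
    by (simp add: chain_add_def add_map_def chain_mapsD(2)[OF \<alpha>] chain_mapsD(2)[OF \<beta>]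
        linear_maps_add[OF module_familyD(2)[OF Y]])
qed

lemma homotopy_add:
  assumes X: "module_family S X" and Y: "module_family S Y"
    and h: "homotopy S X Y \<alpha> \<alpha>' h" and k: "homotopy S X Y \<beta> \<beta>' k"
    and \<alpha>': "\<alpha>' \<in> chain_maps S X Y" and \<beta>': "\<beta>' \<in> chain_maps S X Y"
  shows "homotopy S X Y (chain_add X Y \<alpha> \<beta>) (chain_add X Y \<alpha>' \<beta>')
    (\<lambda>i. \<lambda>x\<in>carrier (cmp X i). h i x \<oplus>\<^bsub>cmp Y (i + 1)\<^esub> k i x)"
  unfolding homotopy_def
proof (intro allI conjI ballI)
  fix i
  show "(\<lambda>x\<in>carrier (cmp X i). h i x \<oplus>\<^bsub>cmp Y (i + 1)\<^esub> k i x) \<in> linear_maps S (cmp X i) (cmp Y (i + 1))"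
    by (intro linear_maps_add_map homotopyD[OF h] homotopyD[OF k] module_familyD[OF X] module_familyD[OF Y])
  interpret Y: module S "cmp Y i" by (rule module_familyD(1)[OF Y])
  fix x assume x: "x \<in> carrier (cmp X i)"
  note cl = homotopy_terms_closed[OF X Y h x] homotopy_terms_closed[OF X Y k x]
    linear_maps_closed[OF chain_mapsD(1)[OF \<alpha>'] x] linear_maps_closed[OF chain_mapsD(1)[OF \<beta>'] x]
    linear_maps_closed[OF module_familyD(2)[OF X] x]
  have "dif Y (i + 1) (h i x \<oplus>\<^bsub>cmp Y (i + 1)\<^esub> k i x) =
      dif Y (i + 1) (h i x) \<oplus>\<^bsub>cmp Y i\<^esub> dif Y (i + 1) (k i x)"
    by (intro linear_maps_add[OF dif_Suc[OF Y]] linear_maps_closed[OF homotopyD(1)[OF h]]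
        linear_maps_closed[OF homotopyD(1)[OF k]] x)
  then show "chain_add X Y \<alpha> \<beta> i x = chain_add X Y \<alpha>' \<beta>' i x \<oplus>\<^bsub>cmp Y i\<^esub>
      (dif Y (i + 1) ((\<lambda>x\<in>carrier (cmp X i). h i x \<oplus>\<^bsub>cmp Y (i + 1)\<^esub> k i x) x) \<oplus>\<^bsub>cmp Y i\<^esub>
       (\<lambda>x\<in>carrier (cmp X (i - 1)). h (i - 1) x \<oplus>\<^bsub>cmp Y (i - 1 + 1)\<^esub> k (i - 1) x) (dif X i x))"
    using cl x
    by (simp add: chain_add_def add_map_def homotopyD(3)[OF h x] homotopyD(3)[OF k x] Y.M.a_ac)
qed

lemma homotopy_rel_add:
  assumes X: "module_family S X" and Y: "module_family S Y"
    and \<alpha>: "(\<alpha>, \<alpha>') \<in> homotopy_rel S X Y" and \<beta>: "(\<beta>, \<beta>') \<in> homotopy_rel S X Y"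
  shows "(chain_add X Y \<alpha> \<beta>, chain_add X Y \<alpha>' \<beta>') \<in> homotopy_rel S X Y"
proof -
  obtain h k where "homotopy S X Y \<alpha> \<alpha>' h" "homotopy S X Y \<beta> \<beta>' k"
    using homotopy_relE[OF \<alpha> X Y] homotopy_relE[OF \<beta> X Y] by metis
  from homotopy_add[OF X Y this homotopy_relD(2)[OF \<alpha>] homotopy_relD(2)[OF \<beta>]]
  show ?thesis
    by (intro homotopy_relI[OF X Y] chain_add_maps[OF X Y] homotopy_relD[OF \<alpha>] homotopy_relD[OF \<beta>])
qed

lemma shift_family:
  assumes X: "module_family S X"
  shows "module_family S (shift X)"
proof -
  have "(\<lambda>x\<in>carrier (cmp X (i - 1)). \<ominus>\<^bsub>cmp X (i - 1 - 1)\<^esub> dif X (i - 1) x)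
      \<in> linear_maps S (cmp X (i - 1)) (cmp X (i - 1 - 1))" for i
    by (intro linear_maps_neg_map module_familyD[OF X])
  then show ?thesis using module_familyD(1)[OF X] by (simp add: module_family_def shift_def)
qed

lemma shift_map_maps:
  assumes X: "module_family S X" and Y: "module_family S Y" and \<alpha>: "\<alpha> \<in> chain_maps S X Y"
  shows "shift_map \<alpha> \<in> chain_maps S (shift X) (shift Y)"
  unfolding chain_maps_def
proof (intro CollectI allI conjI ballI)
  fix i
  show "shift_map \<alpha> i \<in> linear_maps S (cmp (shift X) i) (cmp (shift Y) i)"
    using chain_mapsD(1)[OF \<alpha>] by (simp add: shift_map_def shift_def)
  fix x assume "x \<in> carrier (cmp (shift X) i)"
  then have x: "x \<in> carrier (cmp X (i - 1))" by (simp add: shift_def)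
  show "shift_map \<alpha> (i - 1) (dif (shift X) i x) = dif (shift Y) i (shift_map \<alpha> i x)"
    using x linear_maps_closed[OF module_familyD(2)[OF X] x]
      linear_maps_closed[OF chain_mapsD(1)[OF \<alpha>] x] chain_mapsD(2)[OF \<alpha> x]
    by (simp add: shift_def shift_map_def
      linear_maps_neg[OF chain_mapsD(1)[OF \<alpha>] module_familyD(1)[OF X] module_familyD(1)[OF Y]])
qed

text \<open>
  The differentials of the shifted families carry a sign, so the homotopy has to carry one, too.
\<close>

lemma homotopy_shift:
  assumes X: "module_family S X" and Y: "module_family S Y"
    and h: "homotopy S X Y \<alpha> \<alpha>' h" and \<alpha>': "\<alpha>' \<in> chain_maps S X Y"
  shows "homotopy S (shift X) (shift Y) (shift_map \<alpha>) (shift_map \<alpha>')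
    (\<lambda>i. \<lambda>x\<in>carrier (cmp X (i - 1)). \<ominus>\<^bsub>cmp Y i\<^esub> h (i - 1) x)"
  unfolding homotopy_def
proof (intro allI conjI ballI)
  fix i
  let ?k = "\<lambda>i. \<lambda>x\<in>carrier (cmp X (i - 1)). \<ominus>\<^bsub>cmp Y i\<^esub> h (i - 1) x"
  note mods = module_familyD(1)[OF X] module_familyD(1)[OF Y]
  have "?k i \<in> linear_maps S (cmp X (i - 1)) (cmp Y i)"
    by (intro linear_maps_neg_map homotopyD(2)[OF h] mods)
  then show "?k i \<in> linear_maps S (cmp (shift X) i) (cmp (shift Y) (i + 1))"
    by (simp add: shift_def)
  interpret Y: module S "cmp Y (i - 1)" by (rule mods)
  fix x assume "x \<in> carrier (cmp (shift X) i)"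
  then have x: "x \<in> carrier (cmp X (i - 1))" by (simp add: shift_def)
  have dx: "dif X (i - 1) x \<in> carrier (cmp X (i - 1 - 1))"
    by (intro linear_maps_closed[OF module_familyD(2)[OF X]] x)
  have hx: "h (i - 1) x \<in> carrier (cmp Y i)" by (intro linear_maps_closed[OF homotopyD(2)[OF h]] x)
  have "dif Y i (\<ominus>\<^bsub>cmp Y i\<^esub> h (i - 1) x) = \<ominus>\<^bsub>cmp Y (i - 1)\<^esub> dif Y i (h (i - 1) x)"
    by (intro linear_maps_neg[OF module_familyD(2)[OF Y]] mods hx)
  moreover have "dif Y i (h (i - 1) x) \<in> carrier (cmp Y (i - 1))"
    by (intro linear_maps_closed[OF module_familyD(2)[OF Y]] hx)
  ultimately have 1: "dif (shift Y) (i + 1) (?k i x) = dif Y i (h (i - 1) x)"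
    using x module_neg_closed[OF mods(2) hx] by (simp add: shift_def)
  have "h (i - 1 - 1) (\<ominus>\<^bsub>cmp X (i - 1 - 1)\<^esub> dif X (i - 1) x) =
      \<ominus>\<^bsub>cmp Y (i - 1)\<^esub> h (i - 1 - 1) (dif X (i - 1) x)"
    by (intro linear_maps_neg[OF homotopyD(2)[OF h]] mods dx)
  moreover have "h (i - 1 - 1) (dif X (i - 1) x) \<in> carrier (cmp Y (i - 1))"
    by (intro linear_maps_closed[OF homotopyD(2)[OF h]] dx)
  ultimately have 2: "?k (i - 1) (dif (shift X) i x) = h (i - 1 - 1) (dif X (i - 1) x)"
    using x module_neg_closed[OF mods(1) dx] by (simp add: shift_def)
  show "shift_map \<alpha> i x = shift_map \<alpha>' i x \<oplus>\<^bsub>cmp (shift Y) i\<^esub>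
      (dif (shift Y) (i + 1) (?k i x) \<oplus>\<^bsub>cmp (shift Y) i\<^esub> ?k (i - 1) (dif (shift X) i x))"
    unfolding 1 2 using homotopyD(3)[OF h x] by (simp add: shift_def shift_map_def)
qed

lemma homotopy_rel_shift:
  assumes X: "module_family S X" and Y: "module_family S Y" and \<alpha>: "(\<alpha>, \<alpha>') \<in> homotopy_rel S X Y"
  shows "(shift_map \<alpha>, shift_map \<alpha>') \<in> homotopy_rel S (shift X) (shift Y)"
proof -
  obtain h where "homotopy S X Y \<alpha> \<alpha>' h" using homotopy_relE[OF \<alpha> X Y] by metis
  from homotopy_shift[OF X Y this homotopy_relD(2)[OF \<alpha>]]
  show ?thesis
    by (intro homotopy_relI[OF shift_family[OF X] shift_family[OF Y]] shift_map_maps[OF X Y]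
        homotopy_relD[OF \<alpha>])
qed

section \<open>Homotopy classes, homotopy equivalences and mapping cones\<close>

lemma homotopy_class_self:
  "module_family S X \<Longrightarrow> module_family S Y \<Longrightarrow> \<alpha> \<in> chain_maps S X Y \<Longrightarrow>
    \<alpha> \<in> homotopy_rel S X Y `` {\<alpha>}"
  by (simp add: homotopy_rel_refl)

lemma homotopy_class_eq_iff:
  assumes "module_family S X" "module_family S Y" "\<alpha> \<in> chain_maps S X Y" "\<beta> \<in> chain_maps S X Y"
  shows "homotopy_rel S X Y `` {\<alpha>} = homotopy_rel S X Y `` {\<beta>} \<longleftrightarrow> (\<alpha>, \<beta>) \<in> homotopy_rel S X Y"
  using eq_equiv_class_iff[OF homotopy_rel_equiv] assms by blast

lemma homotopy_class_eqI:
  assumes "module_family S X" "module_family S Y" "(\<alpha>, \<beta>) \<in> homotopy_rel S X Y"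
  shows "homotopy_rel S X Y `` {\<alpha>} = homotopy_rel S X Y `` {\<beta>}"
  using assms homotopy_class_eq_iff homotopy_relD by blast

lemma homotopy_classE:
  assumes "u \<in> chain_maps S X Y // homotopy_rel S X Y"
  obtains \<alpha> where "\<alpha> \<in> chain_maps S X Y" "u = homotopy_rel S X Y `` {\<alpha>}"
  using assms by (rule quotientE)

lemma homotopy_class_rep:
  assumes "module_family S X" "module_family S Y"
    and "u \<in> chain_maps S X Y // homotopy_rel S X Y" "\<alpha> \<in> u"
  shows "\<alpha> \<in> chain_maps S X Y" "u = homotopy_rel S X Y `` {\<alpha>}"
proof -
  obtain \<beta> where \<beta>: "\<beta> \<in> chain_maps S X Y" "u = homotopy_rel S X Y `` {\<beta>}"
    using assms(3) by (rule homotopy_classE)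
  then have rel: "(\<beta>, \<alpha>) \<in> homotopy_rel S X Y" using assms(4) by simp
  then show "\<alpha> \<in> chain_maps S X Y" by (rule homotopy_relD)
  show "u = homotopy_rel S X Y `` {\<alpha>}"
    using \<beta>(2) homotopy_class_eqI[OF assms(1,2) rel] by simp
qed

text \<open>
  The operations of \<open>homotopy_category\<close> are unions over representatives; each union collapses to
  the class computed from a single choice.
\<close>

lemma UN_constant:
  assumes "a \<in> A" "\<And>x. x \<in> A \<Longrightarrow> F x = c"
  shows "(\<Union>x\<in>A. F x) = c"
  using assms by auto

lemma Comp_class:
  assumes X: "module_family S X" and Y: "module_family S Y" and Z: "module_family S Z"
    and \<alpha>: "\<alpha> \<in> chain_maps S X Y" and \<beta>: "\<beta> \<in> chain_maps S Y Z"
  shows "Comp (homotopy_category S Obj) X Y Z (homotopy_rel S Y Z `` {\<beta>}) (homotopy_rel S X Y `` {\<alpha>}) =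
    homotopy_rel S X Z `` {chain_comp X \<beta> \<alpha>}"
proof -
  have eq: "homotopy_rel S X Z `` {chain_comp X \<beta>' \<alpha>'} = homotopy_rel S X Z `` {chain_comp X \<beta> \<alpha>}"
    if "\<beta>' \<in> homotopy_rel S Y Z `` {\<beta>}" "\<alpha>' \<in> homotopy_rel S X Y `` {\<alpha>}" for \<alpha>' \<beta>'
    using that by (intro homotopy_class_eqI[OF X Z, symmetric] homotopy_rel_comp[OF X Y Z]) auto
  have "(\<Union>\<beta>'\<in>homotopy_rel S Y Z `` {\<beta>}. \<Union>\<alpha>'\<in>homotopy_rel S X Y `` {\<alpha>}.
      homotopy_rel S X Z `` {chain_comp X \<beta>' \<alpha>'}) = homotopy_rel S X Z `` {chain_comp X \<beta> \<alpha>}"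
    by (rule UN_constant[OF homotopy_class_self[OF Y Z \<beta>]],
        rule UN_constant[OF homotopy_class_self[OF X Y \<alpha>]], rule eq)
  then show ?thesis by (simp add: homotopy_category_def)
qed

lemma Plus_class:
  assumes X: "module_family S X" and Y: "module_family S Y"
    and \<alpha>: "\<alpha> \<in> chain_maps S X Y" and \<beta>: "\<beta> \<in> chain_maps S X Y"
  shows "Plus (homotopy_category S Obj) X Y (homotopy_rel S X Y `` {\<alpha>}) (homotopy_rel S X Y `` {\<beta>}) =
    homotopy_rel S X Y `` {chain_add X Y \<alpha> \<beta>}"
proof -
  have eq: "homotopy_rel S X Y `` {chain_add X Y \<alpha>' \<beta>'} = homotopy_rel S X Y `` {chain_add X Y \<alpha> \<beta>}"
    if "\<alpha>' \<in> homotopy_rel S X Y `` {\<alpha>}" "\<beta>' \<in> homotopy_rel S X Y `` {\<beta>}" for \<alpha>' \<beta>'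
    using that by (intro homotopy_class_eqI[OF X Y, symmetric] homotopy_rel_add[OF X Y]) auto
  have "(\<Union>\<alpha>'\<in>homotopy_rel S X Y `` {\<alpha>}. \<Union>\<beta>'\<in>homotopy_rel S X Y `` {\<beta>}.
      homotopy_rel S X Y `` {chain_add X Y \<alpha>' \<beta>'}) = homotopy_rel S X Y `` {chain_add X Y \<alpha> \<beta>}"
    by (rule UN_constant[OF homotopy_class_self[OF X Y \<alpha>]],
        rule UN_constant[OF homotopy_class_self[OF X Y \<beta>]], rule eq)
  then show ?thesis by (simp add: homotopy_category_def)
qed

lemma ShiftMor_class:
  assumes X: "module_family S X" and Y: "module_family S Y" and \<alpha>: "\<alpha> \<in> chain_maps S X Y"
  shows "ShiftMor (homotopy_category S Obj) X Y (homotopy_rel S X Y `` {\<alpha>}) =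
    homotopy_rel S (shift X) (shift Y) `` {shift_map \<alpha>}"
proof -
  have eq: "homotopy_rel S (shift X) (shift Y) `` {shift_map \<alpha>'} =
      homotopy_rel S (shift X) (shift Y) `` {shift_map \<alpha>}"
    if "\<alpha>' \<in> homotopy_rel S X Y `` {\<alpha>}" for \<alpha>'
    using that
    by (intro homotopy_class_eqI[OF shift_family[OF X] shift_family[OF Y], symmetric]
        homotopy_rel_shift[OF X Y]) auto
  have "(\<Union>\<alpha>'\<in>homotopy_rel S X Y `` {\<alpha>}. homotopy_rel S (shift X) (shift Y) `` {shift_map \<alpha>'}) =
      homotopy_rel S (shift X) (shift Y) `` {shift_map \<alpha>}"
    by (rule UN_constant[OF homotopy_class_self[OF X Y \<alpha>]], rule eq)
  then show ?thesis by (simp add: homotopy_category_def)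
qed

lemma homotopy_equivsI:
  assumes "\<alpha> \<in> chain_maps S X Y" "\<beta> \<in> chain_maps S Y X"
    and "(chain_comp X \<beta> \<alpha>, chain_id X) \<in> homotopy_rel S X X"
    and "(chain_comp Y \<alpha> \<beta>, chain_id Y) \<in> homotopy_rel S Y Y"
  shows "\<alpha> \<in> homotopy_equivs S X Y"
  using assms unfolding homotopy_equivs_def by blast

lemma homotopy_equivsE:
  assumes "\<alpha> \<in> homotopy_equivs S X Y"
  obtains \<beta> where "\<alpha> \<in> chain_maps S X Y" "\<beta> \<in> chain_maps S Y X"
    "(chain_comp X \<beta> \<alpha>, chain_id X) \<in> homotopy_rel S X X"
    "(chain_comp Y \<alpha> \<beta>, chain_id Y) \<in> homotopy_rel S Y Y"
  using assms unfolding homotopy_equivs_def by blast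

text \<open>
  One half of the closure of homotopy equivalences under composition; the other half is the same
  statement with the roles of the maps and of their inverses exchanged.
\<close>

lemma homotopy_inverse_comp:
  assumes X: "module_family S X" and Y: "module_family S Y" and Z: "module_family S Z"
    and a: "a \<in> chain_maps S X Y" and a': "a' \<in> chain_maps S Y X"
    and b: "b \<in> chain_maps S Y Z" and b': "b' \<in> chain_maps S Z Y"
    and aa: "(chain_comp X a' a, chain_id X) \<in> homotopy_rel S X X"
    and bb: "(chain_comp Y b' b, chain_id Y) \<in> homotopy_rel S Y Y"
  shows "(chain_comp X (chain_comp Z a' b') (chain_comp X b a), chain_id X) \<in> homotopy_rel S X X"
proof -
  note refl = homotopy_rel_refl[OF X Y a] homotopy_rel_refl[OF Y X a']
  have ba: "chain_comp X b a \<in> chain_maps S X Z" by (rule chain_comp_maps[OF X a b])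
  have "(chain_comp X (chain_comp Y b' b) a, chain_comp X (chain_id Y) a) \<in> homotopy_rel S X Y"
    by (rule homotopy_rel_comp[OF X Y Y refl(1) bb])
  then have "(chain_comp X (chain_comp Y b' b) a, a) \<in> homotopy_rel S X Y"
    by (simp add: chain_comp_id_left[OF X a])
  then have "(chain_comp X a' (chain_comp X (chain_comp Y b' b) a), chain_comp X a' a) \<in> homotopy_rel S X X"
    by (rule homotopy_rel_comp[OF X Y X _ refl(2)])
  moreover have "chain_comp X a' (chain_comp X (chain_comp Y b' b) a) =
      chain_comp X (chain_comp Z a' b') (chain_comp X b a)"
    by (simp add: chain_comp_assoc[OF a, symmetric] chain_comp_assoc[OF ba])
  ultimately show ?thesis using homotopy_rel_trans[OF X X _ aa] by simp
qed

lemma homotopy_equivs_comp: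
  assumes X: "module_family S X" and Y: "module_family S Y" and Z: "module_family S Z"
    and a: "a \<in> homotopy_equivs S X Y" and b: "b \<in> homotopy_equivs S Y Z"
  shows "chain_comp X b a \<in> homotopy_equivs S X Z"
proof -
  from a obtain a' where a': "a \<in> chain_maps S X Y" "a' \<in> chain_maps S Y X"
    "(chain_comp X a' a, chain_id X) \<in> homotopy_rel S X X"
    "(chain_comp Y a a', chain_id Y) \<in> homotopy_rel S Y Y" by (rule homotopy_equivsE)
  from b obtain b' where b': "b \<in> chain_maps S Y Z" "b' \<in> chain_maps S Z Y"
    "(chain_comp Y b' b, chain_id Y) \<in> homotopy_rel S Y Y"
    "(chain_comp Z b b', chain_id Z) \<in> homotopy_rel S Z Z" by (rule homotopy_equivsE)
  show ?thesis
    by (rule homotopy_equivsI[OF chain_comp_maps[OF X a'(1) b'(1)] chain_comp_maps[OF Z b'(2) a'(2)]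
        homotopy_inverse_comp[OF X Y Z a'(1,2) b'(1,2) a'(3) b'(3)]
        homotopy_inverse_comp[OF Z Y X b'(2,1) a'(2,1) b'(4) a'(4)]])
qed

lemma strict_iso_homotopy_equiv:
  assumes X: "module_family S X" and Y: "module_family S Y"
    and \<alpha>: "\<alpha> \<in> chain_maps S X Y" and \<beta>: "\<beta> \<in> chain_maps S Y X"
    and "\<And>i x. x \<in> carrier (cmp X i) \<Longrightarrow> \<beta> i (\<alpha> i x) = x"
    and "\<And>i y. y \<in> carrier (cmp Y i) \<Longrightarrow> \<alpha> i (\<beta> i y) = y"
  shows "\<alpha> \<in> homotopy_equivs S X Y"
proof (rule homotopy_equivsI[OF \<alpha> \<beta>])
  have "chain_comp X \<beta> \<alpha> = chain_id X" "chain_comp Y \<alpha> \<beta> = chain_id Y"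
    using assms(5,6) by (auto simp: chain_comp_def chain_id_def compose_def fun_eq_iff restrict_def)
  then show "(chain_comp X \<beta> \<alpha>, chain_id X) \<in> homotopy_rel S X X"
    "(chain_comp Y \<alpha> \<beta>, chain_id Y) \<in> homotopy_rel S Y Y"
    using homotopy_rel_refl[OF X X chain_id_maps[OF X]] homotopy_rel_refl[OF Y Y chain_id_maps[OF Y]]
    by simp_all
qed

text \<open>
  The inverses in the single degrees automatically commute with the differentials.
\<close>

lemma bij_chain_map_homotopy_equiv:
  assumes X: "module_family S X" and Y: "module_family S Y" and \<alpha>: "\<alpha> \<in> chain_maps S X Y"
    and bij: "\<And>i. bij_betw (\<alpha> i) (carrier (cmp X i)) (carrier (cmp Y i))"
  shows "\<alpha> \<in> homotopy_equivs S X Y"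
proof -
  have "\<exists>b. b \<in> linear_maps S (cmp Y i) (cmp X i) \<and> (\<forall>x\<in>carrier (cmp X i). b (\<alpha> i x) = x) \<and>
      (\<forall>y\<in>carrier (cmp Y i). \<alpha> i (b y) = y)" for i
    by (rule linear_maps_inverse[OF chain_mapsD(1)[OF \<alpha>] bij module_familyD(1)[OF X] module_familyD(1)[OF Y]])
      blast
  then obtain \<beta> where \<beta>: "\<And>i. \<beta> i \<in> linear_maps S (cmp Y i) (cmp X i)"
    "\<And>i x. x \<in> carrier (cmp X i) \<Longrightarrow> \<beta> i (\<alpha> i x) = x"
    "\<And>i y. y \<in> carrier (cmp Y i) \<Longrightarrow> \<alpha> i (\<beta> i y) = y" by metis
  have "\<beta> (i - 1) (dif Y i y) = dif X i (\<beta> i y)" if y: "y \<in> carrier (cmp Y i)" for i y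
  proof -
    have bX: "\<beta> i y \<in> carrier (cmp X i)" by (rule linear_maps_closed[OF \<beta>(1) y])
    have "dif Y i y = \<alpha> (i - 1) (dif X i (\<beta> i y))"
      using chain_mapsD(2)[OF \<alpha> bX] \<beta>(3)[OF y] by simp
    then show ?thesis using \<beta>(2)[OF linear_maps_closed[OF module_familyD(2)[OF X] bX]] by simp
  qed
  then have "\<beta> \<in> chain_maps S Y X" using \<beta>(1) by (auto simp: chain_maps_def)
  then show ?thesis by (rule strict_iso_homotopy_equiv[OF X Y \<alpha> _ \<beta>(2,3)])
qed

lemma direct_sum_simps:
  "carrier (direct_sum M N) = carrier M \<times> carrier N"
  "zero (direct_sum M N) = (\<zero>\<^bsub>M\<^esub>, \<zero>\<^bsub>N\<^esub>)"
  "(x, y) \<oplus>\<^bsub>direct_sum M N\<^esub> (x', y') = (x \<oplus>\<^bsub>M\<^esub> x', y \<oplus>\<^bsub>N\<^esub> y')"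
  "a \<odot>\<^bsub>direct_sum M N\<^esub> (x, y) = (a \<odot>\<^bsub>M\<^esub> x, a \<odot>\<^bsub>N\<^esub> y)"
  by (simp_all add: direct_sum_def)

lemma direct_sum_module:
  assumes M: "module S M" and N: "module S N"
  shows "module S (direct_sum M N)"
proof -
  interpret M: module S M by fact
  interpret N: module S N by fact
  have neg: "\<exists>z\<in>carrier M \<times> carrier N. z \<oplus>\<^bsub>direct_sum M N\<^esub> (x, y) = (\<zero>\<^bsub>M\<^esub>, \<zero>\<^bsub>N\<^esub>)"
    if "x \<in> carrier M" "y \<in> carrier N" for x y
    using that by (intro bexI[of _ "(\<ominus>\<^bsub>M\<^esub> x, \<ominus>\<^bsub>N\<^esub> y)"]) (auto simp: direct_sum_simps M.M.l_neg N.M.l_neg)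
  show ?thesis
    by (intro moduleI abelian_groupI M.is_cring; (unfold direct_sum_simps(1,2))?)
      (auto simp: direct_sum_simps neg M.M.a_ac N.M.a_ac M.smult_l_distr N.smult_l_distr
        M.smult_r_distr N.smult_r_distr M.smult_assoc1 N.smult_assoc1)
qed

lemma cone_simps:
  "cmp (cone X Y \<alpha>) i = direct_sum (cmp Y i) (cmp X (i - 1))"
  "y \<in> carrier (cmp Y i) \<Longrightarrow> x \<in> carrier (cmp X (i - 1)) \<Longrightarrow> dif (cone X Y \<alpha>) i (y, x) =
    (dif Y i y \<oplus>\<^bsub>cmp Y (i - 1)\<^esub> \<alpha> (i - 1) x, \<ominus>\<^bsub>cmp X (i - 1 - 1)\<^esub> dif X (i - 1) x)"
  by (simp_all add: cone_def)

lemma cone_family: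
  assumes X: "module_family S X" and Y: "module_family S Y" and \<alpha>: "\<alpha> \<in> chain_maps S X Y"
  shows "module_family S (cone X Y \<alpha>)"
  unfolding module_family_def
proof (intro allI conjI)
  fix i
  note mods = module_familyD(1)[OF X] module_familyD(1)[OF Y]
  show "module S (cmp (cone X Y \<alpha>) i)"
    unfolding cone_simps by (intro direct_sum_module mods)
  interpret Y: module S "cmp Y (i - 1)" by (rule mods)
  interpret X: module S "cmp X (i - 1 - 1)" by (rule mods)
  note dx = module_familyD(2)[OF X, of "i - 1"] and dy = module_familyD(2)[OF Y, of i]
    and a = chain_mapsD(1)[OF \<alpha>, of "i - 1"]
  have "(\<lambda>z\<in>carrier (direct_sum (cmp Y i) (cmp X (i - 1))).
      (dif Y i (fst z) \<oplus>\<^bsub>cmp Y (i - 1)\<^esub> \<alpha> (i - 1) (snd z), \<ominus>\<^bsub>cmp X (i - 1 - 1)\<^esub> dif X (i - 1) (snd z)))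
    \<in> linear_maps S (direct_sum (cmp Y i) (cmp X (i - 1)))
        (direct_sum (cmp Y (i - 1)) (cmp X (i - 1 - 1)))"
  proof (rule linear_maps_restrictI[OF direct_sum_module[OF mods(2) mods(1)]])
    fix z assume "z \<in> carrier (direct_sum (cmp Y i) (cmp X (i - 1)))"
    then obtain y x where z: "z = (y, x)" "y \<in> carrier (cmp Y i)" "x \<in> carrier (cmp X (i - 1))"
      by (auto simp: direct_sum_simps)
    note cl = linear_maps_closed[OF dy z(2)] linear_maps_closed[OF dx z(3)] linear_maps_closed[OF a z(3)]
    show "(dif Y i (fst z) \<oplus>\<^bsub>cmp Y (i - 1)\<^esub> \<alpha> (i - 1) (snd z), \<ominus>\<^bsub>cmp X (i - 1 - 1)\<^esub> dif X (i - 1) (snd z))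
        \<in> carrier (direct_sum (cmp Y (i - 1)) (cmp X (i - 1 - 1)))"
      unfolding z(1) using Y.M.a_closed[OF cl(1,3)] X.M.a_inv_closed[OF cl(2)]
      by (simp add: direct_sum_simps)
    {
      fix z' assume "z' \<in> carrier (direct_sum (cmp Y i) (cmp X (i - 1)))"
      then obtain y' x' where z': "z' = (y', x')" "y' \<in> carrier (cmp Y i)" "x' \<in> carrier (cmp X (i - 1))"
        by (auto simp: direct_sum_simps)
      note cl' = linear_maps_closed[OF dy z'(2)] linear_maps_closed[OF dx z'(3)] linear_maps_closed[OF a z'(3)]
      show "(dif Y i (fst (z \<oplus>\<^bsub>direct_sum (cmp Y i) (cmp X (i - 1))\<^esub> z')) \<oplus>\<^bsub>cmp Y (i - 1)\<^esub>
            \<alpha> (i - 1) (snd (z \<oplus>\<^bsub>direct_sum (cmp Y i) (cmp X (i - 1))\<^esub> z')),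
          \<ominus>\<^bsub>cmp X (i - 1 - 1)\<^esub> dif X (i - 1) (snd (z \<oplus>\<^bsub>direct_sum (cmp Y i) (cmp X (i - 1))\<^esub> z'))) =
        (dif Y i (fst z) \<oplus>\<^bsub>cmp Y (i - 1)\<^esub> \<alpha> (i - 1) (snd z), \<ominus>\<^bsub>cmp X (i - 1 - 1)\<^esub> dif X (i - 1) (snd z))
          \<oplus>\<^bsub>direct_sum (cmp Y (i - 1)) (cmp X (i - 1 - 1))\<^esub>
        (dif Y i (fst z') \<oplus>\<^bsub>cmp Y (i - 1)\<^esub> \<alpha> (i - 1) (snd z'), \<ominus>\<^bsub>cmp X (i - 1 - 1)\<^esub> dif X (i - 1) (snd z'))"
        unfolding z(1) z'(1) direct_sum_simps fst_conv snd_conv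
          linear_maps_add[OF dy z(2) z'(2)] linear_maps_add[OF a z(3) z'(3)]
          linear_maps_add[OF dx z(3) z'(3)] X.M.minus_add[OF cl(2) cl'(2)]
        using cl cl' by (simp add: Y.M.a_ac)
    }
    {
      fix r assume r: "r \<in> carrier S"
      show "(dif Y i (fst (r \<odot>\<^bsub>direct_sum (cmp Y i) (cmp X (i - 1))\<^esub> z)) \<oplus>\<^bsub>cmp Y (i - 1)\<^esub>
            \<alpha> (i - 1) (snd (r \<odot>\<^bsub>direct_sum (cmp Y i) (cmp X (i - 1))\<^esub> z)),
          \<ominus>\<^bsub>cmp X (i - 1 - 1)\<^esub> dif X (i - 1) (snd (r \<odot>\<^bsub>direct_sum (cmp Y i) (cmp X (i - 1))\<^esub> z))) =
        r \<odot>\<^bsub>direct_sum (cmp Y (i - 1)) (cmp X (i - 1 - 1))\<^esub>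
        (dif Y i (fst z) \<oplus>\<^bsub>cmp Y (i - 1)\<^esub> \<alpha> (i - 1) (snd z), \<ominus>\<^bsub>cmp X (i - 1 - 1)\<^esub> dif X (i - 1) (snd z))"
        unfolding z(1) direct_sum_simps fst_conv snd_conv
          linear_maps_smult[OF dy r z(2)] linear_maps_smult[OF a r z(3)]
          linear_maps_smult[OF dx r z(3)] X.smult_r_minus[OF r cl(2)] Y.smult_r_distr[OF r cl(1,3)]
        by simp
    }
  qed
  then show "dif (cone X Y \<alpha>) i \<in> linear_maps S (cmp (cone X Y \<alpha>) i) (cmp (cone X Y \<alpha>) (i - 1))"
    by (simp add: cone_def direct_sum_def case_prod_unfold)
qed

lemma cone_incl_maps:
  assumes X: "module_family S X" and Y: "module_family S Y" and \<alpha>: "\<alpha> \<in> chain_maps S X Y"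
  shows "cone_incl X Y \<in> chain_maps S Y (cone X Y \<alpha>)"
  unfolding chain_maps_def
proof (intro CollectI allI conjI ballI)
  fix i
  note mods = module_familyD(1)[OF X] module_familyD(1)[OF Y]
  interpret X: module S "cmp X (i - 1)" by (rule mods)
  interpret Y: module S "cmp Y (i - 1)" by (rule mods)
  show "cone_incl X Y i \<in> linear_maps S (cmp Y i) (cmp (cone X Y \<alpha>) i)"
    unfolding cone_incl_def cone_simps
    by (intro linear_maps_restrictI mods) (auto simp: direct_sum_simps)
  fix y assume y: "y \<in> carrier (cmp Y i)"
  have "dif Y i y \<in> carrier (cmp Y (i - 1))" by (intro linear_maps_closed[OF module_familyD(2)[OF Y]] y)
  then show "cone_incl X Y (i - 1) (dif Y i y) = dif (cone X Y \<alpha>) i (cone_incl X Y i y)"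
    using y linear_maps_zero[OF chain_mapsD(1)[OF \<alpha>] mods, of "i - 1"]
      linear_maps_zero[OF module_familyD(2)[OF X] mods(1) mods(1), of "i - 1"]
      module_minus_zero[OF mods(1), of "i - 1 - 1"]
    by (simp add: cone_incl_def cone_simps)
qed

lemma cone_proj_maps:
  assumes X: "module_family S X" and Y: "module_family S Y" and \<alpha>: "\<alpha> \<in> chain_maps S X Y"
  shows "cone_proj X Y \<in> chain_maps S (cone X Y \<alpha>) (shift X)"
  unfolding chain_maps_def
proof (intro CollectI allI conjI ballI)
  fix i
  note mods = module_familyD(1)[OF X] module_familyD(1)[OF Y]
  have "(\<lambda>z\<in>carrier (direct_sum (cmp Y i) (cmp X (i - 1))). snd z)
      \<in> linear_maps S (direct_sum (cmp Y i) (cmp X (i - 1))) (cmp X (i - 1))"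
    by (intro linear_maps_restrictI direct_sum_module mods) (auto simp: direct_sum_simps)
  then show "cone_proj X Y i \<in> linear_maps S (cmp (cone X Y \<alpha>) i) (cmp (shift X) i)"
    by (simp add: cone_proj_def cone_simps shift_def direct_sum_def case_prod_unfold)
  fix z assume "z \<in> carrier (cmp (cone X Y \<alpha>) i)"
  then obtain y x where z: "z = (y, x)" "y \<in> carrier (cmp Y i)" "x \<in> carrier (cmp X (i - 1))"
    by (auto simp: direct_sum_simps cone_simps)
  note cl = linear_maps_closed[OF module_familyD(2)[OF Y] z(2)]
    linear_maps_closed[OF module_familyD(2)[OF X] z(3)] linear_maps_closed[OF chain_mapsD(1)[OF \<alpha>] z(3)]
  show "cone_proj X Y (i - 1) (dif (cone X Y \<alpha>) i z) = dif (shift X) i (cone_proj X Y i z)"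
    using z(2,3) module_add_closed[OF mods(2) cl(1,3)] module_neg_closed[OF mods(1) cl(2)]
    unfolding z(1) by (simp add: cone_proj_def cone_simps shift_def)
qed

section \<open>From families over \<open>S\<close> to families over \<open>R\<close>\<close>

context principal_quotient
begin

text \<open>
  The index passes through \<open>of_int\<close>, which unrolls a family indexed mod 2 to a 2-periodic family
  indexed by the integers, and leaves a family indexed by the integers as it is.
\<close>

definition hom_family :: "('i::comm_ring_1, 's, 'm) family \<Rightarrow> (int, 's set, 's set \<Rightarrow> 'm) family"
  where "hom_family X =
    \<lparr>cmp = (\<lambda>i. HomR (cmp X (of_int i))),
     dif = (\<lambda>i. hom_map (cmp X (of_int i)) (dif X (of_int i)))\<rparr>"

definition hom_chain ::
  "('i::comm_ring_1, 's, 'm) family \<Rightarrow> ('i \<Rightarrow> 'm \<Rightarrow> 'n) \<Rightarrow> int \<Rightarrow> ('s set \<Rightarrow> 'm) \<Rightarrow> 's set \<Rightarrow> 'n"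
  where "hom_chain X \<alpha> = (\<lambda>i. hom_map (cmp X (of_int i)) (\<alpha> (of_int i)))"

lemma hom_family_simps:
  "cmp (hom_family X) i = HomR (cmp X (of_int i))"
  "dif (hom_family X) i = hom_map (cmp X (of_int i)) (dif X (of_int i))"
  by (simp_all add: hom_family_def)

lemma hom_family_is_family:
  assumes X: "module_family S X"
  shows "module_family R (hom_family X)"
  using module_familyD[OF X] hom_map_linear[OF module_familyD(2)[OF X] module_familyD(1)[OF X] module_familyD(1)[OF X]]
  by (auto simp: module_family_def hom_family_simps hom_module_is_module)

lemma hom_chain_linear:
  assumes "module_family S X" "module_family S Y" "\<And>i. \<alpha> i \<in> linear_maps S (cmp X i) (cmp Y i)"
  shows "hom_chain X \<alpha> i \<in> linear_maps R (cmp (hom_family X) i) (cmp (hom_family Y) i)"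
  unfolding hom_chain_def hom_family_simps
  by (intro hom_map_linear assms(3) module_familyD(1)[OF assms(1)] module_familyD(1)[OF assms(2)])

lemma hom_chain_maps:
  assumes X: "module_family S X" and Y: "module_family S Y" and \<alpha>: "\<alpha> \<in> chain_maps S X Y"
  shows "hom_chain X \<alpha> \<in> chain_maps R (hom_family X) (hom_family Y)"
  unfolding chain_maps_def
proof (intro CollectI allI conjI ballI)
  fix i
  show "hom_chain X \<alpha> i \<in> linear_maps R (cmp (hom_family X) i) (cmp (hom_family Y) i)"
    by (rule hom_chain_linear[OF X Y chain_mapsD(1)[OF \<alpha>]])
  note lin = hom_chain_linear[OF X Y chain_mapsD(1)[OF \<alpha>]] module_familyD(2)[OF hom_family_is_family[OF X]]
    module_familyD(2)[OF hom_family_is_family[OF Y]]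
  fix h assume h: "h \<in> carrier (cmp (hom_family X) i)"
  have dh: "dif (hom_family X) i h \<in> carrier (cmp (hom_family X) (i - 1))"
    by (rule linear_maps_closed[OF lin(2) h])
  have ah: "hom_chain X \<alpha> i h \<in> carrier (cmp (hom_family Y) i)"
    by (rule linear_maps_closed[OF lin(1) h])
  show "hom_chain X \<alpha> (i - 1) (dif (hom_family X) i h) = dif (hom_family Y) i (hom_chain X \<alpha> i h)"
  proof (rule hom_eqI[where M = "cmp Y (of_int (i - 1))"])
    show "hom_chain X \<alpha> (i - 1) (dif (hom_family X) i h) \<in> carrier (HomR (cmp Y (of_int (i - 1))))"
      using linear_maps_closed[OF lin(1) dh] by (simp add: hom_family_simps)
    show "dif (hom_family Y) i (hom_chain X \<alpha> i h) \<in> carrier (HomR (cmp Y (of_int (i - 1))))"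
      using linear_maps_closed[OF lin(3) ah] by (simp add: hom_family_simps)
    show "hom_chain X \<alpha> (i - 1) (dif (hom_family X) i h) \<one>\<^bsub>R\<^esub> =
        dif (hom_family Y) i (hom_chain X \<alpha> i h) \<one>\<^bsub>R\<^esub>"
      using h dh ah chain_mapsD(2)[OF \<alpha> hom_eval_closed[OF h[unfolded hom_family_simps]]]
      by (simp add: hom_family_simps hom_chain_def hom_map_eval)
  qed
qed

lemma hom_chain_id:
  assumes X: "module_family S X"
  shows "hom_chain X (chain_id X) = chain_id (hom_family X)"
proof (rule chain_maps_eqI)
  show "hom_chain X (chain_id X) \<in> chain_maps R (hom_family X) (hom_family X)"
    by (intro hom_chain_maps chain_id_maps X)
  show "chain_id (hom_family X) \<in> chain_maps R (hom_family X) (hom_family X)"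
    by (intro chain_id_maps hom_family_is_family X)
  fix i h assume h: "h \<in> carrier (cmp (hom_family X) i)"
  then show "hom_chain X (chain_id X) i h = chain_id (hom_family X) i h"
    using linear_maps_closed[OF hom_chain_linear[OF X X chain_mapsD(1)[OF chain_id_maps[OF X]]] h]
    by (intro hom_eqI[where M = "cmp X (of_int i)"])
      (auto simp: hom_family_simps hom_chain_def hom_map_eval chain_id_def hom_eval_closed)
qed

lemma hom_chain_comp:
  assumes X: "module_family S X" and Y: "module_family S Y" and Z: "module_family S Z"
    and \<alpha>: "\<alpha> \<in> chain_maps S X Y" and \<beta>: "\<beta> \<in> chain_maps S Y Z"
  shows "hom_chain X (chain_comp X \<beta> \<alpha>) = chain_comp (hom_family X) (hom_chain Y \<beta>) (hom_chain X \<alpha>)"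
proof (rule chain_maps_eqI)
  note 1 = hom_chain_maps[OF X Z chain_comp_maps[OF X \<alpha> \<beta>]]
  note 2 = chain_comp_maps[OF hom_family_is_family[OF X] hom_chain_maps[OF X Y \<alpha>] hom_chain_maps[OF Y Z \<beta>]]
  show "hom_chain X (chain_comp X \<beta> \<alpha>) \<in> chain_maps R (hom_family X) (hom_family Z)"
    by (rule 1)
  show "chain_comp (hom_family X) (hom_chain Y \<beta>) (hom_chain X \<alpha>)
      \<in> chain_maps R (hom_family X) (hom_family Z)" by (rule 2)
  fix i h assume h: "h \<in> carrier (cmp (hom_family X) i)"
  have "hom_chain X (chain_comp X \<beta> \<alpha>) i h \<one>\<^bsub>R\<^esub> =
      chain_comp (hom_family X) (hom_chain Y \<beta>) (hom_chain X \<alpha>) i h \<one>\<^bsub>R\<^esub>"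
    using h linear_maps_closed[OF hom_chain_linear[OF X Y chain_mapsD(1)[OF \<alpha>]] h]
    by (simp add: hom_family_simps hom_chain_def hom_map_eval chain_comp_apply hom_eval_closed)
  then show "hom_chain X (chain_comp X \<beta> \<alpha>) i h = chain_comp (hom_family X) (hom_chain Y \<beta>) (hom_chain X \<alpha>) i h"
    using linear_maps_closed[OF chain_mapsD(1)[OF 1] h] linear_maps_closed[OF chain_mapsD(1)[OF 2] h]
    by (intro hom_eqI[where M = "cmp Z (of_int i)"]) (simp_all add: hom_family_simps)
qed

lemma hom_chain_add:
  assumes X: "module_family S X" and Y: "module_family S Y"
    and \<alpha>: "\<alpha> \<in> chain_maps S X Y" and \<beta>: "\<beta> \<in> chain_maps S X Y"
  shows "hom_chain X (chain_add X Y \<alpha> \<beta>) = chain_add (hom_family X) (hom_family Y) (hom_chain X \<alpha>) (hom_chain X \<beta>)"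
proof (rule chain_maps_eqI)
  note 1 = hom_chain_maps[OF X Y chain_add_maps[OF X Y \<alpha> \<beta>]]
  note 2 = chain_add_maps[OF hom_family_is_family[OF X] hom_family_is_family[OF Y]
      hom_chain_maps[OF X Y \<alpha>] hom_chain_maps[OF X Y \<beta>]]
  show "hom_chain X (chain_add X Y \<alpha> \<beta>) \<in> chain_maps R (hom_family X) (hom_family Y)"
    by (rule 1)
  show "chain_add (hom_family X) (hom_family Y) (hom_chain X \<alpha>) (hom_chain X \<beta>)
      \<in> chain_maps R (hom_family X) (hom_family Y)" by (rule 2)
  fix i h assume h: "h \<in> carrier (cmp (hom_family X) i)"
  have "hom_chain X (chain_add X Y \<alpha> \<beta>) i h \<one>\<^bsub>R\<^esub> =
      chain_add (hom_family X) (hom_family Y) (hom_chain X \<alpha>) (hom_chain X \<beta>) i h \<one>\<^bsub>R\<^esub>"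
    using h
    by (simp add: hom_family_simps hom_chain_def hom_map_eval chain_add_def add_map_def hom_eval_closed hom_add_eval)
  then show "hom_chain X (chain_add X Y \<alpha> \<beta>) i h =
      chain_add (hom_family X) (hom_family Y) (hom_chain X \<alpha>) (hom_chain X \<beta>) i h"
    using linear_maps_closed[OF chain_mapsD(1)[OF 1] h] linear_maps_closed[OF chain_mapsD(1)[OF 2] h]
    by (intro hom_eqI[where M = "cmp Y (of_int i)"]) (simp_all add: hom_family_simps)
qed

lemma hom_chain_shift: "hom_chain (shift X) (shift_map \<alpha>) = shift_map (hom_chain X \<alpha>)"
  by (simp add: hom_chain_def shift_def shift_map_def)

lemma hom_family_shift:
  assumes X: "module_family S X"
  shows "hom_family (shift X) = shift (hom_family X)"
proof -
  note X' = hom_family_is_family[OF X]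
  have eq: "dif (hom_family (shift X)) i = dif (shift (hom_family X)) i" for i
  proof (rule linear_maps_eqI)
    note 1 = module_familyD(2)[OF hom_family_is_family[OF shift_family[OF X]], of i]
    note 2 = module_familyD(2)[OF shift_family[OF X'], of i]
    show "dif (hom_family (shift X)) i \<in> linear_maps R
        (cmp (hom_family (shift X)) i) (cmp (hom_family (shift X)) (i - 1))" by (rule 1)
    show "dif (shift (hom_family X)) i \<in> linear_maps R
        (cmp (hom_family (shift X)) i) (cmp (shift (hom_family X)) (i - 1))"
      using 2 by (simp add: hom_family_simps shift_def)
    fix h assume h: "h \<in> carrier (cmp (hom_family (shift X)) i)"
    then have h': "h \<in> carrier (cmp (hom_family X) (i - 1))" "h \<in> carrier (cmp (shift (hom_family X)) i)"
      by (simp_all add: hom_family_simps shift_def)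
    have "dif (hom_family (shift X)) i h \<one>\<^bsub>R\<^esub> =
        dif (shift (hom_family X)) i h \<one>\<^bsub>R\<^esub>"
      using h h'(1) hom_eval_closed[OF h'(1)[unfolded hom_family_simps]]
        linear_maps_closed[OF module_familyD(2)[OF X'] h'(1)]
        hom_neg_eval[OF module_familyD(1)[OF X], of _ "of_int (i - 1 - 1)"]
      by (simp add: hom_family_simps shift_def hom_map_eval)
    then show "dif (hom_family (shift X)) i h = dif (shift (hom_family X)) i h"
      using linear_maps_closed[OF 1 h] linear_maps_closed[OF 2 h'(2)]
      by (intro hom_eqI[where M = "cmp X (of_int (i - 1 - 1))"]) (simp_all add: hom_family_simps shift_def)
  qed
  have "cmp (hom_family (shift X)) i = cmp (shift (hom_family X)) i" for i
    by (simp add: hom_family_simps shift_def)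
  then have "cmp (hom_family (shift X)) = cmp (shift (hom_family X))" by blast
  moreover have "dif (hom_family (shift X)) = dif (shift (hom_family X))" using eq by blast
  ultimately show ?thesis by (intro family.equality) simp_all
qed

text \<open>
  The maps \<open>\<alpha>\<close> and \<open>\<beta>\<close> are allowed not to commute with the differentials, since the lifts of
  a chain map over \<open>R\<close> do so only modulo \<open>f\<close>.
\<close>

lemma hom_homotopy:
  assumes X: "module_family S X" and Y: "module_family S Y" and h: "homotopy S X Y \<alpha> \<beta> h"
    and \<alpha>: "\<And>i. \<alpha> i \<in> linear_maps S (cmp X i) (cmp Y i)"
    and \<beta>: "\<And>i. \<beta> i \<in> linear_maps S (cmp X i) (cmp Y i)"
  shows "homotopy R (hom_family X) (hom_family Y) (hom_chain X \<alpha>) (hom_chain X \<beta>)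
    (\<lambda>i. hom_map (cmp X (of_int i)) (h (of_int i)))"
  unfolding homotopy_def
proof (intro allI conjI ballI)
  fix i :: int
  note X' = hom_family_is_family[OF X] and Y' = hom_family_is_family[OF Y]
  let ?h = "\<lambda>i::int. hom_map (cmp X (of_int i)) (h (of_int i))"
  have lin: "?h i \<in> linear_maps R (cmp (hom_family X) i) (cmp (hom_family Y) (i + 1))" for i
    using hom_map_linear[OF homotopyD(1)[OF h] module_familyD(1)[OF X] module_familyD(1)[OF Y], of "of_int i"]
    by (simp add: hom_family_simps)
  then show "?h i \<in> linear_maps R (cmp (hom_family X) i) (cmp (hom_family Y) (i + 1))" .
  have lin': "?h (i - 1) \<in> linear_maps R (cmp (hom_family X) (i - 1)) (cmp (hom_family Y) i)"
    using lin by (rule homotopy_step_linear)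
  fix t assume t: "t \<in> carrier (cmp (hom_family X) i)"
  note cl = linear_maps_closed[OF hom_chain_linear[OF X Y \<alpha>] t] linear_maps_closed[OF hom_chain_linear[OF X Y \<beta>] t]
    linear_maps_closed[OF lin t] linear_maps_closed[OF module_familyD(2)[OF X'] t]
  have cl2: "dif (hom_family Y) (i + 1) (?h i t) \<in> carrier (cmp (hom_family Y) i)"
    by (rule linear_maps_closed[OF dif_Suc[OF Y'] cl(3)])
  have cl3: "?h (i - 1) (dif (hom_family X) i t) \<in> carrier (cmp (hom_family Y) i)"
    by (rule linear_maps_closed[OF lin' cl(4)])
  note add = module_add_closed[OF module_familyD(1)[OF Y']]
  have "hom_chain X \<alpha> i t \<one>\<^bsub>R\<^esub> =
      (hom_chain X \<beta> i t \<oplus>\<^bsub>cmp (hom_family Y) i\<^esub> (dif (hom_family Y) (i + 1) (?h i t)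
        \<oplus>\<^bsub>cmp (hom_family Y) i\<^esub> ?h (i - 1) (dif (hom_family X) i t))) \<one>\<^bsub>R\<^esub>"
    using t cl homotopyD(3)[OF h hom_eval_closed[OF t[unfolded hom_family_simps]]]
    by (simp add: hom_family_simps hom_add_eval hom_chain_def hom_map_eval)
  then show "hom_chain X \<alpha> i t = hom_chain X \<beta> i t \<oplus>\<^bsub>cmp (hom_family Y) i\<^esub> (dif (hom_family Y) (i + 1) (?h i t)
        \<oplus>\<^bsub>cmp (hom_family Y) i\<^esub> ?h (i - 1) (dif (hom_family X) i t))"
    using cl(1) add[OF cl(2) add[OF cl2 cl3]]
    by (intro hom_eqI[where M = "cmp Y (of_int i)"]) (simp_all add: hom_family_simps)
qed

lemma hom_chain_rel:
  assumes X: "module_family S X" and Y: "module_family S Y" and \<alpha>: "(\<alpha>, \<beta>) \<in> homotopy_rel S X Y"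
  shows "(hom_chain X \<alpha>, hom_chain X \<beta>) \<in> homotopy_rel R (hom_family X) (hom_family Y)"
proof -
  obtain h where "homotopy S X Y \<alpha> \<beta> h" using homotopy_relE[OF \<alpha> X Y] by metis
  from hom_homotopy[OF X Y this homotopy_relD(1)[OF \<alpha>, THEN chain_mapsD(1)]
      homotopy_relD(2)[OF \<alpha>, THEN chain_mapsD(1)]] show ?thesis
    by (rule homotopy_relI[OF hom_family_is_family[OF X] hom_family_is_family[OF Y]
        hom_chain_maps[OF X Y homotopy_relD(1)[OF \<alpha>]] hom_chain_maps[OF X Y homotopy_relD(2)[OF \<alpha>]]])
qed

lemma hom_chain_equiv:
  assumes X: "module_family S X" and Y: "module_family S Y" and \<alpha>: "\<alpha> \<in> homotopy_equivs S X Y"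
  shows "hom_chain X \<alpha> \<in> homotopy_equivs R (hom_family X) (hom_family Y)"
proof -
  from \<alpha> obtain \<beta> where *: "\<alpha> \<in> chain_maps S X Y" "\<beta> \<in> chain_maps S Y X"
    "(chain_comp X \<beta> \<alpha>, chain_id X) \<in> homotopy_rel S X X"
    "(chain_comp Y \<alpha> \<beta>, chain_id Y) \<in> homotopy_rel S Y Y" by (rule homotopy_equivsE)
  show ?thesis
    using hom_chain_rel[OF X X *(3)] hom_chain_rel[OF Y Y *(4)]
    by (intro homotopy_equivsI[OF hom_chain_maps[OF X Y *(1)] hom_chain_maps[OF Y X *(2)]])
      (simp_all add: hom_chain_comp[OF X Y X *(1,2)] hom_chain_comp[OF Y X Y *(2,1)] hom_chain_id X Y)
qed

text \<open>
  The canonical isomorphism from \<open>Hom\<^sub>S(R, cone \<alpha>)\<close> to the cone of \<open>Hom\<^sub>S(R, \<alpha>)\<close>.  It is needed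
  because the two have different carriers: functions with values in pairs, and pairs of functions.
\<close>

definition hom_split ::
  "('i::comm_ring_1, 's, 'm) family \<Rightarrow> ('i, 's, 'n) family \<Rightarrow> ('i \<Rightarrow> 'm \<Rightarrow> 'n) \<Rightarrow>
    int \<Rightarrow> ('s set \<Rightarrow> 'n \<times> 'm) \<Rightarrow> ('s set \<Rightarrow> 'n) \<times> ('s set \<Rightarrow> 'm)"
  where "hom_split X Y \<alpha> = (\<lambda>i. \<lambda>h\<in>carrier (cmp (hom_family (cone X Y \<alpha>)) i).
    (hom_map (cmp (cone X Y \<alpha>) (of_int i)) (\<lambda>z\<in>carrier (cmp (cone X Y \<alpha>) (of_int i)). fst z) h,
     hom_map (cmp (cone X Y \<alpha>) (of_int i)) (\<lambda>z\<in>carrier (cmp (cone X Y \<alpha>) (of_int i)). snd z) h))"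

lemma hom_split:
  assumes X: "module_family S X" and Y: "module_family S Y" and \<alpha>: "\<alpha> \<in> chain_maps S X Y"
  shows hom_split_linear: "hom_split X Y \<alpha> i \<in> linear_maps R (cmp (hom_family (cone X Y \<alpha>)) i)
      (cmp (cone (hom_family X) (hom_family Y) (hom_chain X \<alpha>)) i)"
    and hom_split_eval: "h \<in> carrier (cmp (hom_family (cone X Y \<alpha>)) i) \<Longrightarrow>
      fst (hom_split X Y \<alpha> i h) \<one>\<^bsub>R\<^esub> = fst (h \<one>\<^bsub>R\<^esub>)"
      "h \<in> carrier (cmp (hom_family (cone X Y \<alpha>)) i) \<Longrightarrow>
      snd (hom_split X Y \<alpha> i h) \<one>\<^bsub>R\<^esub> = snd (h \<one>\<^bsub>R\<^esub>)"
proof -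
  let ?D = "cmp (cone X Y \<alpha>) (of_int i)" and ?M = "cmp Y (of_int i)" and ?N = "cmp X (of_int i - 1)"
  note mods = module_familyD(1)[OF X] module_familyD(1)[OF Y] module_familyD(1)[OF cone_family[OF X Y \<alpha>]]
  have "(\<lambda>z\<in>carrier ?D. fst z) \<in> linear_maps S ?D ?M"
    by (intro linear_maps_restrictI mods) (auto simp: cone_simps direct_sum_simps)
  then have 1: "hom_map ?D (\<lambda>z\<in>carrier ?D. fst z) \<in> linear_maps R
      (HomR ?D) (HomR ?M)" by (intro hom_map_linear mods)
  have "(\<lambda>z\<in>carrier ?D. snd z) \<in> linear_maps S ?D ?N"
    by (intro linear_maps_restrictI mods) (auto simp: cone_simps direct_sum_simps)
  then have 2: "hom_map ?D (\<lambda>z\<in>carrier ?D. snd z) \<in> linear_maps R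
      (HomR ?D) (HomR ?N)" by (intro hom_map_linear mods)
  show "hom_split X Y \<alpha> i \<in> linear_maps R (cmp (hom_family (cone X Y \<alpha>)) i)
      (cmp (cone (hom_family X) (hom_family Y) (hom_chain X \<alpha>)) i)"
    unfolding hom_split_def cone_simps(1)[of "hom_family X"] hom_family_simps of_int_diff of_int_1
    by (intro linear_maps_restrictI hom_module_is_module mods)
      (simp_all add: direct_sum_simps linear_maps_closed[OF 1] linear_maps_closed[OF 2]
        linear_maps_add[OF 1] linear_maps_add[OF 2] linear_maps_smult[OF 1] linear_maps_smult[OF 2])
  assume h: "h \<in> carrier (cmp (hom_family (cone X Y \<alpha>)) i)"
  then show "fst (hom_split X Y \<alpha> i h) \<one>\<^bsub>R\<^esub> = fst (h \<one>\<^bsub>R\<^esub>)"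
    "snd (hom_split X Y \<alpha> i h) \<one>\<^bsub>R\<^esub> = snd (h \<one>\<^bsub>R\<^esub>)"
    by (simp_all add: hom_split_def hom_family_simps hom_map_eval hom_eval_closed)
qed

lemma hom_pair_eqI:
  assumes "z \<in> carrier (cmp (cone (hom_family X) (hom_family Y) \<gamma>) i)"
    and "z' \<in> carrier (cmp (cone (hom_family X) (hom_family Y) \<gamma>) i)"
    and "fst z \<one>\<^bsub>R\<^esub> = fst z' \<one>\<^bsub>R\<^esub>"
    and "snd z \<one>\<^bsub>R\<^esub> = snd z' \<one>\<^bsub>R\<^esub>"
  shows "z = z'"
  using assms hom_eqI[of "fst z" "cmp Y (of_int i)" "fst z'"]
    hom_eqI[of "snd z" "cmp X (of_int (i - 1))" "snd z'"]
  by (intro prod_eqI) (auto simp: cone_simps direct_sum_simps hom_family_simps)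

lemma hom_split_maps:
  assumes X: "module_family S X" and Y: "module_family S Y" and \<alpha>: "\<alpha> \<in> chain_maps S X Y"
  shows "hom_split X Y \<alpha> \<in> chain_maps R (hom_family (cone X Y \<alpha>))
    (cone (hom_family X) (hom_family Y) (hom_chain X \<alpha>))"
  unfolding chain_maps_def
proof (intro CollectI allI conjI ballI)
  fix i
  let ?C = "cone X Y \<alpha>" and ?C' = "cone (hom_family X) (hom_family Y) (hom_chain X \<alpha>)"
  note X' = hom_family_is_family[OF X] and Y' = hom_family_is_family[OF Y]
  note C = cone_family[OF X Y \<alpha>] and C' = cone_family[OF X' Y' hom_chain_maps[OF X Y \<alpha>]]
  note HC = hom_family_is_family[OF C]
  note lin = hom_split_linear[OF X Y \<alpha>]
  show "hom_split X Y \<alpha> i \<in> linear_maps R (cmp (hom_family ?C) i) (cmp ?C' i)"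
    by (rule lin)
  fix h assume h: "h \<in> carrier (cmp (hom_family ?C) i)"
  have dh: "dif (hom_family ?C) i h \<in> carrier (cmp (hom_family ?C) (i - 1))"
    by (rule linear_maps_closed[OF module_familyD(2)[OF HC] h])
  have sh: "hom_split X Y \<alpha> i h \<in> carrier (cmp ?C' i)" by (rule linear_maps_closed[OF lin h])
  obtain p q where pq: "hom_split X Y \<alpha> i h = (p, q)" "p \<in> carrier (cmp (hom_family Y) i)"
    "q \<in> carrier (cmp (hom_family X) (i - 1))"
    using sh by (auto simp: cone_simps direct_sum_simps)
  obtain y x where yx: "h \<one>\<^bsub>R\<^esub> = (y, x)" "y \<in> carrier (cmp Y (of_int i))"
    "x \<in> carrier (cmp X (of_int i - 1))"
    using hom_eval_closed[OF h[unfolded hom_family_simps]] by (auto simp: cone_simps direct_sum_simps)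
  have ev: "p \<one>\<^bsub>R\<^esub> = y" "q \<one>\<^bsub>R\<^esub> = x"
    using hom_split_eval[OF X Y \<alpha> h] pq(1) yx(1) by auto
  have ev_dh: "dif (hom_family ?C) i h \<one>\<^bsub>R\<^esub> =
      (dif Y (of_int i) y \<oplus>\<^bsub>cmp Y (of_int i - 1)\<^esub> \<alpha> (of_int i - 1) x,
       \<ominus>\<^bsub>cmp X (of_int i - 1 - 1)\<^esub> dif X (of_int i - 1) x)"
    using h yx by (simp add: hom_family_simps hom_map_eval cone_simps)
  have neg_q: "(\<ominus>\<^bsub>cmp (hom_family X) (i - 1 - 1)\<^esub> dif (hom_family X) (i - 1) q) \<one>\<^bsub>R\<^esub> =
      \<ominus>\<^bsub>cmp X (of_int (i - 1 - 1))\<^esub> dif X (of_int (i - 1)) x"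
    using hom_neg_eval[OF module_familyD(1)[OF X], of "dif (hom_family X) (i - 1) q" "of_int (i - 1 - 1)"]
      linear_maps_closed[OF module_familyD(2)[OF X'] pq(3)] pq(3) ev
    by (simp add: hom_family_simps hom_map_eval)
  show "hom_split X Y \<alpha> (i - 1) (dif (hom_family ?C) i h) = dif ?C' i (hom_split X Y \<alpha> i h)"
  proof (rule hom_pair_eqI)
    show "hom_split X Y \<alpha> (i - 1) (dif (hom_family ?C) i h) \<in> carrier (cmp ?C' (i - 1))"
      by (rule linear_maps_closed[OF lin dh])
    show "dif ?C' i (hom_split X Y \<alpha> i h) \<in> carrier (cmp ?C' (i - 1))"
      by (rule linear_maps_closed[OF module_familyD(2)[OF C'] sh])
    show "fst (hom_split X Y \<alpha> (i - 1) (dif (hom_family ?C) i h)) \<one>\<^bsub>R\<^esub> =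
        fst (dif ?C' i (hom_split X Y \<alpha> i h)) \<one>\<^bsub>R\<^esub>"
      unfolding hom_split_eval[OF X Y \<alpha> dh] ev_dh pq(1) cone_simps(2)[OF pq(2,3)] fst_conv
      using pq(2,3) ev by (simp add: hom_family_simps hom_add_eval hom_chain_def hom_map_eval)
    show "snd (hom_split X Y \<alpha> (i - 1) (dif (hom_family ?C) i h)) \<one>\<^bsub>R\<^esub> =
        snd (dif ?C' i (hom_split X Y \<alpha> i h)) \<one>\<^bsub>R\<^esub>"
      unfolding hom_split_eval[OF X Y \<alpha> dh] ev_dh pq(1) cone_simps(2)[OF pq(2,3)] snd_conv neg_q
      by simp
  qed
qed

lemma hom_split_equiv:
  assumes X: "module_family S X" and Y: "module_family S Y" and \<alpha>: "\<alpha> \<in> chain_maps S X Y"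
  shows "hom_split X Y \<alpha> \<in> homotopy_equivs R (hom_family (cone X Y \<alpha>))
    (cone (hom_family X) (hom_family Y) (hom_chain X \<alpha>))"
proof (rule bij_chain_map_homotopy_equiv[OF _ _ hom_split_maps[OF X Y \<alpha>]])
  let ?C = "cone X Y \<alpha>" and ?C' = "cone (hom_family X) (hom_family Y) (hom_chain X \<alpha>)"
  note X' = hom_family_is_family[OF X] and Y' = hom_family_is_family[OF Y]
  note C = cone_family[OF X Y \<alpha>]
  show "module_family R (hom_family ?C)" by (rule hom_family_is_family[OF C])
  show "module_family R ?C'" by (rule cone_family[OF X' Y' hom_chain_maps[OF X Y \<alpha>]])
  fix i
  let ?s = "hom_split X Y \<alpha> i"
  note lin = hom_split_linear[OF X Y \<alpha>, of i] and ev = hom_split_eval[OF X Y \<alpha>]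
  show "bij_betw ?s (carrier (cmp (hom_family ?C) i)) (carrier (cmp ?C' i))"
  proof (rule bij_betw_imageI)
    show "inj_on ?s (carrier (cmp (hom_family ?C) i))"
    proof (rule inj_onI)
      fix h h' assume h: "h \<in> carrier (cmp (hom_family ?C) i)" "h' \<in> carrier (cmp (hom_family ?C) i)" "?s h = ?s h'"
      have "h \<one>\<^bsub>R\<^esub> = h' \<one>\<^bsub>R\<^esub>"
        using ev[OF h(1)] ev[OF h(2)] h(3) by (intro prod_eqI) simp_all
      then show "h = h'" using h by (intro hom_eqI) (simp_all add: hom_family_simps)
    qed
    show "?s ` carrier (cmp (hom_family ?C) i) = carrier (cmp ?C' i)"
    proof (intro equalityI subsetI)
      fix z assume "z \<in> ?s ` carrier (cmp (hom_family ?C) i)"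
      then show "z \<in> carrier (cmp ?C' i)" using linear_maps_closed[OF lin] by auto
    next
      fix z assume z: "z \<in> carrier (cmp ?C' i)"
      then obtain p q where pq: "z = (p, q)" "p \<in> carrier (HomR (cmp Y (of_int i)))"
        "q \<in> carrier (HomR (cmp X (of_int i - 1)))"
        by (auto simp: cone_simps direct_sum_simps hom_family_simps)
      let ?x = "(p \<one>\<^bsub>R\<^esub>, q \<one>\<^bsub>R\<^esub>)"
      have x: "?x \<in> carrier (cmp ?C (of_int i))" "f \<odot>\<^bsub>cmp ?C (of_int i)\<^esub> ?x = \<zero>\<^bsub>cmp ?C (of_int i)\<^esub>"
        using hom_eval_closed[OF pq(2)] hom_eval_closed[OF pq(3)]
          hom_eval_torsion[OF module_familyD(1)[OF Y] pq(2)] hom_eval_torsion[OF module_familyD(1)[OF X] pq(3)]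
        by (simp_all add: cone_simps direct_sum_simps)
      note at = hom_at[OF module_familyD(1)[OF C] x]
      have h: "hom_at (cmp ?C (of_int i)) ?x \<in> carrier (cmp (hom_family ?C) i)"
        using at(1) by (simp add: hom_family_simps)
      have "?s (hom_at (cmp ?C (of_int i)) ?x) = z"
        using ev[OF h] at(2) pq(1) by (intro hom_pair_eqI[OF linear_maps_closed[OF lin h] z]) simp_all
      then show "z \<in> ?s ` carrier (cmp (hom_family ?C) i)" using h by blast
    qed
  qed
qed

lemma hom_split_incl:
  assumes X: "module_family S X" and Y: "module_family S Y" and \<alpha>: "\<alpha> \<in> chain_maps S X Y"
  shows "chain_comp (hom_family Y) (hom_split X Y \<alpha>) (hom_chain Y (cone_incl X Y)) =
    cone_incl (hom_family X) (hom_family Y)"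
proof (rule chain_maps_eqI)
  let ?C = "cone X Y \<alpha>" and ?C' = "cone (hom_family X) (hom_family Y) (hom_chain X \<alpha>)"
  note X' = hom_family_is_family[OF X] and Y' = hom_family_is_family[OF Y] and C = cone_family[OF X Y \<alpha>]
  note inc = hom_chain_maps[OF Y C cone_incl_maps[OF X Y \<alpha>]]
  note 1 = chain_comp_maps[OF Y' inc hom_split_maps[OF X Y \<alpha>]]
  note 2 = cone_incl_maps[OF X' Y' hom_chain_maps[OF X Y \<alpha>]]
  show "chain_comp (hom_family Y) (hom_split X Y \<alpha>) (hom_chain Y (cone_incl X Y))
    \<in> chain_maps R (hom_family Y) ?C'" by (rule 1)
  show "cone_incl (hom_family X) (hom_family Y) \<in> chain_maps R (hom_family Y) ?C'" by (rule 2)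
  fix i h assume h: "h \<in> carrier (cmp (hom_family Y) i)"
  note ih = linear_maps_closed[OF chain_mapsD(1)[OF inc] h]
  have e: "hom_chain Y (cone_incl X Y) i h \<one>\<^bsub>R\<^esub> =
      (h \<one>\<^bsub>R\<^esub>, \<zero>\<^bsub>cmp X (of_int i - 1)\<^esub>)"
    using h by (simp add: hom_family_simps hom_chain_def hom_map_eval cone_incl_def hom_eval_closed)
  show "chain_comp (hom_family Y) (hom_split X Y \<alpha>) (hom_chain Y (cone_incl X Y)) i h =
      cone_incl (hom_family X) (hom_family Y) i h"
    using h e hom_split_eval[OF X Y \<alpha> ih]
    by (intro hom_pair_eqI[OF linear_maps_closed[OF chain_mapsD(1)[OF 1] h] linear_maps_closed[OF chain_mapsD(1)[OF 2] h]])
      (simp_all add: chain_comp_apply cone_incl_def hom_family_simps hom_zero_eval)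
qed

lemma hom_split_proj:
  assumes X: "module_family S X" and Y: "module_family S Y" and \<alpha>: "\<alpha> \<in> chain_maps S X Y"
  shows "chain_comp (hom_family (cone X Y \<alpha>)) (cone_proj (hom_family X) (hom_family Y)) (hom_split X Y \<alpha>) =
    hom_chain (cone X Y \<alpha>) (cone_proj X Y)"
proof (rule chain_maps_eqI)
  let ?C = "cone X Y \<alpha>" and ?C' = "cone (hom_family X) (hom_family Y) (hom_chain X \<alpha>)"
  note X' = hom_family_is_family[OF X] and Y' = hom_family_is_family[OF Y] and C = cone_family[OF X Y \<alpha>]
  note 1 = chain_comp_maps[OF hom_family_is_family[OF C] hom_split_maps[OF X Y \<alpha>]
      cone_proj_maps[OF X' Y' hom_chain_maps[OF X Y \<alpha>]]]
  note 2 = hom_chain_maps[OF C shift_family[OF X] cone_proj_maps[OF X Y \<alpha>], unfolded hom_family_shift[OF X]]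
  show "chain_comp (hom_family ?C) (cone_proj (hom_family X) (hom_family Y)) (hom_split X Y \<alpha>)
    \<in> chain_maps R (hom_family ?C) (shift (hom_family X))" by (rule 1)
  show "hom_chain ?C (cone_proj X Y) \<in> chain_maps R (hom_family ?C) (shift (hom_family X))"
    by (rule 2)
  fix i h assume h: "h \<in> carrier (cmp (hom_family ?C) i)"
  obtain p q where pq: "hom_split X Y \<alpha> i h = (p, q)" "p \<in> carrier (cmp (hom_family Y) i)"
    "q \<in> carrier (cmp (hom_family X) (i - 1))"
    using linear_maps_closed[OF hom_split_linear[OF X Y \<alpha>] h] by (auto simp: cone_simps direct_sum_simps)
  obtain y x where yx: "h \<one>\<^bsub>R\<^esub> = (y, x)" "y \<in> carrier (cmp Y (of_int i))"
    "x \<in> carrier (cmp X (of_int i - 1))"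
    using hom_eval_closed[OF h[unfolded hom_family_simps]] by (auto simp: cone_simps direct_sum_simps)
  have "chain_comp (hom_family ?C) (cone_proj (hom_family X) (hom_family Y)) (hom_split X Y \<alpha>) i h
      \<one>\<^bsub>R\<^esub> = hom_chain ?C (cone_proj X Y) i h \<one>\<^bsub>R\<^esub>"
    using h pq yx hom_split_eval(2)[OF X Y \<alpha> h]
    by (simp add: chain_comp_apply cone_proj_def hom_chain_def hom_family_simps hom_map_eval)
  then show "chain_comp (hom_family ?C) (cone_proj (hom_family X) (hom_family Y)) (hom_split X Y \<alpha>) i h =
      hom_chain ?C (cone_proj X Y) i h"
    using linear_maps_closed[OF chain_mapsD(1)[OF 1] h] linear_maps_closed[OF chain_mapsD(1)[OF 2] h]
    by (intro hom_eqI[where M = "cmp X (of_int (i - 1))"]) (simp_all add: hom_family_simps shift_def)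
qed

end

section \<open>Compatibility with the triangulated structures\<close>

lemma homotopy_category_simps:
  "Ob (homotopy_category S Obj) = Obj"
  "Mor (homotopy_category S Obj) X Y = chain_maps S X Y // homotopy_rel S X Y"
  "Ident (homotopy_category S Obj) X = homotopy_rel S X X `` {chain_id X}"
  "Shift (homotopy_category S Obj) X = shift X"
  by (simp_all add: homotopy_category_def)

lemma Comp_Ident_left:
  assumes X: "module_family S X" and Y: "module_family S Y"
    and u: "u \<in> chain_maps S X Y // homotopy_rel S X Y"
  shows "Comp (homotopy_category S Obj) X Y Y (homotopy_rel S Y Y `` {chain_id Y}) u = u"
proof -
  obtain \<alpha> where \<alpha>: "\<alpha> \<in> chain_maps S X Y" "u = homotopy_rel S X Y `` {\<alpha>}"
    using u by (rule homotopy_classE)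
  show ?thesis
    unfolding \<alpha>(2) Comp_class[OF X Y Y \<alpha>(1) chain_id_maps[OF Y]] chain_comp_id_left[OF X \<alpha>(1)] by simp
qed

lemma Comp_Ident_right:
  assumes X: "module_family S X" and Y: "module_family S Y"
    and u: "u \<in> chain_maps S X Y // homotopy_rel S X Y"
  shows "Comp (homotopy_category S Obj) X X Y u (homotopy_rel S X X `` {chain_id X}) = u"
proof -
  obtain \<alpha> where \<alpha>: "\<alpha> \<in> chain_maps S X Y" "u = homotopy_rel S X Y `` {\<alpha>}"
    using u by (rule homotopy_classE)
  show ?thesis
    unfolding \<alpha>(2) Comp_class[OF X X Y chain_id_maps[OF X] \<alpha>(1)] chain_comp_id_right[OF X \<alpha>(1)] by simp
qed

lemma Ident_iso:
  assumes X: "module_family S X"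
  shows "homotopy_rel S X X `` {chain_id X} \<in> isos (homotopy_category S Obj) X X"
proof -
  have "homotopy_rel S X X `` {chain_id X} \<in> chain_maps S X X // homotopy_rel S X X"
    by (rule quotientI[OF chain_id_maps[OF X]])
  then show ?thesis
    unfolding isos_def homotopy_category_simps
    using Comp_Ident_left[OF X X] by blast
qed

context principal_quotient
begin

definition hom_class ::
  "('i::comm_ring_1, 's, 'm) family \<Rightarrow> ('i, 's, 'n) family \<Rightarrow> ('i \<Rightarrow> 'm \<Rightarrow> 'n) set \<Rightarrow>
    (int \<Rightarrow> ('s set \<Rightarrow> 'm) \<Rightarrow> 's set \<Rightarrow> 'n) set"
  where "hom_class X Y u =
    (\<Union>\<alpha>\<in>u. homotopy_rel R (hom_family X) (hom_family Y) `` {hom_chain X \<alpha>})"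

lemma hom_class:
  assumes X: "module_family S X" and Y: "module_family S Y" and \<alpha>: "\<alpha> \<in> chain_maps S X Y"
  shows "hom_class X Y (homotopy_rel S X Y `` {\<alpha>}) =
    homotopy_rel R (hom_family X) (hom_family Y) `` {hom_chain X \<alpha>}"
  unfolding hom_class_def
proof (rule UN_constant[OF homotopy_class_self[OF X Y \<alpha>]])
  fix \<beta> assume "\<beta> \<in> homotopy_rel S X Y `` {\<alpha>}"
  then have "(\<alpha>, \<beta>) \<in> homotopy_rel S X Y" by simp
  from homotopy_class_eqI[OF hom_family_is_family[OF X] hom_family_is_family[OF Y] hom_chain_rel[OF X Y this]]
  show "homotopy_rel R (hom_family X) (hom_family Y) `` {hom_chain X \<beta>} =
      homotopy_rel R (hom_family X) (hom_family Y) `` {hom_chain X \<alpha>}" by simp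
qed

lemma hom_class_Mor:
  assumes X: "module_family S X" and Y: "module_family S Y"
    and u: "u \<in> chain_maps S X Y // homotopy_rel S X Y"
  shows "hom_class X Y u \<in> chain_maps R (hom_family X) (hom_family Y) //
    homotopy_rel R (hom_family X) (hom_family Y)"
proof -
  obtain \<alpha> where \<alpha>: "\<alpha> \<in> chain_maps S X Y" "u = homotopy_rel S X Y `` {\<alpha>}"
    using u by (rule homotopy_classE)
  show ?thesis unfolding \<alpha>(2) hom_class[OF X Y \<alpha>(1)]
    by (rule quotientI[OF hom_chain_maps[OF X Y \<alpha>(1)]])
qed

lemma hom_class_member:
  assumes X: "module_family S X" and Y: "module_family S Y"
    and u: "u \<in> chain_maps S X Y // homotopy_rel S X Y" and \<alpha>: "\<alpha> \<in> u"
  shows "hom_chain X \<alpha> \<in> hom_class X Y u"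
  unfolding homotopy_class_rep(2)[OF X Y u \<alpha>] hom_class[OF X Y homotopy_class_rep(1)[OF X Y u \<alpha>]]
  by (intro homotopy_class_self hom_family_is_family X Y hom_chain_maps homotopy_class_rep(1)[OF X Y u \<alpha>])

text \<open>
  A triangle is exact through homotopy equivalences \<open>a\<close>, \<open>b\<close>, \<open>c\<close> to the triangle of a cone.  Their
  images serve for the image triangle, with the image of \<open>c\<close> followed by \<open>hom_split\<close>, which is
  compatible with the inclusion into the cone and the projection from it.
\<close>

lemma hom_triangle:
  assumes fam: "\<And>X. X \<in> Obj \<Longrightarrow> module_family S X" and Obj': "\<And>X. X \<in> Obj \<Longrightarrow> hom_family X \<in> Obj'"
    and tri: "(X, Y, Z, u, v, w) \<in> Triangles (homotopy_category S Obj)"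
  shows "(hom_family X, hom_family Y, hom_family Z, hom_class X Y u, hom_class Y Z v, hom_class Z (shift X) w)
    \<in> Triangles (homotopy_category R Obj')"
proof -
  from tri have Ob: "X \<in> Obj" "Y \<in> Obj" "Z \<in> Obj"
    and u: "u \<in> chain_maps S X Y // homotopy_rel S X Y"
    and v: "v \<in> chain_maps S Y Z // homotopy_rel S Y Z"
    and w: "w \<in> chain_maps S Z (shift X) // homotopy_rel S Z (shift X)"
    by (auto simp: homotopy_category_def)
  from tri obtain X' Y' \<alpha> a b c u' v' w' where Ob': "X' \<in> Obj" "Y' \<in> Obj"
    and \<alpha>: "\<alpha> \<in> chain_maps S X' Y'"
    and a: "a \<in> homotopy_equivs S X X'" and b: "b \<in> homotopy_equivs S Y Y'"
    and c: "c \<in> homotopy_equivs S Z (cone X' Y' \<alpha>)" and uvw: "u' \<in> u" "v' \<in> v" "w' \<in> w"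
    and sq1: "(chain_comp X b u', chain_comp X \<alpha> a) \<in> homotopy_rel S X Y'"
    and sq2: "(chain_comp Y c v', chain_comp Y (cone_incl X' Y') b) \<in> homotopy_rel S Y (cone X' Y' \<alpha>)"
    and sq3: "(chain_comp Z (shift_map a) w', chain_comp Z (cone_proj X' Y') c) \<in> homotopy_rel S Z (shift X')"
    by (auto simp: homotopy_category_def)
  note X = fam[OF Ob(1)] and Y = fam[OF Ob(2)] and Z = fam[OF Ob(3)] and X' = fam[OF Ob'(1)] and Y' = fam[OF Ob'(2)]
  note sX = shift_family[OF X] and sX' = shift_family[OF X'] and K = cone_family[OF X' Y' \<alpha>]
  note TX = hom_family_is_family[OF X] and TY = hom_family_is_family[OF Y] and TZ = hom_family_is_family[OF Z]
    and TX' = hom_family_is_family[OF X'] and TY' = hom_family_is_family[OF Y']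
    and TK = hom_family_is_family[OF K] and T\<alpha> = hom_chain_maps[OF X' Y' \<alpha>]
  note KT = cone_family[OF TX' TY' T\<alpha>]
  have ca: "a \<in> chain_maps S X X'" and cb: "b \<in> chain_maps S Y Y'" and cc: "c \<in> chain_maps S Z (cone X' Y' \<alpha>)"
    using a b c by (auto simp: homotopy_equivs_def)
  note cu = homotopy_class_rep(1)[OF X Y u uvw(1)] and cv = homotopy_class_rep(1)[OF Y Z v uvw(2)]
    and cw = homotopy_class_rep(1)[OF Z sX w uvw(3)]
  define s where "s = hom_split X' Y' \<alpha>"
  note s = hom_split_maps[OF X' Y' \<alpha>, folded s_def]
  note inc = cone_incl_maps[OF X' Y' \<alpha>] and prj = cone_proj_maps[OF X' Y' \<alpha>]
  define c' where "c' = chain_comp (hom_family Z) s (hom_chain Z c)"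
  have c': "c' \<in> homotopy_equivs R (hom_family Z) (cone (hom_family X') (hom_family Y') (hom_chain X' \<alpha>))"
    unfolding c'_def s_def
    by (rule homotopy_equivs_comp[OF TZ TK KT hom_chain_equiv[OF Z K c] hom_split_equiv[OF X' Y' \<alpha>]])
  have 1: "(chain_comp (hom_family X) (hom_chain Y b) (hom_chain X u'),
      chain_comp (hom_family X) (hom_chain X' \<alpha>) (hom_chain X a))
      \<in> homotopy_rel R (hom_family X) (hom_family Y')"
    using hom_chain_rel[OF X Y' sq1]
    unfolding hom_chain_comp[OF X Y Y' cu cb] hom_chain_comp[OF X X' Y' ca \<alpha>] .
  have Tv: "hom_chain Y v' \<in> chain_maps R (hom_family Y) (hom_family Z)" by (rule hom_chain_maps[OF Y Z cv])
  have "(chain_comp (hom_family Y) (hom_chain Z c) (hom_chain Y v'),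
      chain_comp (hom_family Y) (hom_chain Y' (cone_incl X' Y')) (hom_chain Y b))
      \<in> homotopy_rel R (hom_family Y) (hom_family (cone X' Y' \<alpha>))"
    using hom_chain_rel[OF Y K sq2]
    unfolding hom_chain_comp[OF Y Z K cv cc] hom_chain_comp[OF Y Y' K cb inc] .
  from homotopy_rel_comp[OF TY TK KT this homotopy_rel_refl[OF TK KT s]]
  have 2: "(chain_comp (hom_family Y) c' (hom_chain Y v'),
      chain_comp (hom_family Y) (cone_incl (hom_family X') (hom_family Y')) (hom_chain Y b))
      \<in> homotopy_rel R (hom_family Y) (cone (hom_family X') (hom_family Y') (hom_chain X' \<alpha>))"
    unfolding c'_def chain_comp_assoc[OF Tv] chain_comp_assoc[OF hom_chain_maps[OF Y Y' cb]]
      hom_split_incl[OF X' Y' \<alpha>, folded s_def] .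
  have 3: "(chain_comp (hom_family Z) (shift_map (hom_chain X a)) (hom_chain Z w'),
      chain_comp (hom_family Z) (cone_proj (hom_family X') (hom_family Y')) c')
      \<in> homotopy_rel R (hom_family Z) (shift (hom_family X'))"
    using hom_chain_rel[OF Z sX' sq3]
    unfolding hom_chain_comp[OF Z sX sX' cw shift_map_maps[OF X X' ca]] hom_chain_comp[OF Z K sX' cc prj]
      hom_chain_shift hom_family_shift[OF X'] c'_def chain_comp_assoc[OF hom_chain_maps[OF Z K cc]]
      hom_split_proj[OF X' Y' \<alpha>, folded s_def] .
  note mem = hom_class_member[OF X Y u uvw(1)] hom_class_member[OF Y Z v uvw(2)] hom_class_member[OF Z sX w uvw(3)]
  note mor = hom_class_Mor[OF X Y u] hom_class_Mor[OF Y Z v] hom_class_Mor[OF Z sX w, unfolded hom_family_shift[OF X]]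
  show ?thesis
    unfolding homotopy_category_def tricat.simps mem_Collect_eq case_prod_conv
    by (intro conjI Obj' Ob mor bexI[OF _ Obj'[OF Ob'(1)]] bexI[OF _ Obj'[OF Ob'(2)]] bexI[OF _ T\<alpha>]
        bexI[OF _ hom_chain_equiv[OF X X' a]] bexI[OF _ hom_chain_equiv[OF Y Y' b]] bexI[OF _ c']
        bexI[OF _ mem(1)] bexI[OF _ mem(2)] bexI[OF _ mem(3)] 1 2 3)
qed

text \<open>
  As \<open>hom_family\<close> commutes strictly with the shift, identity morphisms can serve as the natural
  isomorphism between the two composites.
\<close>

theorem hom_triangulated_functor:
  assumes fam: "\<And>X. X \<in> Obj \<Longrightarrow> module_family S X" and Obj': "\<And>X. X \<in> Obj \<Longrightarrow> hom_family X \<in> Obj'"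
  shows "triangulated_functor (homotopy_category S Obj) (homotopy_category R Obj')
    hom_family hom_class"
proof -
  let ?A = "homotopy_category S Obj" and ?B = "homotopy_category R Obj'"
  note T = hom_family_is_family
  have comp: "hom_class X Z (Comp ?A X Y Z v u) =
      Comp ?B (hom_family X) (hom_family Y) (hom_family Z) (hom_class Y Z v) (hom_class X Y u)"
    if X: "module_family S X" and Y: "module_family S Y" and Z: "module_family S Z"
      and u: "u \<in> chain_maps S X Y // homotopy_rel S X Y" and v: "v \<in> chain_maps S Y Z // homotopy_rel S Y Z"
    for X Y Z u v
  proof -
    obtain \<alpha> where \<alpha>: "\<alpha> \<in> chain_maps S X Y" "u = homotopy_rel S X Y `` {\<alpha>}" using u by (rule homotopy_classE)
    obtain \<beta> where \<beta>: "\<beta> \<in> chain_maps S Y Z" "v = homotopy_rel S Y Z `` {\<beta>}" using v by (rule homotopy_classE)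
    show ?thesis
      unfolding \<alpha>(2) \<beta>(2) Comp_class[OF X Y Z \<alpha>(1) \<beta>(1)] hom_class[OF X Y \<alpha>(1)] hom_class[OF Y Z \<beta>(1)]
        hom_class[OF X Z chain_comp_maps[OF X \<alpha>(1) \<beta>(1)]] hom_chain_comp[OF X Y Z \<alpha>(1) \<beta>(1)]
        Comp_class[OF T[OF X] T[OF Y] T[OF Z] hom_chain_maps[OF X Y \<alpha>(1)] hom_chain_maps[OF Y Z \<beta>(1)]] ..
  qed
  have plus: "hom_class X Y (Plus ?A X Y u v) = Plus ?B (hom_family X) (hom_family Y) (hom_class X Y u) (hom_class X Y v)"
    if X: "module_family S X" and Y: "module_family S Y"
      and u: "u \<in> chain_maps S X Y // homotopy_rel S X Y" and v: "v \<in> chain_maps S X Y // homotopy_rel S X Y"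
    for X Y u v
  proof -
    obtain \<alpha> where \<alpha>: "\<alpha> \<in> chain_maps S X Y" "u = homotopy_rel S X Y `` {\<alpha>}" using u by (rule homotopy_classE)
    obtain \<beta> where \<beta>: "\<beta> \<in> chain_maps S X Y" "v = homotopy_rel S X Y `` {\<beta>}" using v by (rule homotopy_classE)
    show ?thesis
      unfolding \<alpha>(2) \<beta>(2) Plus_class[OF X Y \<alpha>(1) \<beta>(1)] hom_class[OF X Y \<alpha>(1)] hom_class[OF X Y \<beta>(1)]
        hom_class[OF X Y chain_add_maps[OF X Y \<alpha>(1) \<beta>(1)]] hom_chain_add[OF X Y \<alpha>(1) \<beta>(1)]
        Plus_class[OF T[OF X] T[OF Y] hom_chain_maps[OF X Y \<alpha>(1)] hom_chain_maps[OF X Y \<beta>(1)]] ..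
  qed
  have shift: "hom_class (shift X) (shift Y) (ShiftMor ?A X Y u) =
      ShiftMor ?B (hom_family X) (hom_family Y) (hom_class X Y u)"
    "ShiftMor ?A X Y u \<in> chain_maps S (shift X) (shift Y) // homotopy_rel S (shift X) (shift Y)"
    if X: "module_family S X" and Y: "module_family S Y"
      and u: "u \<in> chain_maps S X Y // homotopy_rel S X Y" for X Y u
  proof -
    obtain \<alpha> where \<alpha>: "\<alpha> \<in> chain_maps S X Y" "u = homotopy_rel S X Y `` {\<alpha>}" using u by (rule homotopy_classE)
    note sX = shift_family[OF X] and sY = shift_family[OF Y]
    show "hom_class (shift X) (shift Y) (ShiftMor ?A X Y u) =
        ShiftMor ?B (hom_family X) (hom_family Y) (hom_class X Y u)"
      unfolding \<alpha>(2) ShiftMor_class[OF X Y \<alpha>(1)] hom_class[OF X Y \<alpha>(1)]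
        hom_class[OF sX sY shift_map_maps[OF X Y \<alpha>(1)]] hom_chain_shift
        ShiftMor_class[OF T[OF X] T[OF Y] hom_chain_maps[OF X Y \<alpha>(1)]]
        hom_family_shift[OF X] hom_family_shift[OF Y] ..
    show "ShiftMor ?A X Y u \<in> chain_maps S (shift X) (shift Y) // homotopy_rel S (shift X) (shift Y)"
      unfolding \<alpha>(2) ShiftMor_class[OF X Y \<alpha>(1)] by (rule quotientI[OF shift_map_maps[OF X Y \<alpha>(1)]])
  qed
  have "is_functor ?A ?B hom_family hom_class"
    unfolding is_functor_def homotopy_category_simps
    by (intro conjI ballI) (simp_all add: Obj' fam hom_class_Mor comp hom_class chain_id_maps hom_chain_id)
  moreover have "\<forall>X\<in>Obj. \<forall>Y\<in>Obj. \<forall>u\<in>chain_maps S X Y // homotopy_rel S X Y. \<forall>v\<in>chain_maps S X Y // homotopy_rel S X Y.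
      hom_class X Y (Plus ?A X Y u v) = Plus ?B (hom_family X) (hom_family Y) (hom_class X Y u) (hom_class X Y v)"
    using fam plus by blast
  moreover have "\<exists>\<eta>.
       (\<forall>X\<in>Obj. \<eta> X \<in> isos ?B (hom_family (shift X)) (shift (hom_family X))) \<and>
       (\<forall>X\<in>Obj. \<forall>Y\<in>Obj. \<forall>u\<in>chain_maps S X Y // homotopy_rel S X Y.
          Comp ?B (hom_family (shift X)) (hom_family (shift Y)) (shift (hom_family Y))
            (\<eta> Y) (hom_class (shift X) (shift Y) (ShiftMor ?A X Y u)) =
          Comp ?B (hom_family (shift X)) (shift (hom_family X)) (shift (hom_family Y))
            (ShiftMor ?B (hom_family X) (hom_family Y) (hom_class X Y u)) (\<eta> X)) \<and>
       (\<forall>X Y Z u v w. (X, Y, Z, u, v, w) \<in> Triangles ?A \<longrightarrow>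
          (hom_family X, hom_family Y, hom_family Z, hom_class X Y u, hom_class Y Z v,
           Comp ?B (hom_family Z) (hom_family (shift X)) (shift (hom_family X)) (\<eta> X) (hom_class Z (shift X) w))
          \<in> Triangles ?B)"
  proof (intro exI[of _ "\<lambda>X. homotopy_rel R (shift (hom_family X)) (shift (hom_family X)) `` {chain_id (shift (hom_family X))}"]
      conjI ballI allI impI)
    fix X assume "X \<in> Obj"
    note X = fam[OF this]
    show "homotopy_rel R (shift (hom_family X)) (shift (hom_family X)) `` {chain_id (shift (hom_family X))}
        \<in> isos ?B (hom_family (shift X)) (shift (hom_family X))"
      unfolding hom_family_shift[OF X] by (rule Ident_iso[OF shift_family[OF T[OF X]]])
  next
    fix X Y u assume "X \<in> Obj" "Y \<in> Obj" and u: "u \<in> chain_maps S X Y // homotopy_rel S X Y"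
    note X = fam[OF \<open>X \<in> Obj\<close>] and Y = fam[OF \<open>Y \<in> Obj\<close>]
    note sX = shift_family[OF T[OF X]] and sY = shift_family[OF T[OF Y]]
    have mor: "ShiftMor ?B (hom_family X) (hom_family Y) (hom_class X Y u) \<in>
        chain_maps R (shift (hom_family X)) (shift (hom_family Y)) //
        homotopy_rel R (shift (hom_family X)) (shift (hom_family Y))"
      using hom_class_Mor[OF shift_family[OF X] shift_family[OF Y] shift(2)[OF X Y u]]
      unfolding shift(1)[OF X Y u] hom_family_shift[OF X] hom_family_shift[OF Y] .
    show "Comp ?B (hom_family (shift X)) (hom_family (shift Y)) (shift (hom_family Y))
        (homotopy_rel R (shift (hom_family Y)) (shift (hom_family Y)) `` {chain_id (shift (hom_family Y))})
        (hom_class (shift X) (shift Y) (ShiftMor ?A X Y u)) =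
      Comp ?B (hom_family (shift X)) (shift (hom_family X)) (shift (hom_family Y))
        (ShiftMor ?B (hom_family X) (hom_family Y) (hom_class X Y u))
        (homotopy_rel R (shift (hom_family X)) (shift (hom_family X)) `` {chain_id (shift (hom_family X))})"
      unfolding shift(1)[OF X Y u] hom_family_shift[OF X] hom_family_shift[OF Y]
        Comp_Ident_left[OF sX sY mor] Comp_Ident_right[OF sX sY mor] ..
  next
    fix X Y Z u v w assume tri: "(X, Y, Z, u, v, w) \<in> Triangles ?A"
    then have "X \<in> Obj" "Z \<in> Obj" and w: "w \<in> chain_maps S Z (shift X) // homotopy_rel S Z (shift X)"
      by (auto simp: homotopy_category_def)
    note X = fam[OF \<open>X \<in> Obj\<close>] and Z = fam[OF \<open>Z \<in> Obj\<close>]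
    have "Comp ?B (hom_family Z) (hom_family (shift X)) (shift (hom_family X))
        (homotopy_rel R (shift (hom_family X)) (shift (hom_family X)) `` {chain_id (shift (hom_family X))})
        (hom_class Z (shift X) w) = hom_class Z (shift X) w"
      using Comp_Ident_left[OF T[OF Z] shift_family[OF T[OF X]]]
        hom_class_Mor[OF Z shift_family[OF X] w, unfolded hom_family_shift[OF X]]
      unfolding hom_family_shift[OF X] by blast
    then show "(hom_family X, hom_family Y, hom_family Z, hom_class X Y u, hom_class Y Z v,
        Comp ?B (hom_family Z) (hom_family (shift X)) (shift (hom_family X))
          (homotopy_rel R (shift (hom_family X)) (shift (hom_family X)) `` {chain_id (shift (hom_family X))})
          (hom_class Z (shift X) w)) \<in> Triangles ?B"
      using hom_triangle[OF fam Obj' tri] by simp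
  qed
  ultimately show ?thesis
    unfolding triangulated_functor_def homotopy_category_simps by blast
qed

end

section \<open>Fullness\<close>

text \<open>
  A homotopy between complexes that are unbounded in both directions has no first component; it is
  constructed from degree \<open>0\<close> upwards and downwards.
\<close>

lemma int_dependent_choice:
  fixes P :: "int \<Rightarrow> 'a \<Rightarrow> bool"
  assumes base: "P 0 x0"
    and up: "\<And>i x. P i x \<Longrightarrow> \<exists>y. P (i + 1) y \<and> Q i x y"
    and down: "\<And>i y. P (i + 1) y \<Longrightarrow> \<exists>x. P i x \<and> Q i x y"
  shows "\<exists>s. \<forall>i. P i (s i) \<and> Q i (s i) (s (i + 1))"
proof -
  have "\<exists>F. \<forall>n. (P (int n) (F n) \<and> (n = 0 \<longrightarrow> F n = x0)) \<and> Q (int n) (F n) (F (Suc n))"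
  proof (rule dependent_nat_choice)
    show "\<exists>x. P (int 0) x \<and> (0 = (0::nat) \<longrightarrow> x = x0)" using base by auto
    fix x n assume "P (int n) x \<and> (n = 0 \<longrightarrow> x = x0)"
    then show "\<exists>y. (P (int (Suc n)) y \<and> (Suc n = 0 \<longrightarrow> y = x0)) \<and> Q (int n) x y"
      using up[of "int n" x] by (simp add: add.commute)
  qed
  then obtain F where F: "\<And>n. P (int n) (F n)" "F 0 = x0" "\<And>n. Q (int n) (F n) (F (Suc n))" by blast
  have minus_Suc: "- int (Suc n) = - int n - 1" for n by simp
  have "\<exists>G. \<forall>n. (P (- int n) (G n) \<and> (n = 0 \<longrightarrow> G n = x0)) \<and> Q (- int n - 1) (G (Suc n)) (G n)"
  proof (rule dependent_nat_choice)
    show "\<exists>x. P (- int 0) x \<and> (0 = (0::nat) \<longrightarrow> x = x0)" using base by auto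
    fix x n assume "P (- int n) x \<and> (n = 0 \<longrightarrow> x = x0)"
    then show "\<exists>y. (P (- int (Suc n)) y \<and> (Suc n = 0 \<longrightarrow> y = x0)) \<and> Q (- int n - 1) y x"
      unfolding minus_Suc using down[of "- int n - 1" x] by auto
  qed
  then obtain G where G: "\<And>n. P (- int n) (G n)" "G 0 = x0" "\<And>n. Q (- int n - 1) (G (Suc n)) (G n)" by blast
  define s where "s i = (if i \<ge> 0 then F (nat i) else G (nat (- i)))" for i
  have "P i (s i)" for i
    using F(1)[of "nat i"] G(1)[of "nat (- i)"] by (cases "i \<ge> 0") (simp_all add: s_def)
  moreover have "Q i (s i) (s (i + 1))" for i
  proof (cases "i \<ge> 0")
    case True
    then show ?thesis using F(3)[of "nat i"] by (simp add: s_def nat_add_distrib)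
  next
    case False
    define n where "n = nat (- i - 1)"
    have n: "i = - int n - 1" using False by (simp add: n_def)
    have "s (i + 1) = G n" using F(2) G(2) by (cases n) (simp_all add: s_def n nat_add_distrib)
    moreover have "s i = G (Suc n)" by (simp add: s_def n nat_add_distrib)
    ultimately show ?thesis using G(3)[of n] n by simp
  qed
  ultimately show ?thesis by blast
qed

context principal_quotient
begin

text \<open>
  The typical situation is \<open>A = X\<^sub>i\<close>, \<open>A' = X\<^sub>i\<^sub>+\<^sub>1\<close>, \<open>B = Y\<^sub>i\<close>, \<open>B' = Y\<^sub>i\<^sub>+\<^sub>1\<close> for factorizations \<open>X\<close>
  and \<open>Y\<close>, where by periodicity the differentials out of \<open>X\<^sub>i\<close> and into it connect the same two
  modules.  The maps \<open>p\<close> and \<open>q\<close> are the part of a homotopy from \<open>g\<close> to \<open>a\<close> that concerns degree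
  \<open>i\<close>, the map \<open>u\<close> measures the failure of \<open>a\<close> to be a chain map, and \<open>q\<close>, \<open>r = p + u\<close> is the part
  in degree \<open>i + 1\<close>.  The claim holds after composition with \<open>dB'\<close>, by
  \<open>dB' a' = a dA' + f u = g dA' + dB' q dA' + p dA dA' + f u = dB' (g' + q dA' + dB r)\<close>, and \<open>dB'\<close>
  can be cancelled: \<open>dB dB' = f\<close>, and all elements of \<open>A'\<close> are multiples of \<open>f\<close>.
\<close>

lemma factor_step_up:
  assumes mods: "module S A" "module S A'" "module S B" "module S B'" and div: "divisible_module A' f"
    and dA: "dA \<in> linear_maps S A A'" and dA': "dA' \<in> linear_maps S A' A"
    and dB: "dB \<in> linear_maps S B B'" and dB': "dB' \<in> linear_maps S B' B"
    and fA': "\<And>x. x \<in> carrier A' \<Longrightarrow> dA (dA' x) = f \<odot>\<^bsub>A'\<^esub> x"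
    and fB': "\<And>x. x \<in> carrier B' \<Longrightarrow> dB (dB' x) = f \<odot>\<^bsub>B'\<^esub> x"
    and a: "a \<in> linear_maps S A B" and a': "a' \<in> linear_maps S A' B'"
    and g: "g \<in> linear_maps S A B" and g': "g' \<in> linear_maps S A' B'"
    and p: "p \<in> linear_maps S A' B" and q: "q \<in> linear_maps S A B'"
    and u: "u \<in> linear_maps S A' B" and r: "r \<in> linear_maps S A' B"
    and aa: "\<And>x. x \<in> carrier A' \<Longrightarrow> dB' (a' x) = a (dA' x) \<oplus>\<^bsub>B\<^esub> f \<odot>\<^bsub>B\<^esub> u x"
    and gg: "\<And>x. x \<in> carrier A' \<Longrightarrow> dB' (g' x) = g (dA' x)"
    and ag: "\<And>x. x \<in> carrier A \<Longrightarrow> a x = g x \<oplus>\<^bsub>B\<^esub> (dB' (q x) \<oplus>\<^bsub>B\<^esub> p (dA x))"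
    and rpu: "\<And>x. x \<in> carrier A' \<Longrightarrow> r x = p x \<oplus>\<^bsub>B\<^esub> u x"
    and x: "x \<in> carrier A'"
  shows "a' x = g' x \<oplus>\<^bsub>B'\<^esub> (dB (r x) \<oplus>\<^bsub>B'\<^esub> q (dA' x))"
proof -
  interpret B: module S B by fact
  interpret B': module S B' by fact
  interpret A: module S A by fact
  obtain y where y: "y \<in> carrier A'" "x = f \<odot>\<^bsub>A'\<^esub> y"
    using div x unfolding divisible_module_def by metis
  note cl = linear_maps_closed[OF dA' y(1)] linear_maps_closed[OF a' y(1)] linear_maps_closed[OF g' y(1)]
    linear_maps_closed[OF p y(1)] linear_maps_closed[OF u y(1)] linear_maps_closed[OF r y(1)]
  note cl2 = linear_maps_closed[OF g cl(1)] linear_maps_closed[OF q cl(1)] linear_maps_closed[OF dB' cl(3)]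
    linear_maps_closed[OF dB cl(6)]
  note cl3 = linear_maps_closed[OF dB' cl2(2)]
  have "dB' (a' y) = g (dA' y) \<oplus>\<^bsub>B\<^esub> (dB' (q (dA' y)) \<oplus>\<^bsub>B\<^esub> f \<odot>\<^bsub>B\<^esub> p y) \<oplus>\<^bsub>B\<^esub> f \<odot>\<^bsub>B\<^esub> u y"
    using y(1) cl f_closed by (simp add: aa ag fA' linear_maps_smult[OF p])
  also have "\<dots> = dB' (g' y) \<oplus>\<^bsub>B\<^esub> (dB' (q (dA' y)) \<oplus>\<^bsub>B\<^esub> f \<odot>\<^bsub>B\<^esub> r y)"
    using y(1) cl cl2 cl3 f_closed by (simp add: gg rpu B.smult_r_distr B.M.a_ac)
  finally have eq: "dB' (a' y) = dB' (g' y) \<oplus>\<^bsub>B\<^esub> (dB' (q (dA' y)) \<oplus>\<^bsub>B\<^esub> f \<odot>\<^bsub>B\<^esub> r y)" .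
  have "a' x = dB (dB' (a' y))"
    using y cl f_closed by (simp add: fB' linear_maps_smult[OF a'])
  also have "\<dots> = f \<odot>\<^bsub>B'\<^esub> g' y \<oplus>\<^bsub>B'\<^esub> (f \<odot>\<^bsub>B'\<^esub> q (dA' y) \<oplus>\<^bsub>B'\<^esub> f \<odot>\<^bsub>B'\<^esub> dB (r y))"
    unfolding eq using cl cl2 cl3 f_closed
    by (simp add: linear_maps_add[OF dB] fB' linear_maps_smult[OF dB])
  also have "\<dots> = g' x \<oplus>\<^bsub>B'\<^esub> (dB (r x) \<oplus>\<^bsub>B'\<^esub> q (dA' x))"
    using y cl cl2 f_closed
    by (simp add: linear_maps_smult[OF g'] linear_maps_smult[OF r] linear_maps_smult[OF dA']
        linear_maps_smult[OF q] linear_maps_smult[OF dB] B'.M.a_comm)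
  finally show ?thesis .
qed

text \<open>
  The step in the other direction, from degree \<open>i + 1\<close> to degree \<open>i\<close>, with \<open>r = q - u\<close>.  Here the
  equation results from composition with \<open>dA'\<close> on the right, which is onto \<open>A\<close> because
  \<open>dA' dA = f\<close> is.
\<close>

lemma factor_step_down:
  assumes mods: "module S A" "module S A'" "module S B" "module S B'" and div: "divisible_module A f"
    and dA: "dA \<in> linear_maps S A A'" and dA': "dA' \<in> linear_maps S A' A"
    and dB: "dB \<in> linear_maps S B B'" and dB': "dB' \<in> linear_maps S B' B"
    and fA: "\<And>x. x \<in> carrier A \<Longrightarrow> dA' (dA x) = f \<odot>\<^bsub>A\<^esub> x"
    and fA': "\<And>x. x \<in> carrier A' \<Longrightarrow> dA (dA' x) = f \<odot>\<^bsub>A'\<^esub> x"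
    and fB: "\<And>x. x \<in> carrier B \<Longrightarrow> dB' (dB x) = f \<odot>\<^bsub>B\<^esub> x"
    and a: "a \<in> linear_maps S A B" and a': "a' \<in> linear_maps S A' B'"
    and g: "g \<in> linear_maps S A B" and g': "g' \<in> linear_maps S A' B'"
    and p: "p \<in> linear_maps S A B'" and q: "q \<in> linear_maps S A' B"
    and u: "u \<in> linear_maps S A' B" and r: "r \<in> linear_maps S A' B"
    and aa: "\<And>x. x \<in> carrier A' \<Longrightarrow> dB' (a' x) = a (dA' x) \<oplus>\<^bsub>B\<^esub> f \<odot>\<^bsub>B\<^esub> u x"
    and gg: "\<And>x. x \<in> carrier A' \<Longrightarrow> dB' (g' x) = g (dA' x)"
    and ag: "\<And>x. x \<in> carrier A' \<Longrightarrow> a' x = g' x \<oplus>\<^bsub>B'\<^esub> (dB (q x) \<oplus>\<^bsub>B'\<^esub> p (dA' x))"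
    and rqu: "\<And>x. x \<in> carrier A' \<Longrightarrow> q x = r x \<oplus>\<^bsub>B\<^esub> u x"
    and x: "x \<in> carrier A"
  shows "a x = g x \<oplus>\<^bsub>B\<^esub> (dB' (p x) \<oplus>\<^bsub>B\<^esub> r (dA x))"
proof -
  interpret B: module S B by fact
  interpret B': module S B' by fact
  interpret A: module S A by fact
  obtain w where w: "w \<in> carrier A" "x = f \<odot>\<^bsub>A\<^esub> w"
    using div x unfolding divisible_module_def by metis
  define y where "y = dA w"
  have y: "y \<in> carrier A'" "dA' y = x" using w linear_maps_closed[OF dA w(1)] by (simp_all add: y_def fA)
  note cl = linear_maps_closed[OF g' y(1)] linear_maps_closed[OF q y(1)] linear_maps_closed[OF u y(1)]
    linear_maps_closed[OF r y(1)] linear_maps_closed[OF p x] linear_maps_closed[OF a x] linear_maps_closed[OF g x]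
  note cl2 = linear_maps_closed[OF dB cl(2)] linear_maps_closed[OF dB' cl(5)]
  have ry: "f \<odot>\<^bsub>B\<^esub> r y = r (dA x)"
    using y f_closed fA'[OF y(1)] by (simp add: linear_maps_smult[OF r, symmetric])
  have rx: "r (dA x) \<in> carrier B" by (intro linear_maps_closed[OF r] linear_maps_closed[OF dA] x)
  have "a x \<oplus>\<^bsub>B\<^esub> f \<odot>\<^bsub>B\<^esub> u y = dB' (a' y)" using aa[OF y(1)] y by simp
  also have "\<dots> = g x \<oplus>\<^bsub>B\<^esub> (f \<odot>\<^bsub>B\<^esub> q y \<oplus>\<^bsub>B\<^esub> dB' (p x))"
    using y cl cl2 gg[OF y(1)] by (simp add: ag linear_maps_add[OF dB'] fB)
  also have "\<dots> = (g x \<oplus>\<^bsub>B\<^esub> (dB' (p x) \<oplus>\<^bsub>B\<^esub> r (dA x))) \<oplus>\<^bsub>B\<^esub> f \<odot>\<^bsub>B\<^esub> u y"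
    using y cl cl2 f_closed rx by (simp add: rqu B.smult_r_distr ry B.M.a_ac)
  finally show ?thesis
    using cl cl2 rx f_closed by (subst (asm) B.M.add.right_cancel) auto
qed

end

definition unroll :: "('i::comm_ring_1, 's, 'm) family \<Rightarrow> (int, 's, 'm) family"
  where "unroll X = \<lparr>cmp = (\<lambda>i. cmp X (of_int i)), dif = (\<lambda>i. dif X (of_int i))\<rparr>"

lemma unroll_simps: "cmp (unroll X) i = cmp X (of_int i)" "dif (unroll X) i = dif X (of_int i)"
  by (simp_all add: unroll_def)

lemma unroll_family: "module_family S X \<Longrightarrow> module_family S (unroll X)"
  by (auto simp: module_family_def unroll_def)

lemma (in principal_quotient) hom_family_unroll: "hom_family (unroll X) = hom_family X"
  by (simp add: hom_family_def unroll_def)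

text \<open>
  This is what makes unrolled factorizations 2-periodic.
\<close>

lemma bit_succ_pred: "j + 1 = j - 1" for j :: bit
  by (cases j) auto

text \<open>
  In each degree this reduces exactness of the complex of maps to factoring a map that is killed
  by the differential through the differential.
\<close>

lemma acyclic_hom_complex_fromI:
  assumes T: "module_family R T" and W: "module R W"
    and dd: "\<And>i h. h \<in> carrier (cmp T (i + 1)) \<Longrightarrow> dif T i (dif T (i + 1) h) = \<zero>\<^bsub>cmp T (i - 1)\<^esub>"
    and exact: "\<And>i \<Phi>. \<Phi> \<in> linear_maps R W (cmp T i) \<Longrightarrow>
      (\<And>w. w \<in> carrier W \<Longrightarrow> dif T i (\<Phi> w) = \<zero>\<^bsub>cmp T (i - 1)\<^esub>) \<Longrightarrow>
      \<exists>\<Psi>\<in>linear_maps R W (cmp T (i + 1)). \<Phi> = compose (carrier W) (dif T (i + 1)) \<Psi>"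
  shows "acyclic_complex (hom_complex_from R W T)"
  unfolding acyclic_complex_def
proof (intro allI equalityI subsetI)
  fix i \<Phi> assume "\<Phi> \<in> a_kernel (cmp (hom_complex_from R W T) i) (cmp (hom_complex_from R W T) (i - 1))
      (dif (hom_complex_from R W T) i)"
  then have \<Phi>: "\<Phi> \<in> linear_maps R W (cmp T i)"
    and eq: "compose (carrier W) (dif T i) \<Phi> = (\<lambda>w\<in>carrier W. \<zero>\<^bsub>cmp T (i - 1)\<^esub>)"
    by (auto simp: a_kernel_def kernel_def hom_complex_from_def hom_module_def)
  have "dif T i (\<Phi> w) = \<zero>\<^bsub>cmp T (i - 1)\<^esub>" if "w \<in> carrier W" for w
    using fun_cong[OF eq, of w] that by (simp add: compose_def)
  from exact[OF \<Phi> this]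
  show "\<Phi> \<in> dif (hom_complex_from R W T) (i + 1) ` carrier (cmp (hom_complex_from R W T) (i + 1))"
    by (auto simp: hom_complex_from_def hom_module_def)
next
  fix i \<Phi> assume "\<Phi> \<in> dif (hom_complex_from R W T) (i + 1) ` carrier (cmp (hom_complex_from R W T) (i + 1))"
  then obtain \<Psi> where \<Psi>: "\<Psi> \<in> linear_maps R W (cmp T (i + 1))" "\<Phi> = compose (carrier W) (dif T (i + 1)) \<Psi>"
    by (auto simp: hom_complex_from_def hom_module_def)
  have \<Phi>: "\<Phi> \<in> linear_maps R W (cmp T i)"
    unfolding \<Psi>(2) by (rule linear_maps_comp[OF \<Psi>(1) dif_Suc[OF T] W])
  have "compose (carrier W) (dif T i) \<Phi> = (\<lambda>w\<in>carrier W. \<zero>\<^bsub>cmp T (i - 1)\<^esub>)"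
    unfolding \<Psi>(2) using dd[OF linear_maps_closed[OF \<Psi>(1)]]
    by (auto simp: compose_def restrict_def fun_eq_iff)
  then show "\<Phi> \<in> a_kernel (cmp (hom_complex_from R W T) i) (cmp (hom_complex_from R W T) (i - 1))
      (dif (hom_complex_from R W T) i)"
    using \<Phi> by (auto simp: a_kernel_def kernel_def hom_complex_from_def hom_module_def)
qed

text \<open>
  The degree \<open>i\<close> of \<open>exact\<close> is that of \<open>T\<close>, which is the negative of the degree in
  \<open>hom_complex_into\<close>.
\<close>

lemma acyclic_hom_complex_intoI:
  assumes T: "module_family R T" and W: "module R W"
    and dd: "\<And>i h. h \<in> carrier (cmp T (i + 1)) \<Longrightarrow> dif T i (dif T (i + 1) h) = \<zero>\<^bsub>cmp T (i - 1)\<^esub>"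
    and exact: "\<And>i \<Phi>. \<Phi> \<in> linear_maps R (cmp T i) W \<Longrightarrow>
      (\<And>h. h \<in> carrier (cmp T (i + 1)) \<Longrightarrow> \<Phi> (dif T (i + 1) h) = \<zero>\<^bsub>W\<^esub>) \<Longrightarrow>
      \<exists>\<Psi>\<in>linear_maps R (cmp T (i - 1)) W. \<Phi> = compose (carrier (cmp T i)) \<Psi> (dif T i)"
  shows "acyclic_complex (hom_complex_into R T W)"
  unfolding acyclic_complex_def
proof (intro allI equalityI subsetI)
  fix i \<Phi> assume "\<Phi> \<in> a_kernel (cmp (hom_complex_into R T W) i) (cmp (hom_complex_into R T W) (i - 1))
      (dif (hom_complex_into R T W) i)"
  then have \<Phi>: "\<Phi> \<in> linear_maps R (cmp T (- i)) W"
    and eq: "compose (carrier (cmp T (- i + 1))) \<Phi> (dif T (- i + 1)) =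
      (\<lambda>h\<in>carrier (cmp T (- (i - 1))). \<zero>\<^bsub>W\<^esub>)"
    by (auto simp: a_kernel_def kernel_def hom_complex_into_def hom_module_def)
  have "\<Phi> (dif T (- i + 1) h) = \<zero>\<^bsub>W\<^esub>" if "h \<in> carrier (cmp T (- i + 1))" for h
  proof -
    have "- i + 1 = - (i - 1)" by simp
    then have "h \<in> carrier (cmp T (- (i - 1)))" using that by (simp only:)
    then show ?thesis using fun_cong[OF eq, of h] that by (simp only: compose_def restrict_apply if_True)
  qed
  from exact[OF \<Phi> this] obtain \<Psi> where \<Psi>: "\<Psi> \<in> linear_maps R (cmp T (- i - 1)) W"
    "\<Phi> = compose (carrier (cmp T (- i))) \<Psi> (dif T (- i))" by blast
  then show "\<Phi> \<in> dif (hom_complex_into R T W) (i + 1) ` carrier (cmp (hom_complex_into R T W) (i + 1))"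
    by (intro image_eqI[of _ _ \<Psi>]) (auto simp: hom_complex_into_def hom_module_def)
next
  fix i \<Phi> assume "\<Phi> \<in> dif (hom_complex_into R T W) (i + 1) ` carrier (cmp (hom_complex_into R T W) (i + 1))"
  then obtain \<Psi> where \<Psi>: "\<Psi> \<in> linear_maps R (cmp T (- i - 1)) W"
    "\<Phi> = compose (carrier (cmp T (- i))) \<Psi> (dif T (- i))"
    by (auto simp: hom_complex_into_def hom_module_def)
  have \<Phi>: "\<Phi> \<in> linear_maps R (cmp T (- i)) W"
    unfolding \<Psi>(2) by (rule linear_maps_comp[OF module_familyD(2)[OF T] \<Psi>(1) module_familyD(1)[OF T]])
  have "compose (carrier (cmp T (- i + 1))) \<Phi> (dif T (- i + 1)) h = \<zero>\<^bsub>W\<^esub>"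
    if h: "h \<in> carrier (cmp T (- i + 1))" for h
    using h dd[OF h] linear_maps_closed[OF dif_Suc[OF T] h] linear_maps_zero[OF \<Psi>(1) module_familyD(1)[OF T] W] unfolding \<Psi>(2) by (simp add: compose_def)
  then have "compose (carrier (cmp T (- i + 1))) \<Phi> (dif T (- i + 1)) = (\<lambda>h\<in>carrier (cmp T (- i + 1)). \<zero>\<^bsub>W\<^esub>)"
    by (auto simp: fun_eq_iff compose_def restrict_def)
  then show "\<Phi> \<in> a_kernel (cmp (hom_complex_into R T W) i) (cmp (hom_complex_into R T W) (i - 1))
      (dif (hom_complex_into R T W) i)"
    using \<Phi> by (simp add: a_kernel_def kernel_def hom_complex_into_def hom_module_def)
qed

locale factorization_category = principal_quotient S f for S :: "('s, 'e) ring_scheme" and f +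
  fixes C :: "('s, 'm) module set"
  assumes C_module: "M \<in> C \<Longrightarrow> module S M"
    and C_divisible: "M \<in> C \<Longrightarrow> divisible_module M f"
    and C_Ext: "M \<in> C \<Longrightarrow> N \<in> C \<Longrightarrow> trivial_group (Ext S 1 M N)"
begin

lemma factorizationD:
  assumes "X \<in> factorizations S C f"
  shows "module_family S X" "cmp X j \<in> C"
    "x \<in> carrier (cmp X j) \<Longrightarrow> dif X (j - 1) (dif X j x) = f \<odot>\<^bsub>cmp X j\<^esub> x"
  using assms C_module by (auto simp: factorizations_def module_family_def)

lemma unroll_period:
  fixes X :: "(bit, 's, 'm) family"
  shows "cmp (unroll X) (i + 1) = cmp (unroll X) (i - 1)" "dif (unroll X) (i + 1) = dif (unroll X) (i - 1)"
  using bit_succ_pred[of "of_int i"] by (simp_all only: unroll_simps of_int_add of_int_diff of_int_1)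

lemma unroll_d:
  assumes X: "X \<in> factorizations S C f"
  shows "dif (unroll X) i \<in> linear_maps S (cmp (unroll X) i) (cmp (unroll X) (i + 1))"
    and "dif (unroll X) (i + 1) \<in> linear_maps S (cmp (unroll X) (i + 1)) (cmp (unroll X) i)"
    and "x \<in> carrier (cmp (unroll X) i) \<Longrightarrow>
      dif (unroll X) (i + 1) (dif (unroll X) i x) = f \<odot>\<^bsub>cmp (unroll X) i\<^esub> x"
    and "x \<in> carrier (cmp (unroll X) (i + 1)) \<Longrightarrow>
      dif (unroll X) i (dif (unroll X) (i + 1) x) = f \<odot>\<^bsub>cmp (unroll X) (i + 1)\<^esub> x"
proof -
  note U = unroll_family[OF factorizationD(1)[OF X]]
  show "dif (unroll X) i \<in> linear_maps S (cmp (unroll X) i) (cmp (unroll X) (i + 1))"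
    using module_familyD(2)[OF U, of i] by (simp only: unroll_period)
  show "dif (unroll X) (i + 1) \<in> linear_maps S (cmp (unroll X) (i + 1)) (cmp (unroll X) i)"
    by (rule dif_Suc[OF U])
  have dd: "dif (unroll X) (k - 1) (dif (unroll X) k x) = f \<odot>\<^bsub>cmp (unroll X) k\<^esub> x"
    if "x \<in> carrier (cmp (unroll X) k)" for x k
    using that factorizationD(3)[OF X, of x "of_int k"] by (simp only: unroll_simps of_int_diff of_int_1)
  show "dif (unroll X) (i + 1) (dif (unroll X) i x) = f \<odot>\<^bsub>cmp (unroll X) i\<^esub> x"
    if "x \<in> carrier (cmp (unroll X) i)" using dd[OF that] by (simp only: unroll_period)
  show "dif (unroll X) i (dif (unroll X) (i + 1) x) = f \<odot>\<^bsub>cmp (unroll X) (i + 1)\<^esub> x"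
    if "x \<in> carrier (cmp (unroll X) (i + 1))" using dd[OF that] by simp
qed

lemma hom_lift:
  assumes "M \<in> C" "N \<in> C" "\<Phi> \<in> linear_maps R (HomR M) (HomR N)"
  obtains g where "g \<in> linear_maps S M N" "hom_map M g = \<Phi>"
  using hom_map_full[OF C_module C_module C_divisible C_Ext assms(3)] assms by metis

text \<open>
  Each \<open>\<phi>\<^sub>i\<close> lifts to a map \<open>a\<^sub>i\<close> over \<open>S\<close>.  Both \<open>d a\<^sub>i\<close> and \<open>a\<^sub>i\<^sub>-\<^sub>1 d\<close> lift the same map over \<open>R\<close>,
  so they differ by a multiple \<open>f u\<^sub>i\<close>.
\<close>

lemma chain_map_lifts:
  assumes X: "X \<in> factorizations S C f" and Y: "Y \<in> factorizations S C f"
    and \<phi>: "\<phi> \<in> chain_maps R (hom_family X) (hom_family Y)"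
  obtains a u where "\<And>i. a i \<in> linear_maps S (cmp (unroll X) i) (cmp (unroll Y) i)"
    "\<And>i. hom_map (cmp (unroll X) i) (a i) = \<phi> i"
    "\<And>i. u i \<in> linear_maps S (cmp (unroll X) i) (cmp (unroll Y) (i - 1))"
    "\<And>i x. x \<in> carrier (cmp (unroll X) i) \<Longrightarrow> dif (unroll Y) i (a i x) =
      a (i - 1) (dif (unroll X) i x) \<oplus>\<^bsub>cmp (unroll Y) (i - 1)\<^esub> f \<odot>\<^bsub>cmp (unroll Y) (i - 1)\<^esub> u i x"
proof -
  define U where "U = unroll X"
  define V where "V = unroll Y"
  note fX = factorizationD[OF X] and fY = factorizationD[OF Y]
  have U: "module_family S U" "\<And>i. cmp U i \<in> C" and V: "module_family S V" "\<And>i. cmp V i \<in> C"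
    using fX(1,2) fY(1,2) by (auto simp: U_def V_def unroll_family unroll_simps)
  note mU = module_familyD(1)[OF U(1)] and mV = module_familyD(1)[OF V(1)]
  have cmp_TU: "cmp (hom_family X) i = HomR (cmp U i)"
    "cmp (hom_family Y) i = HomR (cmp V i)" for i
    by (simp_all add: hom_family_simps U_def V_def unroll_simps)
  have dif_TU: "dif (hom_family X) i = hom_map (cmp U i) (dif U i)"
    "dif (hom_family Y) i = hom_map (cmp V i) (dif V i)" for i
    by (simp_all add: hom_family_simps U_def V_def unroll_simps)
  have "\<exists>a. a \<in> linear_maps S (cmp U i) (cmp V i) \<and> hom_map (cmp U i) a = \<phi> i" for i
    using hom_lift[OF U(2) V(2)] chain_mapsD(1)[OF \<phi>, of i] by (metis cmp_TU)
  then obtain a where a: "\<And>i. a i \<in> linear_maps S (cmp U i) (cmp V i)" "\<And>i. hom_map (cmp U i) (a i) = \<phi> i"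
    by metis
  have "\<exists>u. u \<in> linear_maps S (cmp U i) (cmp V (i - 1)) \<and> (\<forall>x\<in>carrier (cmp U i).
      dif V i (a i x) = a (i - 1) (dif U i x) \<oplus>\<^bsub>cmp V (i - 1)\<^esub> f \<odot>\<^bsub>cmp V (i - 1)\<^esub> u x)" for i
  proof -
    let ?l = "compose (carrier (cmp U i)) (dif V i) (a i)" and ?r = "compose (carrier (cmp U i)) (a (i - 1)) (dif U i)"
    have l: "?l \<in> linear_maps S (cmp U i) (cmp V (i - 1))"
      by (rule linear_maps_comp[OF a(1) module_familyD(2)[OF V(1)] mU])
    have r: "?r \<in> linear_maps S (cmp U i) (cmp V (i - 1))"
      by (rule linear_maps_comp[OF module_familyD(2)[OF U(1)] a(1) mU])
    have "hom_map (cmp U i) ?l = hom_map (cmp U i) ?r"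
    proof (rule linear_maps_eqI[OF hom_map_linear[OF l mU mV] hom_map_linear[OF r mU mV]])
      fix h assume h: "h \<in> carrier (HomR (cmp U i))"
      have dh: "hom_map (cmp U i) (dif U i) h \<in> carrier (HomR (cmp U (i - 1)))"
        by (rule hom_map_closed[OF module_familyD(2)[OF U(1)] mU mU h])
      have ah: "hom_map (cmp U i) (a i) h \<in> carrier (HomR (cmp V i))"
        by (rule hom_map_closed[OF a(1) mU mV h])
      have "a (i - 1) (dif U i (h \<one>\<^bsub>R\<^esub>)) = \<phi> (i - 1) (dif (hom_family X) i h) \<one>\<^bsub>R\<^esub>"
        using h dh by (simp add: dif_TU hom_map_eval flip: a(2))
      also have "\<phi> (i - 1) (dif (hom_family X) i h) = dif (hom_family Y) i (\<phi> i h)"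
        using h by (intro chain_mapsD(2)[OF \<phi>]) (simp add: cmp_TU)
      also have "\<dots> \<one>\<^bsub>R\<^esub> = dif V i (a i (h \<one>\<^bsub>R\<^esub>))"
        using h ah by (simp add: dif_TU hom_map_eval flip: a(2))
      finally show "hom_map (cmp U i) ?l h = hom_map (cmp U i) ?r h"
        using h hom_eval_closed[OF h]
        by (intro hom_eqI[where M = "cmp V (i - 1)"] hom_map_closed[OF l mU mV h] hom_map_closed[OF r mU mV h])
          (simp add: hom_map_eval compose_def)
    qed
    from hom_map_eqD[OF mU mV C_divisible[OF U(2)] l r this]
    obtain u where "u \<in> linear_maps S (cmp U i) (cmp V (i - 1))"
      "\<And>x. x \<in> carrier (cmp U i) \<Longrightarrow> ?l x = ?r x \<oplus>\<^bsub>cmp V (i - 1)\<^esub> f \<odot>\<^bsub>cmp V (i - 1)\<^esub> u x" by metis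
    then show ?thesis by (auto simp: compose_def)
  qed
  then obtain u where u: "\<And>i. u i \<in> linear_maps S (cmp U i) (cmp V (i - 1))"
    "\<And>i x. x \<in> carrier (cmp U i) \<Longrightarrow>
      dif V i (a i x) = a (i - 1) (dif U i x) \<oplus>\<^bsub>cmp V (i - 1)\<^esub> f \<odot>\<^bsub>cmp V (i - 1)\<^esub> u i x" by metis
  from a u show thesis unfolding U_def V_def by (rule that)
qed

text \<open>
  With \<open>a\<close> and \<open>u\<close> from \<open>chain_map_lifts\<close>, put \<open>g\<^sub>0 = a\<^sub>0\<close> and \<open>g\<^sub>1 = a\<^sub>1 - d u\<^sub>1\<close>.  Then
  \<open>d g\<^sub>1 = d a\<^sub>1 - f u\<^sub>1 = g\<^sub>0 d\<close>, and \<open>g\<^sub>1 d = d g\<^sub>0\<close> follows after multiplication by \<open>f\<close>.  So \<open>g\<close> is a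
  morphism of factorizations.  It agrees with \<open>a\<close> in degree \<open>0\<close>, where a homotopy can therefore
  start with zero maps; \<open>factor_step_up\<close> and \<open>factor_step_down\<close> continue it to all degrees.
\<close>

lemma hom_chain_full:
  assumes X: "X \<in> factorizations S C f" and Y: "Y \<in> factorizations S C f"
    and \<phi>: "\<phi> \<in> chain_maps R (hom_family X) (hom_family Y)"
  shows "\<exists>g\<in>chain_maps S X Y. (hom_chain X g, \<phi>) \<in> homotopy_rel R (hom_family X) (hom_family Y)"
proof -
  define U where "U = unroll X"
  define V where "V = unroll Y"
  note fX = factorizationD[OF X] and fY = factorizationD[OF Y]
  have U: "module_family S U" "\<And>i. cmp U i \<in> C" and V: "module_family S V" "\<And>i. cmp V i \<in> C"
    using fX(1,2) fY(1,2) by (auto simp: U_def V_def unroll_family unroll_simps)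
  have TU: "hom_family U = hom_family X" and TV: "hom_family V = hom_family Y"
    by (simp_all add: U_def V_def hom_family_unroll)
  note mU = module_familyD(1)[OF U(1)] and mV = module_familyD(1)[OF V(1)]
  obtain a u where a: "\<And>i. a i \<in> linear_maps S (cmp U i) (cmp V i)" "\<And>i. hom_map (cmp U i) (a i) = \<phi> i"
    and u: "\<And>i. u i \<in> linear_maps S (cmp U i) (cmp V (i - 1))"
    "\<And>i x. x \<in> carrier (cmp U i) \<Longrightarrow>
      dif V i (a i x) = a (i - 1) (dif U i x) \<oplus>\<^bsub>cmp V (i - 1)\<^esub> f \<odot>\<^bsub>cmp V (i - 1)\<^esub> u i x"
    using chain_map_lifts[OF X Y \<phi>] unfolding U_def V_def by blast

  have X01: "dif X 0 \<in> linear_maps S (cmp X 0) (cmp X 1)" "dif X 1 \<in> linear_maps S (cmp X 1) (cmp X 0)"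
    "\<And>x. x \<in> carrier (cmp X 0) \<Longrightarrow> dif X 1 (dif X 0 x) = f \<odot>\<^bsub>cmp X 0\<^esub> x"
    and Y01: "dif Y 0 \<in> linear_maps S (cmp Y 0) (cmp Y 1)" "dif Y 1 \<in> linear_maps S (cmp Y 1) (cmp Y 0)"
    "\<And>y. y \<in> carrier (cmp Y 0) \<Longrightarrow> dif Y 1 (dif Y 0 y) = f \<odot>\<^bsub>cmp Y 0\<^esub> y"
    "\<And>y. y \<in> carrier (cmp Y 1) \<Longrightarrow> dif Y 0 (dif Y 1 y) = f \<odot>\<^bsub>cmp Y 1\<^esub> y"
    using module_familyD(2)[OF fX(1), of 0] module_familyD(2)[OF fX(1), of 1] fX(3)[of _ 0]
      module_familyD(2)[OF fY(1), of 0] module_familyD(2)[OF fY(1), of 1] fY(3)[of _ 0] fY(3)[of _ 1]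
    by simp_all
  note mX = module_familyD(1)[OF fX(1)] and mY = module_familyD(1)[OF fY(1)]
  have a01: "a 0 \<in> linear_maps S (cmp X 0) (cmp Y 0)" "a 1 \<in> linear_maps S (cmp X 1) (cmp Y 1)"
    and u1: "u 1 \<in> linear_maps S (cmp X 1) (cmp Y 0)"
    and ua: "\<And>x. x \<in> carrier (cmp X 1) \<Longrightarrow> dif Y 1 (a 1 x) = a 0 (dif X 1 x) \<oplus>\<^bsub>cmp Y 0\<^esub> f \<odot>\<^bsub>cmp Y 0\<^esub> u 1 x"
    using a(1)[of 0] a(1)[of 1] u(1)[of 1] u(2)[of _ 1] by (simp_all add: U_def V_def unroll_simps)
  define g1 where "g1 = (\<lambda>x\<in>carrier (cmp X 1). a 1 x \<ominus>\<^bsub>cmp Y 1\<^esub> compose (carrier (cmp X 1)) (dif Y 0) (u 1) x)"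
  have g1: "g1 \<in> linear_maps S (cmp X 1) (cmp Y 1)"
    unfolding g1_def by (intro linear_maps_minus_map a01 linear_maps_comp[OF u1 Y01(1)] mX mY)
  interpret Y0: module S "cmp Y 0" by (rule mY)
  interpret Y1: module S "cmp Y 1" by (rule mY)
  have g1_comm: "dif Y 1 (g1 x) = a 0 (dif X 1 x)" if x: "x \<in> carrier (cmp X 1)" for x
  proof -
    note cl = linear_maps_closed[OF a01(2) x] linear_maps_closed[OF u1 x]
      linear_maps_closed[OF a01(1) linear_maps_closed[OF X01(2) x]]
    show ?thesis
      using x cl linear_maps_closed[OF Y01(1) cl(2)] f_closed
      by (simp add: g1_def compose_def Y1.M.minus_eq linear_maps_add[OF Y01(2)] linear_maps_neg[OF Y01(2) mY mY]
          Y01(3) ua Y0.M.a_assoc Y0.M.r_neg)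
  qed
  \<comment> \<open>The equation \<open>g1_comm\<close> is applied to \<open>dif X 0 z\<close> and then composed with \<open>dif Y 0\<close>.\<close>
  have g0_comm: "g1 (dif X 0 x) = dif Y 0 (a 0 x)" if x: "x \<in> carrier (cmp X 0)" for x
  proof -
    have l: "compose (carrier (cmp X 0)) g1 (dif X 0) \<in> linear_maps S (cmp X 0) (cmp Y 1)"
      by (rule linear_maps_comp[OF X01(1) g1 mX])
    have r: "compose (carrier (cmp X 0)) (dif Y 0) (a 0) \<in> linear_maps S (cmp X 0) (cmp Y 1)"
      by (rule linear_maps_comp[OF a01(1) Y01(1) mX])
    have "f \<odot>\<^bsub>cmp Y 1\<^esub> g1 (dif X 0 z) = f \<odot>\<^bsub>cmp Y 1\<^esub> dif Y 0 (a 0 z)" if z: "z \<in> carrier (cmp X 0)" for z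
    proof -
      note cl = linear_maps_closed[OF X01(1) z] linear_maps_closed[OF a01(1) z]
      have "f \<odot>\<^bsub>cmp Y 1\<^esub> g1 (dif X 0 z) = dif Y 0 (dif Y 1 (g1 (dif X 0 z)))"
        using Y01(4)[OF linear_maps_closed[OF g1 cl(1)]] by simp
      also have "\<dots> = dif Y 0 (a 0 (f \<odot>\<^bsub>cmp X 0\<^esub> z))" using g1_comm[OF cl(1)] X01(3)[OF z] by simp
      also have "\<dots> = f \<odot>\<^bsub>cmp Y 1\<^esub> dif Y 0 (a 0 z)"
        using z cl f_closed by (simp add: linear_maps_smult[OF a01(1)] linear_maps_smult[OF Y01(1)])
      finally show ?thesis .
    qed
    then have "compose (carrier (cmp X 0)) g1 (dif X 0) x = compose (carrier (cmp X 0)) (dif Y 0) (a 0) x"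
      using x by (intro f_cancel[OF C_divisible[OF fX(2)] l r mX]) (simp_all add: compose_def)
    then show ?thesis using x by (simp add: compose_def)
  qed
  define g where "g = (\<lambda>j::bit. if j = 0 then a 0 else g1)"
  have g: "g \<in> chain_maps S X Y"
    unfolding chain_maps_def
  proof (intro CollectI allI)
    fix j :: bit
    show "g j \<in> linear_maps S (cmp X j) (cmp Y j) \<and>
        (\<forall>x\<in>carrier (cmp X j). g (j - 1) (dif X j x) = dif Y j (g j x))"
      using a01(1) g1 g1_comm g0_comm by (cases j) (simp_all add: g_def)
  qed
  define G where "G = (\<lambda>i::int. g (of_int i))"
  have G: "G \<in> chain_maps S U V"
    using chain_mapsD[OF g] unfolding chain_maps_def by (auto simp: G_def U_def V_def unroll_simps)

  \<comment> \<open>The state in degree \<open>i\<close> consists of the components of the homotopy in degrees \<open>i - 1\<close> and \<open>i\<close>; by periodicity the source of the former is written as \<open>cmp U (i + 1)\<close>.\<close>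
  define P where "P = (\<lambda>i (p, q).
    p \<in> linear_maps S (cmp U (i + 1)) (cmp V i) \<and> q \<in> linear_maps S (cmp U i) (cmp V (i + 1)) \<and>
    (\<forall>x\<in>carrier (cmp U i). a i x = G i x \<oplus>\<^bsub>cmp V i\<^esub> (dif V (i + 1) (q x) \<oplus>\<^bsub>cmp V i\<^esub> p (dif U i x))))"
  have per: "cmp U (i + 1 + 1) = cmp U i" "cmp V (i + 1 + 1) = cmp V i" "dif V (i + 1 + 1) = dif V i" for i
    using unroll_period[of X "i + 1"] unroll_period[of Y "i + 1"] by (simp_all add: U_def V_def)
  have dU: "dif U i \<in> linear_maps S (cmp U i) (cmp U (i + 1))"
    "dif U (i + 1) \<in> linear_maps S (cmp U (i + 1)) (cmp U i)"
    "x \<in> carrier (cmp U i) \<Longrightarrow> dif U (i + 1) (dif U i x) = f \<odot>\<^bsub>cmp U i\<^esub> x"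
    "x \<in> carrier (cmp U (i + 1)) \<Longrightarrow> dif U i (dif U (i + 1) x) = f \<odot>\<^bsub>cmp U (i + 1)\<^esub> x"
    and dV: "dif V i \<in> linear_maps S (cmp V i) (cmp V (i + 1))"
    "dif V (i + 1) \<in> linear_maps S (cmp V (i + 1)) (cmp V i)"
    "y \<in> carrier (cmp V i) \<Longrightarrow> dif V (i + 1) (dif V i y) = f \<odot>\<^bsub>cmp V i\<^esub> y"
    "y \<in> carrier (cmp V (i + 1)) \<Longrightarrow> dif V i (dif V (i + 1) y) = f \<odot>\<^bsub>cmp V (i + 1)\<^esub> y" for i x y
    by (simp_all add: U_def V_def unroll_d[OF X] unroll_d[OF Y])
  have uS: "u (i + 1) \<in> linear_maps S (cmp U (i + 1)) (cmp V i)"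
    "x \<in> carrier (cmp U (i + 1)) \<Longrightarrow>
      dif V (i + 1) (a (i + 1) x) = a i (dif U (i + 1) x) \<oplus>\<^bsub>cmp V i\<^esub> f \<odot>\<^bsub>cmp V i\<^esub> u (i + 1) x" for i x
    using u(1)[of "i + 1"] u(2)[of x "i + 1"] by simp_all
  have GS: "x \<in> carrier (cmp U (i + 1)) \<Longrightarrow> dif V (i + 1) (G (i + 1) x) = G i (dif U (i + 1) x)" for i x
    using chain_mapsD(2)[OF G, of x "i + 1"] by simp
  have "\<exists>s. \<forall>i. P i (s i) \<and> snd (s i) = fst (s (i + 1))"
  proof (rule int_dependent_choice)
    let ?z = "\<lambda>x\<in>carrier (cmp U 1). \<zero>\<^bsub>cmp V 0\<^esub>" and ?z' = "\<lambda>x\<in>carrier (cmp U 0). \<zero>\<^bsub>cmp V 1\<^esub>"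
    interpret V0: module S "cmp V 0" by (rule mV)
    have "a 0 x = G 0 x" for x by (simp add: G_def g_def)
    then show "P 0 (?z, ?z')"
      using linear_maps_zero_map[OF mU mV] linear_maps_zero[OF dV(2)[of 0] mV mV] linear_maps_closed[OF a(1)[of 0]]
        linear_maps_closed[OF dU(1)[of 0]]
      by (simp add: P_def)
  next
    fix i s assume "P i s"
    then obtain p q where pq: "s = (p, q)" "p \<in> linear_maps S (cmp U (i + 1)) (cmp V i)"
      "q \<in> linear_maps S (cmp U i) (cmp V (i + 1))"
      "\<And>x. x \<in> carrier (cmp U i) \<Longrightarrow> a i x = G i x \<oplus>\<^bsub>cmp V i\<^esub> (dif V (i + 1) (q x) \<oplus>\<^bsub>cmp V i\<^esub> p (dif U i x))"
      by (auto simp: P_def)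
    define r where "r = (\<lambda>x\<in>carrier (cmp U (i + 1)). p x \<oplus>\<^bsub>cmp V i\<^esub> u (i + 1) x)"
    have r: "r \<in> linear_maps S (cmp U (i + 1)) (cmp V i)"
      unfolding r_def by (intro linear_maps_add_map pq uS(1) mU mV)
    have "a (i + 1) x = G (i + 1) x \<oplus>\<^bsub>cmp V (i + 1)\<^esub> (dif V i (r x) \<oplus>\<^bsub>cmp V (i + 1)\<^esub> q (dif U (i + 1) x))"
      if x: "x \<in> carrier (cmp U (i + 1))" for x
      by (rule factor_step_up[OF mU[of i] mU[of "i + 1"] mV[of i] mV[of "i + 1"] C_divisible[OF U(2)] dU(1,2) dV(1,2)
            dU(4) dV(4) a(1)[of i] a(1)[of "i + 1"] chain_mapsD(1)[OF G, of i] chain_mapsD(1)[OF G, of "i + 1"]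
            pq(2,3) uS(1) r uS(2) GS pq(4) _ x])
        (simp_all add: r_def)
    then have "P (i + 1) (q, r)" unfolding P_def case_prod_conv per using r pq(3) by blast
    then show "\<exists>y. P (i + 1) y \<and> snd s = fst y" using pq(1) by auto
  next
    fix i s assume "P (i + 1) s"
    moreover obtain p q where "s = (p, q)" by (cases s)
    ultimately have pq: "s = (p, q)" "p \<in> linear_maps S (cmp U i) (cmp V (i + 1))"
      "q \<in> linear_maps S (cmp U (i + 1)) (cmp V i)"
      "\<And>x. x \<in> carrier (cmp U (i + 1)) \<Longrightarrow> a (i + 1) x = G (i + 1) x \<oplus>\<^bsub>cmp V (i + 1)\<^esub>
        (dif V i (q x) \<oplus>\<^bsub>cmp V (i + 1)\<^esub> p (dif U (i + 1) x))"
      by (simp_all only: P_def case_prod_conv per)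
    define r where "r = (\<lambda>x\<in>carrier (cmp U (i + 1)). q x \<ominus>\<^bsub>cmp V i\<^esub> u (i + 1) x)"
    have r: "r \<in> linear_maps S (cmp U (i + 1)) (cmp V i)"
      unfolding r_def by (intro linear_maps_minus_map pq uS(1) mU mV)
    interpret Vi: module S "cmp V i" by (rule mV)
    have qr: "q x = r x \<oplus>\<^bsub>cmp V i\<^esub> u (i + 1) x" if "x \<in> carrier (cmp U (i + 1))" for x
      using that linear_maps_closed[OF pq(3) that] linear_maps_closed[OF uS(1) that]
      by (simp add: r_def Vi.M.minus_eq Vi.M.a_assoc Vi.M.l_neg)
    have "a i x = G i x \<oplus>\<^bsub>cmp V i\<^esub> (dif V (i + 1) (p x) \<oplus>\<^bsub>cmp V i\<^esub> r (dif U i x))"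
      if x: "x \<in> carrier (cmp U i)" for x
      by (rule factor_step_down[OF mU[of i] mU[of "i + 1"] mV[of i] mV[of "i + 1"] C_divisible[OF U(2)] dU(1,2) dV(1,2)
            dU(3,4) dV(3) a(1)[of i] a(1)[of "i + 1"] chain_mapsD(1)[OF G, of i] chain_mapsD(1)[OF G, of "i + 1"]
            pq(2,3) uS(1) r uS(2) GS pq(4) qr x])
    then have "P i (r, p)" using r pq(2) by (simp add: P_def)
    then show "\<exists>x. P i x \<and> snd x = fst s" using pq(1) by auto
  qed
  then obtain s where s: "\<And>i. P i (s i)" "\<And>i. snd (s i) = fst (s (i + 1))" by metis
  have "homotopy S U V a G (\<lambda>i. snd (s i))"
    unfolding homotopy_def
  proof (intro allI)
    fix i
    have "snd (s (i - 1)) = fst (s i)" using s(2)[of "i - 1"] by simp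
    then show "snd (s i) \<in> linear_maps S (cmp U i) (cmp V (i + 1)) \<and>
      (\<forall>x\<in>carrier (cmp U i). a i x = G i x \<oplus>\<^bsub>cmp V i\<^esub>
        (dif V (i + 1) (snd (s i) x) \<oplus>\<^bsub>cmp V i\<^esub> snd (s (i - 1)) (dif U i x)))"
      using s(1)[of i] by (simp add: P_def case_prod_beta)
  qed
  from hom_homotopy[OF U(1) V(1) this a(1) chain_mapsD(1)[OF G]]
  have "homotopy R (hom_family X) (hom_family Y) (hom_chain U a) (hom_chain U G)
      (\<lambda>i. hom_map (cmp U (of_int i)) (snd (s (of_int i))))" by (simp only: TU TV)
  moreover have "hom_chain U a = \<phi>" using a(2) by (simp add: hom_chain_def)
  moreover have "hom_chain U G = hom_chain X g" by (simp add: hom_chain_def G_def U_def unroll_simps)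
  ultimately have "homotopy R (hom_family X) (hom_family Y) \<phi> (hom_chain X g)
      (\<lambda>i. hom_map (cmp U (of_int i)) (snd (s (of_int i))))" by simp
  note TX = hom_family_is_family[OF fX(1)] and TY = hom_family_is_family[OF fY(1)]
  have "(\<phi>, hom_chain X g) \<in> homotopy_rel R (hom_family X) (hom_family Y)"
    by (rule homotopy_relI[OF TX TY \<phi> hom_chain_maps[OF fX(1) fY(1) g]]) fact
  from homotopy_rel_sym[OF TX TY this] g show ?thesis by blast
qed

section \<open>Faithfulness\<close>

text \<open>
  Let \<open>k\<close> and \<open>l\<close> lift the components of the given homotopy in degrees \<open>0\<close> and \<open>-1\<close>.  Then
  \<open>\<alpha>\<^sub>0 = \<beta>\<^sub>0 + d k + l d + f v\<close> for some \<open>v\<close>, and \<open>f v = d d v\<close> is absorbed by replacing \<open>k\<close> by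
  \<open>q = k + d v\<close>.  So \<open>q\<close> and \<open>l\<close> form a homotopy of factorizations in degree \<open>0\<close>.  In degree \<open>1\<close>
  they do so by \<open>factor_step_up\<close>, with \<open>u = 0\<close> since \<open>\<alpha>\<close> and \<open>\<beta>\<close> commute with the differentials.
\<close>

lemma hom_chain_faithful:
  assumes X: "X \<in> factorizations S C f" and Y: "Y \<in> factorizations S C f"
    and \<alpha>: "\<alpha> \<in> chain_maps S X Y" and \<beta>: "\<beta> \<in> chain_maps S X Y"
    and rel: "(hom_chain X \<alpha>, hom_chain X \<beta>) \<in> homotopy_rel R (hom_family X) (hom_family Y)"
  shows "(\<alpha>, \<beta>) \<in> homotopy_rel S X Y"
proof -
  note fX = factorizationD[OF X] and fY = factorizationD[OF Y]
  note mX = module_familyD(1)[OF fX(1)] and mY = module_familyD(1)[OF fY(1)]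
  note TX = hom_family_is_family[OF fX(1)] and TY = hom_family_is_family[OF fY(1)]
  obtain h where h: "homotopy R (hom_family X) (hom_family Y) (hom_chain X \<alpha>) (hom_chain X \<beta>) h"
    using homotopy_relE[OF rel TX TY] by metis
  have X01: "dif X 0 \<in> linear_maps S (cmp X 0) (cmp X 1)" "dif X 1 \<in> linear_maps S (cmp X 1) (cmp X 0)"
    "\<And>x. x \<in> carrier (cmp X 0) \<Longrightarrow> dif X 1 (dif X 0 x) = f \<odot>\<^bsub>cmp X 0\<^esub> x"
    "\<And>x. x \<in> carrier (cmp X 1) \<Longrightarrow> dif X 0 (dif X 1 x) = f \<odot>\<^bsub>cmp X 1\<^esub> x"
    and Y01: "dif Y 0 \<in> linear_maps S (cmp Y 0) (cmp Y 1)" "dif Y 1 \<in> linear_maps S (cmp Y 1) (cmp Y 0)"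
    "\<And>y. y \<in> carrier (cmp Y 0) \<Longrightarrow> dif Y 1 (dif Y 0 y) = f \<odot>\<^bsub>cmp Y 0\<^esub> y"
    "\<And>y. y \<in> carrier (cmp Y 1) \<Longrightarrow> dif Y 0 (dif Y 1 y) = f \<odot>\<^bsub>cmp Y 1\<^esub> y"
    using module_familyD(2)[OF fX(1), of 0] module_familyD(2)[OF fX(1), of 1] fX(3)[of _ 0] fX(3)[of _ 1]
      module_familyD(2)[OF fY(1), of 0] module_familyD(2)[OF fY(1), of 1] fY(3)[of _ 0] fY(3)[of _ 1]
    by simp_all
  note ab = chain_mapsD(1)[OF \<alpha>] chain_mapsD(1)[OF \<beta>]
  have "h 0 \<in> linear_maps R (HomR (cmp X 0)) (HomR (cmp Y 1))"
    using homotopyD(1)[OF h, of 0] by (simp add: hom_family_simps)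
  then obtain k where k: "k \<in> linear_maps S (cmp X 0) (cmp Y 1)" "hom_map (cmp X 0) k = h 0"
    using hom_lift[OF fX(2) fY(2)] by metis
  have "h (- 1) \<in> linear_maps R (HomR (cmp X 1)) (HomR (cmp Y 0))"
    using homotopyD(1)[OF h, of "- 1"] by (simp add: hom_family_simps)
  then obtain l where l: "l \<in> linear_maps S (cmp X 1) (cmp Y 0)" "hom_map (cmp X 1) l = h (- 1)"
    using hom_lift[OF fX(2) fY(2)] by metis
  interpret Y0: module S "cmp Y 0" by (rule mY)
  interpret Y1: module S "cmp Y 1" by (rule mY)
  let ?dk = "compose (carrier (cmp X 0)) (dif Y 1) k" and ?ld = "compose (carrier (cmp X 0)) l (dif X 0)"
  have dk: "?dk \<in> linear_maps S (cmp X 0) (cmp Y 0)" by (rule linear_maps_comp[OF k(1) Y01(2) mX])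
  have ld: "?ld \<in> linear_maps S (cmp X 0) (cmp Y 0)" by (rule linear_maps_comp[OF X01(1) l(1) mX])
  define s where "s = (\<lambda>x\<in>carrier (cmp X 0). ?dk x \<oplus>\<^bsub>cmp Y 0\<^esub> ?ld x)"
  have s: "s \<in> linear_maps S (cmp X 0) (cmp Y 0)" unfolding s_def by (rule linear_maps_add_map[OF dk ld mX mY])
  define b where "b = (\<lambda>x\<in>carrier (cmp X 0). \<beta> 0 x \<oplus>\<^bsub>cmp Y 0\<^esub> s x)"
  have b: "b \<in> linear_maps S (cmp X 0) (cmp Y 0)" unfolding b_def by (rule linear_maps_add_map[OF ab(2) s mX mY])
  have "hom_map (cmp X 0) (\<alpha> 0) = hom_map (cmp X 0) b"
  proof (rule linear_maps_eqI[OF hom_map_linear[OF ab(1) mX mY] hom_map_linear[OF b mX mY]])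
    fix t assume t: "t \<in> carrier (HomR (cmp X 0))"
    have kt: "hom_map (cmp X 0) k t \<in> carrier (HomR (cmp Y 1))"
      by (rule hom_map_closed[OF k(1) mX mY t])
    have dt: "hom_map (cmp X 0) (dif X 0) t \<in> carrier (HomR (cmp X 1))"
      by (rule hom_map_closed[OF X01(1) mX mX t])
    have "t \<in> carrier (cmp (hom_family X) 0)" using t by (simp add: hom_family_simps)
    from homotopyD(3)[OF h this]
    have "hom_map (cmp X 0) (\<alpha> 0) t = hom_map (cmp X 0) (\<beta> 0) t \<oplus>\<^bsub>HomR (cmp Y 0)\<^esub>
        (hom_map (cmp Y 1) (dif Y 1) (hom_map (cmp X 0) k t) \<oplus>\<^bsub>HomR (cmp Y 0)\<^esub>
         hom_map (cmp X 1) l (hom_map (cmp X 0) (dif X 0) t))"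
      by (simp add: hom_family_simps hom_chain_def k(2) l(2))
    then have "hom_map (cmp X 0) (\<alpha> 0) t \<one>\<^bsub>R\<^esub> = hom_map (cmp X 0) b t \<one>\<^bsub>R\<^esub>"
      using t kt dt hom_eval_closed[OF t]
      by (simp add: hom_add_eval hom_map_eval b_def s_def compose_def)
    then show "hom_map (cmp X 0) (\<alpha> 0) t = hom_map (cmp X 0) b t"
      by (rule hom_eqI[OF hom_map_closed[OF ab(1) mX mY t] hom_map_closed[OF b mX mY t]])
  qed
  from hom_map_eqD[OF mX mY C_divisible[OF fX(2)] ab(1) b this]
  obtain v where v: "v \<in> linear_maps S (cmp X 0) (cmp Y 0)"
    "\<And>x. x \<in> carrier (cmp X 0) \<Longrightarrow> \<alpha> 0 x = b x \<oplus>\<^bsub>cmp Y 0\<^esub> f \<odot>\<^bsub>cmp Y 0\<^esub> v x" by metis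
  let ?dv = "compose (carrier (cmp X 0)) (dif Y 0) v"
  have dv: "?dv \<in> linear_maps S (cmp X 0) (cmp Y 1)" by (rule linear_maps_comp[OF v(1) Y01(1) mX])
  define q where "q = (\<lambda>x\<in>carrier (cmp X 0). k x \<oplus>\<^bsub>cmp Y 1\<^esub> ?dv x)"
  have q: "q \<in> linear_maps S (cmp X 0) (cmp Y 1)" unfolding q_def by (rule linear_maps_add_map[OF k(1) dv mX mY])
  have 0: "\<alpha> 0 x = \<beta> 0 x \<oplus>\<^bsub>cmp Y 0\<^esub> (dif Y 1 (q x) \<oplus>\<^bsub>cmp Y 0\<^esub> l (dif X 0 x))" if x: "x \<in> carrier (cmp X 0)" for x
  proof -
    note cl = linear_maps_closed[OF k(1) x] linear_maps_closed[OF v(1) x] linear_maps_closed[OF ab(2) x]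
      linear_maps_closed[OF l(1) linear_maps_closed[OF X01(1) x]]
    note cl2 = linear_maps_closed[OF Y01(1) cl(2)] linear_maps_closed[OF Y01(2) cl(1)]
    show ?thesis
      using x cl cl2 f_closed
      by (simp add: v(2) b_def s_def q_def compose_def linear_maps_add[OF Y01(2)] Y01(3) Y0.M.a_ac)
  qed
  let ?z = "\<lambda>x\<in>carrier (cmp X 1). \<zero>\<^bsub>cmp Y 0\<^esub>"
  have z: "?z \<in> linear_maps S (cmp X 1) (cmp Y 0)" by (rule linear_maps_zero_map[OF mX mY])
  have comm: "dif Y 1 (\<alpha> 1 x) = \<alpha> 0 (dif X 1 x)" "dif Y 1 (\<beta> 1 x) = \<beta> 0 (dif X 1 x)"
    if "x \<in> carrier (cmp X 1)" for x
    using chain_mapsD(2)[OF \<alpha> that] chain_mapsD(2)[OF \<beta> that] by simp_all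
  have 1: "\<alpha> 1 x = \<beta> 1 x \<oplus>\<^bsub>cmp Y 1\<^esub> (dif Y 0 (l x) \<oplus>\<^bsub>cmp Y 1\<^esub> q (dif X 1 x))" if x: "x \<in> carrier (cmp X 1)" for x
  proof (rule factor_step_up[OF mX[of 0] mX[of 1] mY[of 0] mY[of 1] C_divisible[OF fX(2)] X01(1,2) Y01(1,2)
        X01(4) Y01(4) ab(1)[of 0] ab(1)[of 1] ab(2)[of 0] ab(2)[of 1] l(1) q z l(1) _ comm(2) 0 _ x])
    fix x assume x: "x \<in> carrier (cmp X 1)"
    show "dif Y 1 (\<alpha> 1 x) = \<alpha> 0 (dif X 1 x) \<oplus>\<^bsub>cmp Y 0\<^esub> f \<odot>\<^bsub>cmp Y 0\<^esub> ?z x"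
      using x comm(1)[OF x] linear_maps_closed[OF ab(1) linear_maps_closed[OF X01(2) x]] f_closed by simp
    show "l x = l x \<oplus>\<^bsub>cmp Y 0\<^esub> ?z x" using x linear_maps_closed[OF l(1) x] by simp
  qed
  have "homotopy S X Y \<alpha> \<beta> (\<lambda>j::bit. if j = 0 then q else l)"
    unfolding homotopy_def
  proof
    fix j :: bit
    show "(if j = 0 then q else l) \<in> linear_maps S (cmp X j) (cmp Y (j + 1)) \<and>
      (\<forall>x\<in>carrier (cmp X j). \<alpha> j x = \<beta> j x \<oplus>\<^bsub>cmp Y j\<^esub>
        (dif Y (j + 1) ((if j = 0 then q else l) x) \<oplus>\<^bsub>cmp Y j\<^esub> (if j - 1 = 0 then q else l) (dif X j x)))"
      using q l(1) 0 1 by (cases j) simp_all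
  qed
  then show ?thesis by (rule homotopy_relI[OF fX(1) fY(1) \<alpha> \<beta>])
qed

section \<open>Total acyclicity\<close>

text \<open>
  A lift \<open>g\<close> of \<open>\<Phi>\<close> satisfies \<open>d g = f u\<close>, so \<open>f g = e d g = f e u\<close>, and cancelling \<open>f\<close> gives
  \<open>g = e u\<close>.
\<close>

lemma factor_from:
  assumes M: "M \<in> C" "M' \<in> C" "N \<in> C"
    and d: "d \<in> linear_maps S M M'" and e: "e \<in> linear_maps S M' M"
    and ed: "\<And>x. x \<in> carrier M \<Longrightarrow> e (d x) = f \<odot>\<^bsub>M\<^esub> x"
    and \<Phi>: "\<Phi> \<in> linear_maps R (HomR N) (HomR M)"
    and zero: "\<And>h. h \<in> carrier (HomR N) \<Longrightarrow> hom_map M d (\<Phi> h) = \<zero>\<^bsub>HomR M'\<^esub>"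
  shows "\<exists>\<Psi>\<in>linear_maps R (HomR N) (HomR M').
    \<forall>h\<in>carrier (HomR N). \<Phi> h = hom_map M' e (\<Psi> h)"
proof -
  note mM = C_module[OF M(1)] and mM' = C_module[OF M(2)] and mN = C_module[OF M(3)]
  interpret M': module S M' by (rule mM')
  obtain g where g: "g \<in> linear_maps S N M" "hom_map N g = \<Phi>" using hom_lift[OF M(3,1) \<Phi>] .
  have dg: "compose (carrier N) d g \<in> linear_maps S N M'" by (rule linear_maps_comp[OF g(1) d mN])
  have z: "(\<lambda>x\<in>carrier N. \<zero>\<^bsub>M'\<^esub>) \<in> linear_maps S N M'" by (rule linear_maps_zero_map[OF mN mM'])
  have "hom_map N (compose (carrier N) d g) = hom_map N (\<lambda>x\<in>carrier N. \<zero>\<^bsub>M'\<^esub>)"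
  proof (rule linear_maps_eqI[OF hom_map_linear[OF dg mN mM'] hom_map_linear[OF z mN mM']])
    fix h assume h: "h \<in> carrier (HomR N)"
    have "d (g (h \<one>\<^bsub>R\<^esub>)) = hom_map M d (\<Phi> h) \<one>\<^bsub>R\<^esub>"
      using h hom_map_closed[OF g(1) mN mM h] by (simp add: hom_map_eval flip: g(2))
    then have "d (g (h \<one>\<^bsub>R\<^esub>)) = \<zero>\<^bsub>M'\<^esub>" using zero[OF h] by (simp add: hom_zero_eval)
    then show "hom_map N (compose (carrier N) d g) h = hom_map N (\<lambda>x\<in>carrier N. \<zero>\<^bsub>M'\<^esub>) h"
      using h hom_eval_closed[OF h]
      by (intro hom_eqI[where M = M'] hom_map_closed[OF dg mN mM' h] hom_map_closed[OF z mN mM' h])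
        (simp add: hom_map_eval compose_def)
  qed
  from hom_map_eqD[OF mN mM' C_divisible[OF M(3)] dg z this]
  obtain u where u: "u \<in> linear_maps S N M'"
    "\<And>x. x \<in> carrier N \<Longrightarrow> compose (carrier N) d g x = (\<lambda>x\<in>carrier N. \<zero>\<^bsub>M'\<^esub>) x \<oplus>\<^bsub>M'\<^esub> f \<odot>\<^bsub>M'\<^esub> u x" by metis
  have eu: "compose (carrier N) e u \<in> linear_maps S N M" by (rule linear_maps_comp[OF u(1) e mN])
  have "f \<odot>\<^bsub>M\<^esub> g x = f \<odot>\<^bsub>M\<^esub> compose (carrier N) e u x" if x: "x \<in> carrier N" for x
  proof -
    have "d (g x) = f \<odot>\<^bsub>M'\<^esub> u x"
      using u(2)[OF x] x linear_maps_closed[OF u(1) x] f_closed by (simp add: compose_def)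
    then show ?thesis
      using x ed[OF linear_maps_closed[OF g(1) x]] f_closed linear_maps_closed[OF u(1) x]
      by (simp add: compose_def linear_maps_smult[OF e])
  qed
  then have geu: "g x = e (u x)" if "x \<in> carrier N" for x
    using f_cancel[OF C_divisible[OF M(3)] g(1) eu mN _ that] that by (simp add: compose_def)
  have "\<Phi> h = hom_map M' e (hom_map N u h)" if h: "h \<in> carrier (HomR N)" for h
    unfolding g(2)[symmetric]
    using h hom_map_closed[OF u(1) mN mM' h] geu[OF hom_eval_closed[OF h]]
    by (intro hom_eqI[where M = M] hom_map_closed[OF g(1) mN mM h] hom_map_closed[OF e mM' mM]) (auto simp: hom_map_eval)
  then show ?thesis using hom_map_linear[OF u(1) mN mM'] by blast
qed

text \<open>
  A lift \<open>g\<close> of \<open>\<Phi>\<close> satisfies \<open>g e = f u\<close>, so \<open>f g = g e d = f u d\<close>, and cancelling \<open>f\<close> gives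
  \<open>g = u d\<close>.
\<close>

lemma factor_into:
  assumes M: "M \<in> C" "M' \<in> C" "N \<in> C"
    and d: "d \<in> linear_maps S M M'" and e: "e \<in> linear_maps S M' M"
    and ed: "\<And>x. x \<in> carrier M \<Longrightarrow> e (d x) = f \<odot>\<^bsub>M\<^esub> x"
    and \<Phi>: "\<Phi> \<in> linear_maps R (HomR M) (HomR N)"
    and zero: "\<And>h. h \<in> carrier (HomR M') \<Longrightarrow> \<Phi> (hom_map M' e h) = \<zero>\<^bsub>HomR N\<^esub>"
  shows "\<exists>\<Psi>\<in>linear_maps R (HomR M') (HomR N).
    \<forall>h\<in>carrier (HomR M). \<Phi> h = \<Psi> (hom_map M d h)"
proof -
  note mM = C_module[OF M(1)] and mM' = C_module[OF M(2)] and mN = C_module[OF M(3)]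
  interpret N: module S N by (rule mN)
  obtain g where g: "g \<in> linear_maps S M N" "hom_map M g = \<Phi>" using hom_lift[OF M(1,3) \<Phi>] .
  have ge: "compose (carrier M') g e \<in> linear_maps S M' N" by (rule linear_maps_comp[OF e g(1) mM'])
  have z: "(\<lambda>x\<in>carrier M'. \<zero>\<^bsub>N\<^esub>) \<in> linear_maps S M' N" by (rule linear_maps_zero_map[OF mM' mN])
  have "hom_map M' (compose (carrier M') g e) = hom_map M' (\<lambda>x\<in>carrier M'. \<zero>\<^bsub>N\<^esub>)"
  proof (rule linear_maps_eqI[OF hom_map_linear[OF ge mM' mN] hom_map_linear[OF z mM' mN]])
    fix h assume h: "h \<in> carrier (HomR M')"
    have "g (e (h \<one>\<^bsub>R\<^esub>)) = \<Phi> (hom_map M' e h) \<one>\<^bsub>R\<^esub>"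
      using h hom_map_closed[OF e mM' mM h] by (simp add: hom_map_eval flip: g(2))
    then have "g (e (h \<one>\<^bsub>R\<^esub>)) = \<zero>\<^bsub>N\<^esub>" using zero[OF h] by (simp add: hom_zero_eval)
    then show "hom_map M' (compose (carrier M') g e) h = hom_map M' (\<lambda>x\<in>carrier M'. \<zero>\<^bsub>N\<^esub>) h"
      using h hom_eval_closed[OF h]
      by (intro hom_eqI[where M = N] hom_map_closed[OF ge mM' mN h] hom_map_closed[OF z mM' mN h])
        (simp add: hom_map_eval compose_def)
  qed
  from hom_map_eqD[OF mM' mN C_divisible[OF M(2)] ge z this]
  obtain u where u: "u \<in> linear_maps S M' N"
    "\<And>x. x \<in> carrier M' \<Longrightarrow> compose (carrier M') g e x = (\<lambda>x\<in>carrier M'. \<zero>\<^bsub>N\<^esub>) x \<oplus>\<^bsub>N\<^esub> f \<odot>\<^bsub>N\<^esub> u x" by metis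
  have ud: "compose (carrier M) u d \<in> linear_maps S M N" by (rule linear_maps_comp[OF d u(1) mM])
  have "f \<odot>\<^bsub>N\<^esub> g x = f \<odot>\<^bsub>N\<^esub> compose (carrier M) u d x" if x: "x \<in> carrier M" for x
  proof -
    have dx: "d x \<in> carrier M'" by (rule linear_maps_closed[OF d x])
    have "g (e (d x)) = f \<odot>\<^bsub>N\<^esub> u (d x)"
      using u(2)[OF dx] dx linear_maps_closed[OF u(1) dx] f_closed by (simp add: compose_def)
    then show ?thesis
      using x f_closed by (simp add: compose_def ed linear_maps_smult[OF g(1)])
  qed
  then have gud: "g x = u (d x)" if "x \<in> carrier M" for x
    using f_cancel[OF C_divisible[OF M(1)] g(1) ud mM _ that] that by (simp add: compose_def)
  have "\<Phi> h = hom_map M' u (hom_map M d h)" if h: "h \<in> carrier (HomR M)" for h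
    unfolding g(2)[symmetric]
    using h hom_map_closed[OF d mM mM' h] gud[OF hom_eval_closed[OF h]]
    by (intro hom_eqI[where M = N] hom_map_closed[OF g(1) mM mN h] hom_map_closed[OF u(1) mM' mN]) (auto simp: hom_map_eval)
  then show ?thesis using hom_map_linear[OF u(1) mM' mN] by blast
qed

text \<open>
  Let \<open>x\<close> be the value of \<open>h\<close> at \<open>1\<close> and write \<open>x = f y = e (d y)\<close>.  The element \<open>d y\<close> is killed by
  \<open>f\<close>, because \<open>f d y = d x = 0\<close>.
\<close>

lemma torsion_exact:
  assumes M: "M \<in> C" "M' \<in> C"
    and d: "d \<in> linear_maps S M M'" and e: "e \<in> linear_maps S M' M"
    and ed: "\<And>x. x \<in> carrier M \<Longrightarrow> e (d x) = f \<odot>\<^bsub>M\<^esub> x"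
    and h: "h \<in> carrier (HomR M)" "hom_map M d h = \<zero>\<^bsub>HomR M'\<^esub>"
  shows "\<exists>h'\<in>carrier (HomR M'). h = hom_map M' e h'"
proof -
  note mM = C_module[OF M(1)] and mM' = C_module[OF M(2)]
  obtain y where y: "y \<in> carrier M" "f \<odot>\<^bsub>M\<^esub> y = h \<one>\<^bsub>R\<^esub>"
    using C_divisible[OF M(1)] hom_eval_closed[OF h(1)] unfolding divisible_module_def by metis
  have dy: "d y \<in> carrier M'" by (rule linear_maps_closed[OF d y(1)])
  have "f \<odot>\<^bsub>M'\<^esub> d y = d (h \<one>\<^bsub>R\<^esub>)"
    using linear_maps_smult[OF d f_closed y(1)] y(2) by simp
  also have "\<dots> = \<zero>\<^bsub>M'\<^esub>" using hom_map_eval[OF h(1), of d] h(2) by (simp add: hom_zero_eval)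
  finally have dy0: "f \<odot>\<^bsub>M'\<^esub> d y = \<zero>\<^bsub>M'\<^esub>" .
  note at = hom_at[OF mM' dy dy0]
  have "h = hom_map M' e (hom_at M' (d y))"
    using at y ed[OF y(1)]
    by (intro hom_eqI[where M = M] h(1) hom_map_closed[OF e mM' mM]) (auto simp: hom_map_eval)
  then show ?thesis using at(1) by blast
qed

lemma hom_family_d_d:
  assumes X: "X \<in> factorizations S C f" and h: "h \<in> carrier (cmp (hom_family X) i)"
  shows "dif (hom_family X) (i - 1) (dif (hom_family X) i h) = \<zero>\<^bsub>cmp (hom_family X) (i - 1 - 1)\<^esub>"
proof -
  note fX = factorizationD[OF X]
  note T = module_familyD[OF hom_family_is_family[OF fX(1)]]
  have dh: "dif (hom_family X) i h \<in> carrier (cmp (hom_family X) (i - 1))" by (rule linear_maps_closed[OF T(2) h])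
  have ddh: "dif (hom_family X) (i - 1) (dif (hom_family X) i h) \<in> carrier (cmp (hom_family X) (i - 1 - 1))"
    by (rule linear_maps_closed[OF T(2) dh])
  interpret T: module R "cmp (hom_family X) (i - 1 - 1)" by (rule T(1))
  have h': "h \<in> carrier (HomR (cmp X (of_int i)))" using h by (simp only: hom_family_simps)
  have "of_int (i - 1 - 1) = (of_int i :: bit)"
    using bit_succ_pred[of "of_int i - 1"] by (simp only: of_int_diff of_int_1) simp
  then have per: "cmp X (of_int (i - 1 - 1)) = cmp X (of_int i)" by (rule arg_cong)
  have "dif (hom_family X) (i - 1) (dif (hom_family X) i h) \<one>\<^bsub>R\<^esub> =
      dif X (of_int i - 1) (dif X (of_int i) (h \<one>\<^bsub>R\<^esub>))"
    using h' dh unfolding hom_family_simps by (simp only: hom_map_eval of_int_diff of_int_1)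
  also have "\<dots> = \<zero>\<^bsub>cmp X (of_int (i - 1 - 1))\<^esub>"
    unfolding fX(3)[OF hom_eval_closed[OF h']] hom_eval_torsion[OF module_familyD(1)[OF fX(1)] h'] per ..
  also have "\<dots> = \<zero>\<^bsub>cmp (hom_family X) (i - 1 - 1)\<^esub> \<one>\<^bsub>R\<^esub>" unfolding hom_family_simps hom_zero_eval ..
  finally show ?thesis
    using ddh T.M.zero_closed unfolding hom_family_simps by (intro hom_eqI) 
qed

text \<open>
  An object \<open>W\<close> of the category is isomorphic to \<open>Hom\<^sub>S(R, M)\<close> for some \<open>M\<close> in \<open>C\<close>, by \<open>\<iota>\<close> with inverse
  \<open>\<kappa>\<close>; conjugation with these reduces the two factorization problems to \<open>factor_from\<close> and
  \<open>factor_into\<close>.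
\<close>

lemma hom_family_tac:
  assumes X: "X \<in> factorizations S C f"
  shows "hom_family X \<in> tac_complexes R (hom_category S f C)"
proof -
  define U where "U = unroll X"
  let ?T = "hom_family X"
  note fX = factorizationD[OF X]
  have UC: "cmp U i \<in> C" for i by (simp add: U_def unroll_simps fX(2))
  have T: "cmp ?T i = HomR (cmp U i)" "dif ?T i = hom_map (cmp U i) (dif U i)" for i
    by (simp_all add: hom_family_simps U_def unroll_simps)
  note fam = module_familyD[OF hom_family_is_family[OF fX(1)]]
  have per: "cmp U (i + 1) = cmp U (i - 1)" "dif U (i + 1) = dif U (i - 1)" for i
    by (simp_all only: U_def unroll_period)
  note dU = unroll_d(1,2,3)[OF X, folded U_def]
  have dd: "dif ?T i (dif ?T (i + 1) h) = \<zero>\<^bsub>cmp ?T (i - 1)\<^esub>" if "h \<in> carrier (cmp ?T (i + 1))" for i h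
    using hom_family_d_d[OF X that] by simp
  have d_closed: "dif ?T (i + 1) h \<in> carrier (cmp ?T i)" if "h \<in> carrier (cmp ?T (i + 1))" for i h
    by (rule linear_maps_closed[OF dif_Suc[OF hom_family_is_family[OF fX(1)]] that])
  have Tper: "cmp ?T (i - 1) = HomR (cmp U (i + 1))" for i by (simp only: T per)

  have "is_complex R ?T"
    unfolding is_complex_def using fam hom_family_d_d[OF X] by blast
  moreover have "acyclic_complex ?T"
    unfolding acyclic_complex_def
  proof (intro allI equalityI subsetI)
    fix i h assume "h \<in> a_kernel (cmp ?T i) (cmp ?T (i - 1)) (dif ?T i)"
    then have h: "h \<in> carrier (cmp ?T i)" "dif ?T i h = \<zero>\<^bsub>cmp ?T (i - 1)\<^esub>"
      by (auto simp: a_kernel_def kernel_def)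
    have "\<exists>h'\<in>carrier (HomR (cmp U (i + 1))). h = hom_map (cmp U (i + 1)) (dif U (i + 1)) h'"
      using h by (intro torsion_exact[OF UC UC dU(1,2,3)]) (simp_all only: T per)
    then show "h \<in> dif ?T (i + 1) ` carrier (cmp ?T (i + 1))" unfolding T by blast
  next
    fix i h assume "h \<in> dif ?T (i + 1) ` carrier (cmp ?T (i + 1))"
    then show "h \<in> a_kernel (cmp ?T i) (cmp ?T (i - 1)) (dif ?T i)"
      using dd d_closed by (auto simp: a_kernel_def kernel_def)
  qed
  moreover have "cmp ?T i \<in> hom_category S f C" for i
  proof -
    have "module_iso R (cmp ?T i) (cmp ?T i)"
      unfolding module_iso_def
      by (rule bexI[OF _ linear_maps_id[OF fam(1)]]) (auto intro!: bij_betwI[where g = "\<lambda>x. x"])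
    then show ?thesis unfolding hom_category_def using fam(1) UC[of i] by (auto simp only: T mem_Collect_eq)
  qed
  moreover have "acyclic_complex (hom_complex_into R ?T W) \<and> acyclic_complex (hom_complex_from R W ?T)"
    if W: "W \<in> hom_category S f C" for W
  proof -
    from W obtain M where W: "module R W" and M: "M \<in> C" and iso: "module_iso R W (HomR M)"
      unfolding hom_category_def by blast
    note TM = hom_module_is_module[OF C_module[OF M]]
    obtain \<iota> where \<iota>: "\<iota> \<in> linear_maps R W (HomR M)"
      "bij_betw \<iota> (carrier W) (carrier (HomR M))" using iso unfolding module_iso_def by auto
    obtain \<kappa> where \<kappa>: "\<kappa> \<in> linear_maps R (HomR M) W"
      "\<And>w. w \<in> carrier W \<Longrightarrow> \<kappa> (\<iota> w) = w" "\<And>h. h \<in> carrier (HomR M) \<Longrightarrow> \<iota> (\<kappa> h) = h"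
      using linear_maps_inverse[OF \<iota> W TM] by metis
    have from_W: "\<exists>\<Psi>\<in>linear_maps R W (cmp ?T (i + 1)). \<Phi> = compose (carrier W) (dif ?T (i + 1)) \<Psi>"
      if \<Phi>: "\<Phi> \<in> linear_maps R W (cmp ?T i)" and zero: "\<And>w. w \<in> carrier W \<Longrightarrow> dif ?T i (\<Phi> w) = \<zero>\<^bsub>cmp ?T (i - 1)\<^esub>"
      for i \<Phi>
    proof -
      let ?\<Phi>' = "compose (carrier (HomR M)) \<Phi> \<kappa>"
      have \<Phi>': "?\<Phi>' \<in> linear_maps R (HomR M) (HomR (cmp U i))"
        using linear_maps_comp[OF \<kappa>(1) \<Phi> TM] by (simp only: T)
      have "\<exists>\<Psi>\<in>linear_maps R (HomR M) (HomR (cmp U (i + 1))).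
          \<forall>h\<in>carrier (HomR M). ?\<Phi>' h = hom_map (cmp U (i + 1)) (dif U (i + 1)) (\<Psi> h)"
      proof (rule factor_from[OF UC UC M dU(1,2,3) \<Phi>'])
        fix h assume h: "h \<in> carrier (HomR M)"
        show "hom_map (cmp U i) (dif U i) (?\<Phi>' h) = \<zero>\<^bsub>HomR (cmp U (i + 1))\<^esub>"
          using zero[OF linear_maps_closed[OF \<kappa>(1) h]] h unfolding T per by (simp add: compose_def)
      qed
      then obtain \<Psi> where \<Psi>: "\<Psi> \<in> linear_maps R (HomR M) (cmp ?T (i + 1))"
        "\<And>h. h \<in> carrier (HomR M) \<Longrightarrow> \<Phi> (\<kappa> h) = dif ?T (i + 1) (\<Psi> h)"
        unfolding T by (auto simp: compose_def)
      have \<Psi>\<iota>: "compose (carrier W) \<Psi> \<iota> \<in> linear_maps R W (cmp ?T (i + 1))"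
        by (rule linear_maps_comp[OF \<iota>(1) \<Psi>(1) W])
      have "\<Phi> = compose (carrier W) (dif ?T (i + 1)) (compose (carrier W) \<Psi> \<iota>)"
      proof (rule linear_maps_eqI[OF \<Phi> linear_maps_comp[OF \<Psi>\<iota> dif_Suc[OF hom_family_is_family[OF fX(1)]] W]])
        fix w assume w: "w \<in> carrier W"
        show "\<Phi> w = compose (carrier W) (dif ?T (i + 1)) (compose (carrier W) \<Psi> \<iota>) w"
          using w \<Psi>(2)[OF linear_maps_closed[OF \<iota>(1) w]] \<kappa>(2)[OF w] by (simp add: compose_def)
      qed
      with \<Psi>\<iota> show ?thesis by blast
    qed
    have into_W: "\<exists>\<Psi>\<in>linear_maps R (cmp ?T (i - 1)) W. \<Phi> = compose (carrier (cmp ?T i)) \<Psi> (dif ?T i)"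
      if \<Phi>: "\<Phi> \<in> linear_maps R (cmp ?T i) W"
        and zero: "\<And>h. h \<in> carrier (cmp ?T (i + 1)) \<Longrightarrow> \<Phi> (dif ?T (i + 1) h) = \<zero>\<^bsub>W\<^esub>"
      for i \<Phi>
    proof -
      let ?\<Phi>' = "compose (carrier (cmp ?T i)) \<iota> \<Phi>"
      have \<Phi>': "?\<Phi>' \<in> linear_maps R (HomR (cmp U i)) (HomR M)"
        using linear_maps_comp[OF \<Phi> \<iota>(1) fam(1)] by (simp only: T)
      have "\<exists>\<Psi>\<in>linear_maps R (HomR (cmp U (i + 1))) (HomR M).
          \<forall>h\<in>carrier (HomR (cmp U i)). ?\<Phi>' h = \<Psi> (hom_map (cmp U i) (dif U i) h)"
      proof (rule factor_into[OF UC UC M dU(1,2,3) \<Phi>'])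
        fix h assume "h \<in> carrier (HomR (cmp U (i + 1)))"
        then have h: "h \<in> carrier (cmp ?T (i + 1))" by (simp only: T)
        show "?\<Phi>' (hom_map (cmp U (i + 1)) (dif U (i + 1)) h) = \<zero>\<^bsub>HomR M\<^esub>"
          using zero[OF h] d_closed[OF h] linear_maps_zero[OF \<iota>(1) W TM] unfolding T by (simp add: compose_def)
      qed
      then have "\<exists>\<Psi>\<in>linear_maps R (cmp ?T (i - 1)) (HomR M).
          \<forall>h\<in>carrier (cmp ?T i). ?\<Phi>' h = \<Psi> (dif ?T i h)"
        unfolding Tper unfolding T .
      then obtain \<Psi> where \<Psi>: "\<Psi> \<in> linear_maps R (cmp ?T (i - 1)) (HomR M)"
        "\<And>h. h \<in> carrier (cmp ?T i) \<Longrightarrow> \<iota> (\<Phi> h) = \<Psi> (dif ?T i h)"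
        by (auto simp: compose_def)
      have \<kappa>\<Psi>: "compose (carrier (cmp ?T (i - 1))) \<kappa> \<Psi> \<in> linear_maps R (cmp ?T (i - 1)) W"
        by (rule linear_maps_comp[OF \<Psi>(1) \<kappa>(1) fam(1)])
      have "\<Phi> = compose (carrier (cmp ?T i)) (compose (carrier (cmp ?T (i - 1))) \<kappa> \<Psi>) (dif ?T i)"
      proof (rule linear_maps_eqI[OF \<Phi> linear_maps_comp[OF fam(2) \<kappa>\<Psi> fam(1)]])
        fix h assume h: "h \<in> carrier (cmp ?T i)"
        show "\<Phi> h = compose (carrier (cmp ?T i)) (compose (carrier (cmp ?T (i - 1))) \<kappa> \<Psi>) (dif ?T i) h"
          using h linear_maps_closed[OF fam(2) h] \<kappa>(2)[OF linear_maps_closed[OF \<Phi> h]]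
          by (simp add: compose_def flip: \<Psi>(2))
      qed
      with \<kappa>\<Psi> show ?thesis by blast
    qed
    note famT = hom_family_is_family[OF fX(1)]
    show ?thesis
      using acyclic_hom_complex_fromI[OF famT W dd from_W] acyclic_hom_complex_intoI[OF famT W dd into_W] by blast
  qed
  ultimately show ?thesis unfolding tac_complexes_def by blast
qed

end

section \<open>The full and faithful triangulated functor\<close>

theorem theorem3p6:
  fixes S :: "('s, 'e) ring_scheme" and C :: "('s, 'm) module set" and f :: 's
  assumes "cring S"
    and "additive_subcategory S C"
    and "self_orthogonal S C"
    and "regular_element S f"
    and "divisible_category C f"
  shows "\<exists>Fo Fm.
    triangulated_functor (HF S C f) (K_tac (quotient_ring S f) (hom_category S f C)) Fo Fm \<and>
    full_functor (HF S C f) (K_tac (quotient_ring S f) (hom_category S f C)) Fo Fm \<and>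
    faithful_functor (HF S C f) Fm"
proof -
  have module_C: "\<And>M. M \<in> C \<Longrightarrow> module S M"
    using assms(2) unfolding additive_subcategory_def by blast
  have divisible_C: "\<And>M. M \<in> C \<Longrightarrow> divisible_module M f"
    using assms(5) unfolding divisible_category_def by blast
  have Ext_C: "\<And>M N. M \<in> C \<Longrightarrow> N \<in> C \<Longrightarrow> trivial_group (Ext S 1 M N)"
    using assms(3) unfolding self_orthogonal_def by blast
  have f: "f \<in> carrier S" using assms(4) unfolding regular_element_def by blast
  interpret factorization_category S f C
    by (rule factorization_category.intro[OF principal_quotient.intro[OF assms(1) principal_quotient_axioms.intro[OF f]]
          factorization_category_axioms.intro[OF module_C divisible_C Ext_C]])
  let ?A = "HF S C f" and ?B = "K_tac (quotient_ring S f) (hom_category S f C)"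
  have "triangulated_functor ?A ?B hom_family hom_class"
    unfolding HF_def K_tac_def
    by (rule hom_triangulated_functor) (use factorizationD(1) hom_family_tac in auto)
  moreover have "full_functor ?A ?B hom_family hom_class"
    unfolding full_functor_def HF_def K_tac_def homotopy_category_simps
  proof (intro ballI)
    fix X Y k assume X: "X \<in> factorizations S C f" and Y: "Y \<in> factorizations S C f"
      and k: "k \<in> chain_maps R (hom_family X) (hom_family Y) // homotopy_rel R (hom_family X) (hom_family Y)"
    note fX = factorizationD(1)[OF X] and fY = factorizationD(1)[OF Y]
    obtain \<phi> where \<phi>: "\<phi> \<in> chain_maps R (hom_family X) (hom_family Y)"
      "k = homotopy_rel R (hom_family X) (hom_family Y) `` {\<phi>}" using k by (rule homotopy_classE)
    obtain g where g: "g \<in> chain_maps S X Y" "(hom_chain X g, \<phi>) \<in> homotopy_rel R (hom_family X) (hom_family Y)"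
      using hom_chain_full[OF X Y \<phi>(1)] by blast
    have "hom_class X Y (homotopy_rel S X Y `` {g}) = k"
      unfolding hom_class[OF fX fY g(1)] \<phi>(2)
      by (rule homotopy_class_eqI[OF hom_family_is_family[OF fX] hom_family_is_family[OF fY] g(2)])
    then show "\<exists>u\<in>chain_maps S X Y // homotopy_rel S X Y. hom_class X Y u = k"
      using quotientI[OF g(1)] by blast
  qed
  moreover have "faithful_functor ?A hom_class"
    unfolding faithful_functor_def HF_def homotopy_category_simps
  proof (intro ballI inj_onI)
    fix X Y u v assume X: "X \<in> factorizations S C f" and Y: "Y \<in> factorizations S C f"
      and u: "u \<in> chain_maps S X Y // homotopy_rel S X Y" and v: "v \<in> chain_maps S X Y // homotopy_rel S X Y"
      and eq: "hom_class X Y u = hom_class X Y v"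
    note fX = factorizationD(1)[OF X] and fY = factorizationD(1)[OF Y]
    obtain \<alpha> where \<alpha>: "\<alpha> \<in> chain_maps S X Y" "u = homotopy_rel S X Y `` {\<alpha>}" using u by (rule homotopy_classE)
    obtain \<beta> where \<beta>: "\<beta> \<in> chain_maps S X Y" "v = homotopy_rel S X Y `` {\<beta>}" using v by (rule homotopy_classE)
    have "(hom_chain X \<alpha>, hom_chain X \<beta>) \<in> homotopy_rel R (hom_family X) (hom_family Y)"
      using eq unfolding \<alpha>(2) \<beta>(2) hom_class[OF fX fY \<alpha>(1)] hom_class[OF fX fY \<beta>(1)]
        homotopy_class_eq_iff[OF hom_family_is_family[OF fX] hom_family_is_family[OF fY]
          hom_chain_maps[OF fX fY \<alpha>(1)] hom_chain_maps[OF fX fY \<beta>(1)]] .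
    from homotopy_class_eqI[OF fX fY hom_chain_faithful[OF X Y \<alpha>(1) \<beta>(1) this]]
    show "u = v" unfolding \<alpha>(2) \<beta>(2) .
  qed
  ultimately show ?thesis by blast
qed

end
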